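(* Let $K$ be a locally essentially small 2-category with a class of 1-arrows $W$ satisfying BF1, BF2, BF3 and BF4. If there is a locally small cofinal class $V\subset W$, then the bicategory of fractions $K[W^{-1}]$ is locally essentially small.
   Context: A 2-category or bicategory is locally essentially small if each hom-category is equivalent to a small category. 2-categories here need not be small. Let $A$ be a class of 1-arrows in a 2-category and $A'\subset A$ a subclass. $A'$ is cofinal in $A$ if for every $f\colon x\to y$ in $A$ there are $g\colon z\to y$ in $A'$ and $s\colon z\to x$ with $f\circ s\simeq g$ (isomorphic via an invertible 2-arrow). $A'$ is a locally small cofinal class if, in addition, for every object $y$ the arrows in $A'$ with codomain $y$ form a set (as opposed to a proper class). Conditions on a class $W$ of 1-arrows in $K$: BF1: $W$ contains all equivalences. BF2: $W$ is closed under composition and isomorphism (if $w\in W$ and there is an invertible 2-arrow $w\Rightarrow f$ then $f\in W$). BF3: for all $w\colon a'\to a$ and $f\colon c\to a$ with $w\in W$ there are an object $p$, 1-arrows $v\colon p\to c$ and $g\colon p\to a'$ with $v\in W$, and an invertible 2-arrow $w\circ g\Rightarrow f\circ v$. BF4: if $\alpha\colon w\circ f\Rightarrow w\circ g$ is a 2-arrow and $w\in W$, there is a 1-arrow $v\in W$ and a 2-arrow $\beta\colon f\circ v\Rightarrow g\circ v$ such that $\alpha\circ v=w\circ\beta$ (whiskering is denoted $\circ$). Moreover: when $\alpha$ is an isomorphism, $\beta$ is required to be an isomorphism too; and when $v',\beta'$ form another such pair, there exist 1-arrows $u,u'$ such that $v\circ u$ and $v'\circ u'$ are in $W$, and an invertible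 2-arrow $\epsilon\colon v\circ u\Rightarrow v'\circ u'$, such that $(g\circ\epsilon)\cdot(\beta\circ u)=(\beta'\circ u')\cdot(f\circ\epsilon)$. When BF1–BF4 hold, $K[W^{-1}]$ denotes Pronk's bicategory of fractions. It has the objects of $K$ and comes with a functor $K\to K[W^{-1}]$ that is the localisation of $K$ at $W$ (it sends the arrows of $W$ to equivalences, and precomposition with it gives an equivalence from the hom-bicategory of functors $K[W^{-1}]\to A$ to that of functors $K\to A$ sending arrows of $W$ to equivalences, for every bicategory $A$). Its hom-categories are as follows. The 1-arrows from $x$ to $y$ are spans $x\xleftarrow{w}u\xrightarrow{f}y$ with $w\in W$. A 2-arrow $(w_1,f_1)\Rightarrow(w_2,f_2)$, where $w_i\colon u_i\to x$, $f_i\colon u_i\to y$, is represented by data $(v,p_1,p_2,\alpha,\beta)$ with $p_i\colon v\to u_i$, $w_i\circ p_i\in W$ for $i=1,2$, $\alpha\colon w_1\circ p_1\Rightarrow w_2\circ p_2$ invertible, and $\beta\colon f_1\circ p_1\Rightarrow f_2\circ p_2$. Two such data $(v,p_1,p_2,\alpha,\beta)$ and $(v',p_1',p_2',\alpha',\beta')$ are equivalent if there are 1-arrows $q\colon t\to v$, $q'\colon t\to v'$ and invertible 2-arrows $\gamma_1\colon p_1'\circ q'\Rightarrow p_1\circ q$, $\gamma_2\colon p_2\circ q\Rightarrow p_2'\circ q'$ such that $w_1\circ p_1\circ q$ and $w_1\circ p_1'\circ q'$ are in $W$, $(w_2\circ\gamma_2)\cdot(\alpha\circ q)\cdot(w_1\circ\gamma_1)=\alpha'\circ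 q'$, and $(f_2\circ\gamma_2)\cdot(\beta\circ q)\cdot(f_1\circ\gamma_1)=\beta'\circ q'$. A 2-arrow is an equivalence class of such data. Vertical composition is the standard one: for data $(v,p_1,p_2,\alpha,\beta)$ from $(w_1,f_1)$ to $(w_2,f_2)$ and $(v',p_1',p_2',\alpha',\beta')$ from $(w_2,f_2)$ to $(w_3,f_3)$, choose $r\colon t\to v$, $r'\colon t\to v'$ and an invertible $\delta\colon p_2\circ r\Rightarrow p_1'\circ r'$ with $w_1\circ p_1\circ r\in W$, and take the class of $(t,\,p_1\circ r,\,p_2'\circ r')$ with the evident pasted 2-arrows. *)

theory Defs
  imports Main
begin

unbundle cardinal_syntax

section \<open>Categories and their equivalences\<close>

text \<open>
  Categories have a carrier set of objects and a carrier set of arrows inside arbitrary types;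
  these carriers play the role of the (possibly proper) classes of objects and arrows.
  Composition is written in applicative order: \<open>Cmp C g f\<close> is \<open>g \<circ> f\<close>.
\<close>

record ('o, 'a) precategory =
  Obj :: "'o set"
  Arr :: "'a set"
  Dom :: "'a \<Rightarrow> 'o"
  Cod :: "'a \<Rightarrow> 'o"
  Ide :: "'o \<Rightarrow> 'a"
  Cmp :: "'a \<Rightarrow> 'a \<Rightarrow> 'a"

definition hom :: "('o, 'a) precategory \<Rightarrow> 'o \<Rightarrow> 'o \<Rightarrow> 'a set" where
  "hom C x y = {f \<in> Arr C. Dom C f = x \<and> Cod C f = y}"

locale category =
  fixes C :: "('o, 'a) precategory"
  assumes dom_obj: "f \<in> Arr C \<Longrightarrow> Dom C f \<in> Obj C"
    and cod_obj: "f \<in> Arr C \<Longrightarrow> Cod C f \<in> Obj C"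
    and ide_hom: "x \<in> Obj C \<Longrightarrow> Ide C x \<in> hom C x x"
    and cmp_hom: "f \<in> hom C x y \<Longrightarrow> g \<in> hom C y z \<Longrightarrow> Cmp C g f \<in> hom C x z"
    and cmp_ide_right: "f \<in> hom C x y \<Longrightarrow> Cmp C f (Ide C x) = f"
    and cmp_ide_left: "f \<in> hom C x y \<Longrightarrow> Cmp C (Ide C y) f = f"
    and cmp_assoc: "f \<in> hom C x y \<Longrightarrow> g \<in> hom C y z \<Longrightarrow> h \<in> hom C z t
      \<Longrightarrow> Cmp C (Cmp C h g) f = Cmp C h (Cmp C g f)"

definition isos :: "('o, 'a) precategory \<Rightarrow> 'o \<Rightarrow> 'o \<Rightarrow> 'a set" where
  "isos C x y = {f \<in> hom C x y. \<exists>g \<in> hom C y x. Cmp C g f = Ide C x \<and> Cmp C f g = Ide C y}"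

locale cat_functor =
  fixes C :: "('o, 'a) precategory" and D :: "('p, 'b) precategory"
    and F0 :: "'o \<Rightarrow> 'p" and F1 :: "'a \<Rightarrow> 'b"
  assumes map_obj: "x \<in> Obj C \<Longrightarrow> F0 x \<in> Obj D"
    and map_hom: "f \<in> hom C x y \<Longrightarrow> F1 f \<in> hom D (F0 x) (F0 y)"
    and map_ide: "x \<in> Obj C \<Longrightarrow> F1 (Ide C x) = Ide D (F0 x)"
    and map_cmp: "f \<in> hom C x y \<Longrightarrow> g \<in> hom C y z \<Longrightarrow> F1 (Cmp C g f) = Cmp D (F1 g) (F1 f)"

locale nat_iso =
  fixes C :: "('o, 'a) precategory" and D :: "('p, 'b) precategory"
    and F0 :: "'o \<Rightarrow> 'p" and F1 :: "'a \<Rightarrow> 'b" and G0 :: "'o \<Rightarrow> 'p" and G1 :: "'a \<Rightarrow> 'b"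
    and \<eta> :: "'o \<Rightarrow> 'b"
  assumes component: "x \<in> Obj C \<Longrightarrow> \<eta> x \<in> isos D (F0 x) (G0 x)"
    and naturality: "f \<in> hom C x y \<Longrightarrow> Cmp D (\<eta> y) (F1 f) = Cmp D (G1 f) (\<eta> x)"

definition equivalent_categories ::
    "('o, 'a) precategory \<Rightarrow> ('p, 'b) precategory \<Rightarrow> bool" where
  "equivalent_categories C D \<longleftrightarrow> category C \<and> category D \<and>
    (\<exists>F0 F1 G0 G1 \<eta> \<epsilon>.
      cat_functor C D F0 F1 \<and> cat_functor D C G0 G1 \<and>
      nat_iso C C (\<lambda>x. x) (\<lambda>f. f) (\<lambda>x. G0 (F0 x)) (\<lambda>f. G1 (F1 f)) \<eta> \<and>
      nat_iso D D (\<lambda>x. F0 (G0 x)) (\<lambda>f. F1 (G1 f)) (\<lambda>x. x) (\<lambda>f. f) \<epsilon>)"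


section \<open>Size\<close>

text \<open>
  The distinction between sets and proper classes is expressed relative to an infinite regular
  cardinal \<open>\<kappa>\<close>: a class is a set if it has fewer than \<open>\<kappa>\<close> elements. Strongly
  inaccessible \<open>\<kappa>\<close> (that is, Grothendieck universes) are instances; requiring only
  regularity keeps HOL instances such as the successor of an infinite cardinal.
\<close>

definition size_cardinal :: "'k rel \<Rightarrow> bool" where
  "size_cardinal \<kappa> \<longleftrightarrow> Cinfinite \<kappa> \<and> regularCard \<kappa>"

definition small :: "'k rel \<Rightarrow> 'a set \<Rightarrow> bool" where
  "small \<kappa> A \<longleftrightarrow> |A| <o \<kappa>"

definition small_category :: "'k rel \<Rightarrow> ('o, 'a) precategory \<Rightarrow> bool" where
  "small_category \<kappa> C \<longleftrightarrow> category C \<and> small \<kappa> (Obj C) \<and> small \<kappa> (Arr C)"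

text \<open>
  HOL has no quantification over types. Since a small set injects into the field of \<open>\<kappa>\<close>,
  every small category is isomorphic to one with carriers in the type underlying \<open>\<kappa>\<close>, so
  quantifying over the latter loses no small category.
\<close>

definition essentially_small :: "'k rel \<Rightarrow> ('o, 'a) precategory \<Rightarrow> bool" where
  "essentially_small \<kappa> C \<longleftrightarrow>
    (\<exists>D :: ('k, 'k) precategory. small_category \<kappa> D \<and> equivalent_categories C D)"

text \<open>
  Local essential smallness of a 2-category or bicategory depends only on its objects
  \<open>X\<close> and its hom-categories \<open>H x y\<close>.
\<close>

definition locally_essentially_small ::
    "'k rel \<Rightarrow> 'x set \<Rightarrow> ('x \<Rightarrow> 'x \<Rightarrow> ('o, 'a) precategory) \<Rightarrow> bool" where
  "locally_essentially_small \<kappa> X H \<longleftrightarrow> (\<forall>x \<in> X. \<forall>y \<in> X. essentially_small \<kappa> (H x y))"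


section \<open>Strict 2-categories\<close>

text \<open>
  \<open>src\<close>, \<open>tgt\<close> are the end objects of a 1-arrow; \<open>src2\<close>, \<open>tgt2\<close> are the end 1-arrows of
  a 2-arrow. All compositions are in applicative order.
\<close>

record ('o, 'a, 'c) two_precategory =
  Ob :: "'o set"
  Ar1 :: "'a set"
  Ar2 :: "'c set"
  src :: "'a \<Rightarrow> 'o"
  tgt :: "'a \<Rightarrow> 'o"
  src2 :: "'c \<Rightarrow> 'a"
  tgt2 :: "'c \<Rightarrow> 'a"
  id1 :: "'o \<Rightarrow> 'a"
  id2 :: "'a \<Rightarrow> 'c"
  comp1 :: "'a \<Rightarrow> 'a \<Rightarrow> 'a" (infixr "\<odot>\<index>" 72)
  vcomp :: "'c \<Rightarrow> 'c \<Rightarrow> 'c" (infixr "\<cdot>\<index>" 66)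
  hcomp :: "'c \<Rightarrow> 'c \<Rightarrow> 'c" (infixr "\<star>\<index>" 72)

definition cat1 :: "('o, 'a, 'c) two_precategory \<Rightarrow> ('o, 'a) precategory" where
  "cat1 K = \<lparr>Obj = Ob K, Arr = Ar1 K, Dom = src K, Cod = tgt K, Ide = id1 K, Cmp = comp1 K\<rparr>"

definition vcat :: "('o, 'a, 'c) two_precategory \<Rightarrow> ('a, 'c) precategory" where
  "vcat K = \<lparr>Obj = Ar1 K, Arr = Ar2 K, Dom = src2 K, Cod = tgt2 K, Ide = id2 K, Cmp = vcomp K\<rparr>"

definition hcat :: "('o, 'a, 'c) two_precategory \<Rightarrow> ('o, 'c) precategory" where
  "hcat K = \<lparr>Obj = Ob K, Arr = Ar2 K,
     Dom = (\<lambda>\<alpha>. src K (src2 K \<alpha>)), Cod = (\<lambda>\<alpha>. tgt K (src2 K \<alpha>)),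
     Ide = (\<lambda>x. id2 K (id1 K x)), Cmp = hcomp K\<rparr>"

locale two_category =
  fixes K :: "('o, 'a, 'c) two_precategory" (structure)
  assumes category_cat1: "category (cat1 K)"
    and category_vcat: "category (vcat K)"
    and category_hcat: "category (hcat K)"
    and parallel: "\<alpha> \<in> Ar2 K \<Longrightarrow> src K (src2 K \<alpha>) = src K (tgt2 K \<alpha>)
      \<and> tgt K (src2 K \<alpha>) = tgt K (tgt2 K \<alpha>)"
    and hcomp_src2: "\<alpha> \<in> hom (hcat K) x y \<Longrightarrow> \<beta> \<in> hom (hcat K) y z
      \<Longrightarrow> src2 K (\<beta> \<star> \<alpha>) = src2 K \<beta> \<odot> src2 K \<alpha>"
    and hcomp_tgt2: "\<alpha> \<in> hom (hcat K) x y \<Longrightarrow> \<beta> \<in> hom (hcat K) y z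
      \<Longrightarrow> tgt2 K (\<beta> \<star> \<alpha>) = tgt2 K \<beta> \<odot> tgt2 K \<alpha>"
    and hcomp_id2: "f \<in> hom (cat1 K) x y \<Longrightarrow> g \<in> hom (cat1 K) y z
      \<Longrightarrow> id2 K g \<star> id2 K f = id2 K (g \<odot> f)"
    and interchange: "\<lbrakk>\<alpha> \<in> hom (vcat K) f f'; \<alpha>' \<in> hom (vcat K) f' f'';
        \<beta> \<in> hom (vcat K) g g'; \<beta>' \<in> hom (vcat K) g' g''; tgt K f = src K g\<rbrakk>
      \<Longrightarrow> (\<beta>' \<cdot> \<beta>) \<star> (\<alpha>' \<cdot> \<alpha>) = (\<beta>' \<star> \<alpha>') \<cdot> (\<beta> \<star> \<alpha>)"

definition hom_category ::
    "('o, 'a, 'c) two_precategory \<Rightarrow> 'o \<Rightarrow> 'o \<Rightarrow> ('a, 'c) precategory" where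
  "hom_category K x y = \<lparr>Obj = hom (cat1 K) x y, Arr = hom (hcat K) x y,
     Dom = src2 K, Cod = tgt2 K, Ide = id2 K, Cmp = vcomp K\<rparr>"

abbreviation iso2 :: "('o, 'a, 'c) two_precategory \<Rightarrow> 'a \<Rightarrow> 'a \<Rightarrow> 'c set" where
  "iso2 K f g \<equiv> isos (vcat K) f g"

text \<open>Whiskerings \<open>w \<circ> \<beta>\<close> and \<open>\<alpha> \<circ> v\<close>.\<close>

abbreviation lwhisker :: "('o, 'a, 'c) two_precategory \<Rightarrow> 'a \<Rightarrow> 'c \<Rightarrow> 'c" where
  "lwhisker K w \<beta> \<equiv> hcomp K (id2 K w) \<beta>"

abbreviation rwhisker :: "('o, 'a, 'c) two_precategory \<Rightarrow> 'c \<Rightarrow> 'a \<Rightarrow> 'c" where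
  "rwhisker K \<alpha> v \<equiv> hcomp K \<alpha> (id2 K v)"

definition equivalence1 :: "('o, 'a, 'c) two_precategory \<Rightarrow> 'a \<Rightarrow> bool" where
  "equivalence1 K f \<longleftrightarrow> f \<in> Ar1 K \<and> (\<exists>g \<in> hom (cat1 K) (tgt K f) (src K f).
     iso2 K (comp1 K g f) (id1 K (src K f)) \<noteq> {} \<and>
     iso2 K (comp1 K f g) (id1 K (tgt K f)) \<noteq> {})"


section \<open>Cofinal classes\<close>

definition cofinal_class :: "('o, 'a, 'c) two_precategory \<Rightarrow> 'a set \<Rightarrow> 'a set \<Rightarrow> bool" where
  "cofinal_class K A' A \<longleftrightarrow> A' \<subseteq> A \<and>
    (\<forall>f \<in> A. \<exists>g \<in> A'. \<exists>s \<in> hom (cat1 K) (src K g) (src K f).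
      tgt K g = tgt K f \<and> iso2 K (comp1 K f s) g \<noteq> {})"

definition locally_small_cofinal_class ::
    "'k rel \<Rightarrow> ('o, 'a, 'c) two_precategory \<Rightarrow> 'a set \<Rightarrow> 'a set \<Rightarrow> bool" where
  "locally_small_cofinal_class \<kappa> K A' A \<longleftrightarrow> cofinal_class K A' A \<and>
    (\<forall>y \<in> Ob K. small \<kappa> {g \<in> A'. tgt K g = y})"


section \<open>Conditions for a bicategory of fractions\<close>

definition BF1 :: "('o, 'a, 'c) two_precategory \<Rightarrow> 'a set \<Rightarrow> bool" where
  "BF1 K W \<longleftrightarrow> (\<forall>f. equivalence1 K f \<longrightarrow> f \<in> W)"

definition BF2 :: "('o, 'a, 'c) two_precategory \<Rightarrow> 'a set \<Rightarrow> bool" where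
  "BF2 K W \<longleftrightarrow>
    (\<forall>w \<in> W. \<forall>w' \<in> W. tgt K w = src K w' \<longrightarrow> comp1 K w' w \<in> W) \<and>
    (\<forall>w \<in> W. \<forall>f \<in> Ar1 K. iso2 K w f \<noteq> {} \<longrightarrow> f \<in> W)"

definition BF3 :: "('o, 'a, 'c) two_precategory \<Rightarrow> 'a set \<Rightarrow> bool" where
  "BF3 K W \<longleftrightarrow> (\<forall>w \<in> W. \<forall>f \<in> Ar1 K. tgt K f = tgt K w \<longrightarrow>
    (\<exists>p \<in> Ob K. \<exists>v \<in> hom (cat1 K) p (src K f). \<exists>g \<in> hom (cat1 K) p (src K w).
      v \<in> W \<and> iso2 K (comp1 K w g) (comp1 K f v) \<noteq> {}))"

text \<open>
  \<open>BF4_pair K W w f g \<alpha> v \<beta>\<close>: the pair \<open>v, \<beta>\<close> is as required in BF4 for the 2-arrow \<open>\<alpha>\<close>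
  from \<open>w \<circ> f\<close> to \<open>w \<circ> g\<close>, including invertibility of \<open>\<beta>\<close> if \<open>\<alpha>\<close> is invertible. The
  same requirements apply to the pair and to the other pairs it is compared with.
\<close>

definition BF4_pair ::
    "('o, 'a, 'c) two_precategory \<Rightarrow> 'a set \<Rightarrow> 'a \<Rightarrow> 'a \<Rightarrow> 'a \<Rightarrow> 'c \<Rightarrow> 'a \<Rightarrow> 'c \<Rightarrow> bool" where
  "BF4_pair K W w f g \<alpha> v \<beta> \<longleftrightarrow>
    v \<in> W \<and> tgt K v = src K f \<and>
    \<beta> \<in> hom (vcat K) (comp1 K f v) (comp1 K g v) \<and>
    rwhisker K \<alpha> v = lwhisker K w \<beta> \<and>
    (\<alpha> \<in> iso2 K (comp1 K w f) (comp1 K w g) \<longrightarrow> \<beta> \<in> iso2 K (comp1 K f v) (comp1 K g v))"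

definition BF4 :: "('o, 'a, 'c) two_precategory \<Rightarrow> 'a set \<Rightarrow> bool" where
  "BF4 K W \<longleftrightarrow> (\<forall>w \<in> W. \<forall>x \<in> Ob K.
    \<forall>f \<in> hom (cat1 K) x (src K w). \<forall>g \<in> hom (cat1 K) x (src K w).
    \<forall>\<alpha> \<in> hom (vcat K) (comp1 K w f) (comp1 K w g).
      \<exists>v \<beta>. BF4_pair K W w f g \<alpha> v \<beta> \<and>
        (\<forall>v' \<beta>'. BF4_pair K W w f g \<alpha> v' \<beta>' \<longrightarrow>
          (\<exists>t \<in> Ob K. \<exists>u \<in> hom (cat1 K) t (src K v). \<exists>u' \<in> hom (cat1 K) t (src K v').
             comp1 K v u \<in> W \<and> comp1 K v' u' \<in> W \<and>
             (\<exists>\<epsilon> \<in> iso2 K (comp1 K v u) (comp1 K v' u').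
                vcomp K (lwhisker K g \<epsilon>) (rwhisker K \<beta> u)
                  = vcomp K (rwhisker K \<beta>' u') (lwhisker K f \<epsilon>)))))"

section \<open>The hom-categories of the bicategory of fractions\<close>

text \<open>
  A span is the pair \<open>(w, f)\<close> of its legs; a representative of a 2-arrow is
  \<open>(p\<^sub>1, p\<^sub>2, \<alpha>, \<beta>)\<close>. The apex of the span and the object \<open>v\<close> of the
  representative are the common sources of the 1-arrows and hence not recorded.
\<close>

type_synonym 'a span = "'a \<times> 'a"
type_synonym ('a, 'c) rep = "'a \<times> 'a \<times> 'c \<times> 'c"

definition spans :: "('o, 'a, 'c) two_precategory \<Rightarrow> 'a set \<Rightarrow> 'o \<Rightarrow> 'o \<Rightarrow> 'a span set" where
  "spans K W x y =
    {(w, f). w \<in> W \<and> f \<in> Ar1 K \<and> src K w = src K f \<and> tgt K w = x \<and> tgt K f = y}"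

fun reps :: "('o, 'a, 'c) two_precategory \<Rightarrow> 'a set \<Rightarrow> 'a span \<Rightarrow> 'a span \<Rightarrow> ('a, 'c) rep set" where
  "reps K W (w1, f1) (w2, f2) =
    {(p1, p2, \<alpha>, \<beta>). \<exists>v \<in> Ob K.
       p1 \<in> hom (cat1 K) v (src K w1) \<and> p2 \<in> hom (cat1 K) v (src K w2) \<and>
       comp1 K w1 p1 \<in> W \<and> comp1 K w2 p2 \<in> W \<and>
       \<alpha> \<in> iso2 K (comp1 K w1 p1) (comp1 K w2 p2) \<and>
       \<beta> \<in> hom (vcat K) (comp1 K f1 p1) (comp1 K f2 p2)}"

fun rep_equiv ::
    "('o, 'a, 'c) two_precategory \<Rightarrow> 'a set \<Rightarrow> 'a span \<Rightarrow> 'a span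
      \<Rightarrow> ('a, 'c) rep \<Rightarrow> ('a, 'c) rep \<Rightarrow> bool" where
  "rep_equiv K W (w1, f1) (w2, f2) (p1, p2, \<alpha>, \<beta>) (p1', p2', \<alpha>', \<beta>') \<longleftrightarrow>
    (\<exists>t \<in> Ob K. \<exists>q \<in> hom (cat1 K) t (src K p1). \<exists>q' \<in> hom (cat1 K) t (src K p1').
     \<exists>\<gamma>1 \<in> iso2 K (comp1 K p1' q') (comp1 K p1 q).
     \<exists>\<gamma>2 \<in> iso2 K (comp1 K p2 q) (comp1 K p2' q').
       comp1 K w1 (comp1 K p1 q) \<in> W \<and> comp1 K w1 (comp1 K p1' q') \<in> W \<and>
       vcomp K (lwhisker K w2 \<gamma>2) (vcomp K (rwhisker K \<alpha> q) (lwhisker K w1 \<gamma>1))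
         = rwhisker K \<alpha>' q' \<and>
       vcomp K (lwhisker K f2 \<gamma>2) (vcomp K (rwhisker K \<beta> q) (lwhisker K f1 \<gamma>1))
         = rwhisker K \<beta>' q')"

definition rep_rel ::
    "('o, 'a, 'c) two_precategory \<Rightarrow> 'a set \<Rightarrow> 'a span \<Rightarrow> 'a span
      \<Rightarrow> (('a, 'c) rep \<times> ('a, 'c) rep) set" where
  "rep_rel K W S T =
    {(d, d'). d \<in> reps K W S T \<and> d' \<in> reps K W S T \<and> rep_equiv K W S T d d'}"

text \<open>
  \<open>rep_comp K W S1 S2 S3 d d' e\<close>: the representative \<open>e\<close> arises by composing
  \<open>d\<close> from \<open>S1\<close> to \<open>S2\<close> with \<open>d'\<close> from \<open>S2\<close> to \<open>S3\<close>
  for some choice of \<open>r\<close>, \<open>r'\<close> and \<open>\<delta>\<close>.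
\<close>

fun rep_comp ::
    "('o, 'a, 'c) two_precategory \<Rightarrow> 'a set \<Rightarrow> 'a span \<Rightarrow> 'a span \<Rightarrow> 'a span
      \<Rightarrow> ('a, 'c) rep \<Rightarrow> ('a, 'c) rep \<Rightarrow> ('a, 'c) rep \<Rightarrow> bool" where
  "rep_comp K W (w1, f1) (w2, f2) (w3, f3) (p1, p2, \<alpha>, \<beta>) (p1', p2', \<alpha>', \<beta>') e \<longleftrightarrow>
    (\<exists>t \<in> Ob K. \<exists>r \<in> hom (cat1 K) t (src K p1). \<exists>r' \<in> hom (cat1 K) t (src K p1').
     \<exists>\<delta> \<in> iso2 K (comp1 K p2 r) (comp1 K p1' r').
       comp1 K w1 (comp1 K p1 r) \<in> W \<and>
       e = (comp1 K p1 r, comp1 K p2' r',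
            vcomp K (rwhisker K \<alpha>' r') (vcomp K (lwhisker K w2 \<delta>) (rwhisker K \<alpha> r)),
            vcomp K (rwhisker K \<beta>' r') (vcomp K (lwhisker K f2 \<delta>) (rwhisker K \<beta> r))))"

text \<open>
  A 2-arrow of the bicategory of fractions is an equivalence class of representatives tagged with
  its source and target spans. The composite of two classes is given without choosing
  representatives: it consists of everything equivalent to a composite of some representatives,
  which is a single class because composition does not depend on the choices.
\<close>

type_synonym ('a, 'c) frac2 = "'a span \<times> 'a span \<times> ('a, 'c) rep set"

fun frac_id :: "('o, 'a, 'c) two_precategory \<Rightarrow> 'a set \<Rightarrow> 'a span \<Rightarrow> ('a, 'c) frac2" where
  "frac_id K W (w, f) = ((w, f), (w, f), rep_rel K W (w, f) (w, f) ``
     {(id1 K (src K w), id1 K (src K w), id2 K w, id2 K f)})"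

fun frac_comp ::
    "('o, 'a, 'c) two_precategory \<Rightarrow> 'a set
      \<Rightarrow> ('a, 'c) frac2 \<Rightarrow> ('a, 'c) frac2 \<Rightarrow> ('a, 'c) frac2" where
  "frac_comp K W (S2', S3, Y) (S1, S2, X) =
    (S1, S3, rep_rel K W S1 S3 `` {e. \<exists>d \<in> X. \<exists>d' \<in> Y. rep_comp K W S1 S2 S3 d d' e})"

definition frac_hom_category ::
    "('o, 'a, 'c) two_precategory \<Rightarrow> 'a set \<Rightarrow> 'o \<Rightarrow> 'o
      \<Rightarrow> ('a span, ('a, 'c) frac2) precategory" where
  "frac_hom_category K W x y = \<lparr>
     Obj = spans K W x y,
     Arr = {(S, T, X). S \<in> spans K W x y \<and> T \<in> spans K W x y \<and>
                       X \<in> reps K W S T // rep_rel K W S T},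
     Dom = (\<lambda>(S, T, X). S),
     Cod = (\<lambda>(S, T, X). T),
     Ide = frac_id K W,
     Cmp = frac_comp K W\<rparr>"

end

theory Submission
  imports Defs
begin

text \<open>
  Restricting a representative \<open>(p\<^sub>1, p\<^sub>2, \<alpha>, \<beta>)\<close> along a 1-arrow \<open>q\<close> such that
  \<open>w\<^sub>1 \<circ> p\<^sub>1 \<circ> q\<close> is in \<open>W\<close> does not change its class, nor does replacing \<open>p\<^sub>1\<close> and
  \<open>p\<^sub>2\<close> by isomorphic 1-arrows, and two representatives are equivalent exactly if they become
  isomorphic after such restrictions. As the class \<open>V\<close> is cofinal, \<open>q\<close> can be chosen so that
  \<open>w\<^sub>1 \<circ> p\<^sub>1 \<circ> q\<close> is isomorphic to an element of \<open>V\<close>. This leaves a small set of apexes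
  \<open>v\<close>, then small sets of 1-arrows \<open>p\<^sub>1\<close>, \<open>p\<^sub>2\<close> up to isomorphism, and small sets of
  2-arrows \<open>\<alpha>\<close>, \<open>\<beta>\<close>. In the same way each span is isomorphic to one whose left leg is in
  \<open>V\<close> and whose right leg comes from a small set.

  That the hom-categories are categories at all uses BF4 only for invertible 2-arrows: the second
  leg \<open>f\<close> of a span is never cancelled.
\<close>

section \<open>Small sets and essentially small categories\<close>

text \<open>The obstacle is that \<open>frac_hom_category\<close> is raw data: before anything can
  be counted it must be shown to be a category, and neither transitivity of the equivalence of
  representatives nor independence of composites from choices can be read off the definitions. Both
  come down to comparing two 1-arrows into a common object, for which BF3 and the two halves of BF4
  are the tools. The comparison half of BF4 is turned into a faithfulness statement: invertible
  2-arrows that agree after whiskering with an element of \<open>W\<close> agree after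
  precomposition with an element of \<open>W\<close>. This is what allows a leg \<open>p\<close> to
  be cancelled when \<open>w \<odot> p\<close> is in \<open>W\<close> but \<open>p\<close> itself
  may not be.

  On the side of size, essential smallness is used in the form of a small set of objects meeting
  every isomorphism class, with small hom-sets between its members. Hence hom-sets of fractions have
  to be bounded only between the selected spans, and regularity of \<kappa> keeps the sums and
  unions over apexes, legs and 2-arrows small.\<close>

lemma small_mono: "small \<kappa> B \<Longrightarrow> A \<subseteq> B \<Longrightarrow> small \<kappa> A"
  unfolding small_def by (rule ordLeq_ordLess_trans[OF card_of_mono1])

lemma small_image: "small \<kappa> A \<Longrightarrow> small \<kappa> (f ` A)"
  unfolding small_def by (rule ordLeq_ordLess_trans[OF card_of_image])

lemma small_inj_on:
  assumes "inj_on f A" "f ` A \<subseteq> B" "small \<kappa> B"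
  shows "small \<kappa> A"
proof -
  have "|A| \<le>o |B|" using assms(1,2) card_of_ordLeq[of A B] by auto
  then show ?thesis using assms(3) unfolding small_def by (rule ordLeq_ordLess_trans)
qed

text \<open>Stability says that a sum of fewer than \<kappa> sets, each of size below \<kappa>,
  again has size below \<kappa>. Regularity of \<kappa> enters the proof in this form, through
  \<open>small_Sigma\<close> and \<open>small_UN\<close>.\<close>

lemma size_cardinal_stable: "size_cardinal \<kappa> \<Longrightarrow> stable \<kappa>"
  using regularCard_stable[of \<kappa>] by (auto simp: size_cardinal_def cinfinite_def)

lemma small_Sigma:
  assumes "size_cardinal \<kappa>" "small \<kappa> A" "\<And>a. a \<in> A \<Longrightarrow> small \<kappa> (F a)"
  shows "small \<kappa> (SIGMA a : A. F a)"
  unfolding small_def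
  by (rule stable_elim[OF size_cardinal_stable[OF assms(1)]]) (use assms(2,3) in \<open>simp_all add: small_def\<close>)

lemma small_UN:
  assumes "size_cardinal \<kappa>" "small \<kappa> A" "\<And>a. a \<in> A \<Longrightarrow> small \<kappa> (F a)"
  shows "small \<kappa> (\<Union>a\<in>A. F a)"
  unfolding small_def
  by (rule stable_UNION[OF size_cardinal_stable[OF assms(1)]]) (use assms(2,3) in \<open>simp_all add: small_def\<close>)

text \<open>The field of \<kappa> has cardinality \<kappa>. The injection is what allows a small
  category to be carried over to the type \<open>'k\<close>, as \<open>essentially_small\<close>
  demands.\<close>

lemma small_embedding:
  fixes \<kappa> :: "'k rel"
  assumes "size_cardinal \<kappa>" "small \<kappa> A"
  obtains f :: "'a \<Rightarrow> 'k" where "inj_on f A"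
proof -
  have "|Field \<kappa>| =o \<kappa>"
    using assms(1) by (simp add: size_cardinal_def card_of_Field_ordIso)
  from ordLess_ordIso_trans[OF assms(2)[unfolded small_def] ordIso_symmetric[OF this]]
  have "|A| \<le>o |Field \<kappa>|" by (rule ordLess_imp_ordLeq)
  then show thesis using that card_of_ordLeq[of A "Field \<kappa>"] by auto
qed

text \<open>The set \<open>S\<close> is the image of the small category under the backward functor,
  and the unit joins every object to an element of it. Hom-sets are small because invertibility of
  the unit makes the forward functor faithful, so that each of them embeds into the arrows of the
  small category.\<close>

lemma essentially_smallD:
  fixes \<kappa> :: "'k rel"
  assumes "essentially_small \<kappa> C"
  obtains S where "S \<subseteq> Obj C" "small \<kappa> S" "\<And>x. x \<in> Obj C \<Longrightarrow> \<exists>s\<in>S. isos C x s \<noteq> {}"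
    "\<And>x y. x \<in> Obj C \<Longrightarrow> y \<in> Obj C \<Longrightarrow> small \<kappa> (hom C x y)"
proof -
  obtain D :: "('k, 'k) precategory" and F0 F1 G0 G1 \<eta> where D: "small_category \<kappa> D" and C: "category C"
    and F: "cat_functor C D F0 F1" and G: "cat_functor D C G0 G1"
    and \<eta>: "nat_iso C C (\<lambda>x. x) (\<lambda>f. f) (\<lambda>x. G0 (F0 x)) (\<lambda>f. G1 (F1 f)) \<eta>"
    using assms unfolding essentially_small_def equivalent_categories_def
    by blast
  interpret category C by (rule C)
  have hom_small: "small \<kappa> (hom C x y)" if y: "y \<in> Obj C" for x y
  proof (rule small_inj_on)
    show "small \<kappa> (Arr D)" using D by (simp add: small_category_def)
    show "F1 ` hom C x y \<subseteq> Arr D" using cat_functor.map_hom[OF F] by (auto simp: hom_def)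
    show "inj_on F1 (hom C x y)"
    proof (rule inj_onI)
      fix f g assume fg: "f \<in> hom C x y" "g \<in> hom C x y" "F1 f = F1 g"
      \<comment> \<open>By naturality both composites with \<open>\<eta> y\<close> are determined by
        the common image under \<open>F1\<close>; it remains to cancel the invertible
        \<open>\<eta> y\<close>.\<close>
      have eq: "Cmp C (\<eta> y) f = Cmp C (\<eta> y) g"
        using nat_iso.naturality[OF \<eta> fg(1)] nat_iso.naturality[OF \<eta> fg(2)] fg(3) by simp
      obtain h where h: "h \<in> hom C (G0 (F0 y)) y" "Cmp C h (\<eta> y) = Ide C y" "\<eta> y \<in> hom C y (G0 (F0 y))"
        using nat_iso.component[OF \<eta> y] by (auto simp: isos_def)
      have "f = Cmp C (Cmp C h (\<eta> y)) f" using cmp_ide_left[OF fg(1)] h(2) by simp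
      also have "\<dots> = Cmp C (Cmp C h (\<eta> y)) g"
        using cmp_assoc[OF fg(1) h(3,1)] cmp_assoc[OF fg(2) h(3,1)] eq by simp
      also have "\<dots> = g" using cmp_ide_left[OF fg(2)] h(2) by simp
      finally show "f = g" .
    qed
  qed
  show thesis
  proof (rule that)
    show "G0 ` Obj D \<subseteq> Obj C" using cat_functor.map_obj[OF G] by blast
    show "small \<kappa> (G0 ` Obj D)" using D by (simp add: small_category_def small_image)
    show "\<exists>s \<in> G0 ` Obj D. isos C x s \<noteq> {}" if "x \<in> Obj C" for x
      using nat_iso.component[OF \<eta> that] cat_functor.map_obj[OF F that] by blast
  qed (use hom_small in blast)
qed

context category
begin

lemma dom_cod: "f \<in> hom C x y \<Longrightarrow> Dom C f = x" "f \<in> hom C x y \<Longrightarrow> Cod C f = y"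
  by (simp_all add: hom_def)

lemma homD: "f \<in> hom C x y \<Longrightarrow> x \<in> Obj C" "f \<in> hom C x y \<Longrightarrow> y \<in> Obj C"
  using dom_obj cod_obj by (auto simp: hom_def)

end

text \<open>
  The category \<open>D\<close> is the full subcategory on \<open>S\<close>, carried over to the type underlying
  \<open>\<kappa>\<close> along injections \<open>i\<close> and \<open>j\<close> of its objects and arrows.
\<close>

lemma essentially_smallI:
  fixes \<kappa> :: "'k rel" and C :: "('o, 'a) precategory"
  assumes \<kappa>: "size_cardinal \<kappa>" and C: "category C" and S: "S \<subseteq> Obj C" "small \<kappa> S"
    and iso: "\<And>x. x \<in> Obj C \<Longrightarrow> \<exists>s\<in>S. isos C x s \<noteq> {}"
    and homs: "\<And>s t. s \<in> S \<Longrightarrow> t \<in> S \<Longrightarrow> small \<kappa> (hom C s t)"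
  shows "essentially_small \<kappa> C"
proof -
  interpret category C by (rule C)
  define A where "A = (\<Union>s\<in>S. \<Union>t\<in>S. hom C s t)"
  have "small \<kappa> A" unfolding A_def by (intro small_UN \<kappa> S homs)
  obtain i :: "'o \<Rightarrow> 'k" where i: "inj_on i S" using small_embedding[OF \<kappa> S(2)] .
  obtain j :: "'a \<Rightarrow> 'k" where j: "inj_on j A" using small_embedding[OF \<kappa> \<open>small \<kappa> A\<close>] .
  define i' where "i' = inv_into S i"
  define j' where "j' = inv_into A j"
  have i' [simp]: "i' (i s) = s" if "s \<in> S" for s using that i by (simp add: i'_def)
  have j' [simp]: "j' (j a) = a" if "a \<in> A" for a using that j by (simp add: j'_def)
  have homA: "f \<in> A" if "f \<in> hom C s t" "s \<in> S" "t \<in> S" for f s t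
    using that by (auto simp: A_def)
  define D :: "('k, 'k) precategory" where
    "D = \<lparr>Obj = i ` S, Arr = j ` A, Dom = (\<lambda>a. i (Dom C (j' a))), Cod = (\<lambda>a. i (Cod C (j' a))),
      Ide = (\<lambda>s. j (Ide C (i' s))), Cmp = (\<lambda>b a. j (Cmp C (j' b) (j' a)))\<rparr>"
  have objD [simp]: "Obj D = i ` S" and ide [simp]: "Ide D s = j (Ide C (i' s))"
    and cmp [simp]: "Cmp D b a = j (Cmp C (j' b) (j' a))" for s a b
    by (simp_all add: D_def)
  have homI: "j f \<in> hom D (i s) (i t)" if "f \<in> hom C s t" "s \<in> S" "t \<in> S" for f s t
    using that homA[OF that] by (simp add: hom_def D_def)
  have homE: thesis
    if a: "a \<in> hom D k l"
      and *: "\<And>f s t. f \<in> hom C s t \<Longrightarrow> s \<in> S \<Longrightarrow> t \<in> S \<Longrightarrow> a = j f \<Longrightarrow> k = i s \<Longrightarrow> l = i t \<Longrightarrow> thesis"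
    for a k l thesis
  proof -
    obtain f where f: "f \<in> A" "a = j f" using a by (auto simp: hom_def D_def)
    then obtain s t where "f \<in> hom C s t" "s \<in> S" "t \<in> S" by (auto simp: A_def)
    then show thesis using a f by (intro *[of f s t]) (auto simp: hom_def D_def)
  qed
  have D: "category D"
  proof
    fix a assume "a \<in> Arr D"
    then have a: "a \<in> hom D (Dom D a) (Cod D a)" by (simp add: hom_def)
    obtain s t where "s \<in> S" "t \<in> S" "Dom D a = i s" "Cod D a = i t" using a by (rule homE)
    then show "Dom D a \<in> Obj D" "Cod D a \<in> Obj D" by auto
  next
    fix s assume "s \<in> Obj D" then show "Ide D s \<in> hom D s s"
      using homI ide_hom S(1) by auto
  next
    fix a b k l m assume a: "a \<in> hom D k l" and b: "b \<in> hom D l m"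
    from a obtain f s t where f: "f \<in> hom C s t" "s \<in> S" "t \<in> S" "a = j f" "k = i s" "l = i t"
      by (rule homE)
    from b obtain g t' u where g: "g \<in> hom C t' u" "t' \<in> S" "u \<in> S" "b = j g" "l = i t'" "m = i u"
      by (rule homE)
    moreover from this have "t' = t" using i f by (simp add: inj_on_eq_iff)
    ultimately show "Cmp D b a \<in> hom D k m"
      using f homI[OF cmp_hom[of f s t g u]] homA[of f s t] homA[of g t u] by simp
  next
    fix a k l assume "a \<in> hom D k l"
    then obtain f s t where "f \<in> hom C s t" "s \<in> S" "t \<in> S" "a = j f" "k = i s" "l = i t"
      by (rule homE)
    then show "Cmp D a (Ide D k) = a" "Cmp D (Ide D l) a = a"
      using homA[of "Ide C s" s s] homA[of "Ide C t" t t] homA[of f s t] ide_hom S(1)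
        cmp_ide_left[of f s t] cmp_ide_right[of f s t]
      by (simp_all add: subset_iff)
  next
    fix a b c k l m n assume a: "a \<in> hom D k l" and b: "b \<in> hom D l m" and c: "c \<in> hom D m n"
    from a obtain f s t where f: "f \<in> hom C s t" "s \<in> S" "t \<in> S" "a = j f" "k = i s" "l = i t"
      by (rule homE)
    from b obtain g t' u where g: "g \<in> hom C t' u" "t' \<in> S" "u \<in> S" "b = j g" "l = i t'" "m = i u"
      by (rule homE)
    from c obtain h u' v where h: "h \<in> hom C u' v" "u' \<in> S" "v \<in> S" "c = j h" "m = i u'" "n = i v"
      by (rule homE)
    have "t' = t" "u' = u" using i f g h by (simp_all add: inj_on_eq_iff)
    then show "Cmp D (Cmp D c b) a = Cmp D c (Cmp D b a)"
      using f g h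
      using homA[OF cmp_hom[of f s t g u]] homA[OF cmp_hom[of g t u h v]]
        homA[of f s t] homA[of g t u] homA[of h u v] cmp_assoc[of f s t g u h v]
      by simp
  qed
  have "\<forall>x\<in>Obj C. \<exists>s e e'. s \<in> S \<and> e \<in> hom C x s \<and> e' \<in> hom C s x \<and> Cmp C e' e = Ide C x \<and> Cmp C e e' = Ide C s"
    using iso by (fastforce simp: isos_def)
  then obtain r e e' where r: "\<And>x. x \<in> Obj C \<Longrightarrow> r x \<in> S"
    and e: "\<And>x. x \<in> Obj C \<Longrightarrow> e x \<in> hom C x (r x)" and e': "\<And>x. x \<in> Obj C \<Longrightarrow> e' x \<in> hom C (r x) x"
    and e'e: "\<And>x. x \<in> Obj C \<Longrightarrow> Cmp C (e' x) (e x) = Ide C x"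
    and ee': "\<And>x. x \<in> Obj C \<Longrightarrow> Cmp C (e x) (e' x) = Ide C (r x)"
    by metis
  \<comment> \<open>Conjugation with the chosen isomorphisms \<open>e\<close> and \<open>e'\<close>:
    the arrow part of the functor from \<open>C\<close> to its full subcategory on \<open>S\<close>
    that sends \<open>x\<close> to \<open>r x\<close>.\<close>
  define \<Phi> where "\<Phi> f = Cmp C (Cmp C (e (Cod C f)) f) (e' (Dom C f))" for f
  have \<Phi>_hom: "\<Phi> f \<in> hom C (r x) (r y)" if f: "f \<in> hom C x y" for f x y
    using cmp_hom[OF e'[OF homD(1)[OF f]] cmp_hom[OF f e[OF homD(2)[OF f]]]] dom_cod[OF f] by (simp add: \<Phi>_def)
  have \<Phi>_A: "\<Phi> f \<in> A" if f: "f \<in> hom C x y" for f x y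
    using homA[OF \<Phi>_hom[OF f]] r homD[OF f] by blast
  have \<Phi>_nat: "Cmp C (\<Phi> f) (e x) = Cmp C (e y) f" if f: "f \<in> hom C x y" for f x y
  proof -
    note x = homD(1)[OF f] and y = homD(2)[OF f]
    note ef = cmp_hom[OF f e[OF y]]
    have "Cmp C (\<Phi> f) (e x) = Cmp C (Cmp C (e y) f) (Cmp C (e' x) (e x))"
      using cmp_assoc[OF e[OF x] e'[OF x] ef] dom_cod[OF f] by (simp add: \<Phi>_def)
    then show ?thesis using e'e[OF x] cmp_ide_right[OF ef] by simp
  qed
  have \<Phi>_cmp: "\<Phi> (Cmp C g f) = Cmp C (\<Phi> g) (\<Phi> f)" if f: "f \<in> hom C x y" and g: "g \<in> hom C y z" for f g x y z
  proof -
    note x = homD(1)[OF f] and y = homD(2)[OF f] and z = homD(2)[OF g]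
    have "Cmp C (\<Phi> g) (\<Phi> f) = Cmp C (Cmp C (\<Phi> g) (Cmp C (e y) f)) (e' x)"
      using cmp_assoc[OF e'[OF x] cmp_hom[OF f e[OF y]] \<Phi>_hom[OF g]] dom_cod[OF f] by (simp add: \<Phi>_def)
    also have "Cmp C (\<Phi> g) (Cmp C (e y) f) = Cmp C (Cmp C (e z) g) f"
      using cmp_assoc[OF f e[OF y] \<Phi>_hom[OF g]] \<Phi>_nat[OF g] by simp
    also have "\<dots> = Cmp C (e z) (Cmp C g f)" by (rule cmp_assoc[OF f g e[OF z]])
    finally show ?thesis using dom_cod[OF cmp_hom[OF f g]] by (simp add: \<Phi>_def)
  qed
  have \<Phi>_ide: "\<Phi> (Ide C x) = Ide C (r x)" if x: "x \<in> Obj C" for x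
    using dom_cod[OF ide_hom[OF x]] cmp_ide_right[OF e[OF x]] ee'[OF x] by (simp add: \<Phi>_def)
  have F: "cat_functor C D (\<lambda>x. i (r x)) (\<lambda>f. j (\<Phi> f))"
  proof
    fix x assume x: "x \<in> Obj C"
    show "i (r x) \<in> Obj D" using r[OF x] by simp
    show "j (\<Phi> (Ide C x)) = Ide D (i (r x))" using r[OF x] \<Phi>_ide[OF x] by simp
  next
    fix f x y assume f: "f \<in> hom C x y"
    show "j (\<Phi> f) \<in> hom D (i (r x)) (i (r y))"
      by (rule homI[OF \<Phi>_hom[OF f] r[OF homD(1)[OF f]] r[OF homD(2)[OF f]]])
    fix g z assume g: "g \<in> hom C y z"
    show "j (\<Phi> (Cmp C g f)) = Cmp D (j (\<Phi> g)) (j (\<Phi> f))"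
      using \<Phi>_A[OF f] \<Phi>_A[OF g] \<Phi>_cmp[OF f g] by simp
  qed
  have G: "cat_functor D C i' j'"
  proof
    fix k assume k: "k \<in> Obj D"
    then obtain s where s: "s \<in> S" "k = i s" by auto
    show "i' k \<in> Obj C" using s S(1) by auto
    show "j' (Ide D k) = Ide C (i' k)" using s homA[OF ide_hom] S(1) by auto
  next
    fix a k l assume "a \<in> hom D k l"
    then obtain f s t where f: "f \<in> hom C s t" "s \<in> S" "t \<in> S" "a = j f" "k = i s" "l = i t"
      by (rule homE)
    then show "j' a \<in> hom C (i' k) (i' l)" using homA by simp
    fix b m assume "b \<in> hom D l m"
    then obtain g t' u where g: "g \<in> hom C t' u" "t' \<in> S" "u \<in> S" "b = j g" "l = i t'" "m = i u"
      by (rule homE)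
    moreover from this have "t' = t" using i f by (simp add: inj_on_eq_iff)
    ultimately show "j' (Cmp D b a) = Cmp C (j' b) (j' a)"
      using f homA[OF cmp_hom[of f s t g u]] homA[of f s t] homA[of g t u] by simp
  qed
  have \<eta>: "nat_iso C C (\<lambda>x. x) (\<lambda>f. f) (\<lambda>x. i' (i (r x))) (\<lambda>f. j' (j (\<Phi> f))) e"
  proof
    fix x assume x: "x \<in> Obj C"
    show "e x \<in> isos C x (i' (i (r x)))"
      using e[OF x] e'[OF x] e'e[OF x] ee'[OF x] r[OF x] by (auto simp: isos_def)
  next
    fix f x y assume f: "f \<in> hom C x y"
    show "Cmp C (e y) f = Cmp C (j' (j (\<Phi> f))) (e x)"
      using \<Phi>_nat[OF f] \<Phi>_A[OF f] by simp
  qed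
  \<comment> \<open>The choice \<open>r\<close> need not fix the elements of \<open>S\<close>, so
    going from \<open>D\<close> to \<open>C\<close> and back is not the identity; the isomorphisms
    \<open>e'\<close> compare the two.\<close>
  have \<epsilon>: "nat_iso D D (\<lambda>k. i (r (i' k))) (\<lambda>a. j (\<Phi> (j' a))) (\<lambda>k. k) (\<lambda>a. a) (\<lambda>k. j (e' (i' k)))"
  proof
    fix k assume "k \<in> Obj D"
    then obtain s where s: "s \<in> S" "k = i s" by auto
    then have sC: "s \<in> Obj C" using S(1) by blast
    note ss = e'[OF sC] e[OF sC] r[OF sC]
    show "j (e' (i' k)) \<in> isos D (i (r (i' k))) k"
      unfolding isos_def using homI[OF ss(1) ss(3) s(1)] homI[OF ss(2) s(1) ss(3)] s
        homA[OF ss(1) ss(3) s(1)] homA[OF ss(2) s(1) ss(3)] ss(3) e'e[OF sC] ee'[OF sC]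
      by (auto intro!: bexI[of _ "j (e s)"])
  next
    fix a k l assume "a \<in> hom D k l"
    then obtain f s t where f: "f \<in> hom C s t" "s \<in> S" "t \<in> S" "a = j f" "k = i s" "l = i t"
      by (rule homE)
    note s = homD(1)[OF f(1)] and t = homD(2)[OF f(1)]
    note ef = cmp_hom[OF f(1) e[OF t]]
    have "Cmp C (e' t) (\<Phi> f) = Cmp C (Cmp C (e' t) (Cmp C (e t) f)) (e' s)"
      using cmp_assoc[OF e'[OF s] ef e'[OF t]] dom_cod[OF f(1)] by (simp add: \<Phi>_def)
    also have "Cmp C (e' t) (Cmp C (e t) f) = f"
      using cmp_assoc[OF f(1) e[OF t] e'[OF t]] e'e[OF t] cmp_ide_left[OF f(1)] by simp
    finally have "Cmp C (e' t) (\<Phi> f) = Cmp C f (e' s)" .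
    then show "Cmp D (j (e' (i' l))) (j (\<Phi> (j' a))) = Cmp D a (j (e' (i' k)))"
      using f homA[OF f(1-3)] \<Phi>_A[OF f(1)] homA[OF e'[OF s] r[OF s]] homA[OF e'[OF t] r[OF t]] by simp
  qed
  have "small_category \<kappa> D"
    using D S(2) \<open>small \<kappa> A\<close> by (simp add: small_category_def small_image D_def)
  moreover have "equivalent_categories C D"
    unfolding equivalent_categories_def 
    by (intro conjI exI[of _ "\<lambda>x. i (r x)"] exI[of _ "\<lambda>f. j (\<Phi> f)"] exI[of _ i'] exI[of _ j']
        exI[of _ e] exI[of _ "\<lambda>k. j (e' (i' k))"] C D F G \<eta> \<epsilon>)
  ultimately show ?thesis unfolding essentially_small_def by (intro exI[of _ D] conjI)
qed


section \<open>Whiskering and invertible 2-arrows\<close>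

context two_category
begin

lemma hom_cat1 [simp]: "f \<in> hom (cat1 K) x y \<longleftrightarrow> f \<in> Ar1 K \<and> src K f = x \<and> tgt K f = y"
  by (simp add: hom_def cat1_def)

lemma hom_vcat [simp]: "\<alpha> \<in> hom (vcat K) f g \<longleftrightarrow> \<alpha> \<in> Ar2 K \<and> src2 K \<alpha> = f \<and> tgt2 K \<alpha> = g"
  by (simp add: hom_def vcat_def)

lemma hom_hcat: "\<alpha> \<in> hom (hcat K) x y \<longleftrightarrow>
    \<alpha> \<in> Ar2 K \<and> src K (src2 K \<alpha>) = x \<and> tgt K (src2 K \<alpha>) = y"
  by (simp add: hom_def hcat_def)

lemma src_Ob [simp]: "f \<in> Ar1 K \<Longrightarrow> src K f \<in> Ob K"
  and tgt_Ob [simp]: "f \<in> Ar1 K \<Longrightarrow> tgt K f \<in> Ob K"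
  using category.dom_obj[OF category_cat1] category.cod_obj[OF category_cat1]
  by (simp_all add: cat1_def)

lemma id1 [simp]:
  assumes "x \<in> Ob K"
  shows "id1 K x \<in> Ar1 K" "src K (id1 K x) = x" "tgt K (id1 K x) = x"
  using category.ide_hom[OF category_cat1, of x] assms by (simp_all add: cat1_def hom_def)

lemma comp1 [simp]:
  assumes "f \<in> Ar1 K" "g \<in> Ar1 K" "tgt K f = src K g"
  shows "g \<odot> f \<in> Ar1 K" "src K (g \<odot> f) = src K f" "tgt K (g \<odot> f) = tgt K g"
  using category.cmp_hom[OF category_cat1, of f "src K f" "tgt K f" g "tgt K g"] assms
  by (simp_all add: cat1_def hom_def)

lemma comp1_assoc [simp]:
  assumes "f \<in> Ar1 K" "g \<in> Ar1 K" "h \<in> Ar1 K" "tgt K f = src K g" "tgt K g = src K h"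
  shows "(h \<odot> g) \<odot> f = h \<odot> g \<odot> f"
  using category.cmp_assoc[OF category_cat1, of f "src K f" "tgt K f" g "tgt K g" h "tgt K h"] assms
  by (simp add: cat1_def hom_def)

lemma comp1_id [simp]:
  assumes "f \<in> Ar1 K"
  shows "src K f = x \<Longrightarrow> f \<odot> id1 K x = f" "tgt K f = x \<Longrightarrow> id1 K x \<odot> f = f"
  using category.cmp_ide_right[OF category_cat1, of f "src K f" "tgt K f"]
    category.cmp_ide_left[OF category_cat1, of f "src K f" "tgt K f"] assms
  by (auto simp add: cat1_def hom_def)

lemma src2_Ar1 [simp]: "\<alpha> \<in> Ar2 K \<Longrightarrow> src2 K \<alpha> \<in> Ar1 K"
  and tgt2_Ar1 [simp]: "\<alpha> \<in> Ar2 K \<Longrightarrow> tgt2 K \<alpha> \<in> Ar1 K"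
  using category.dom_obj[OF category_vcat] category.cod_obj[OF category_vcat]
  by (simp_all add: vcat_def)

lemma end_tgt2 [simp]:
  assumes "\<alpha> \<in> Ar2 K"
  shows "src K (tgt2 K \<alpha>) = src K (src2 K \<alpha>)" "tgt K (tgt2 K \<alpha>) = tgt K (src2 K \<alpha>)"
  using parallel[OF assms] by simp_all

lemma id2 [simp]:
  assumes "f \<in> Ar1 K"
  shows "id2 K f \<in> Ar2 K" "src2 K (id2 K f) = f" "tgt2 K (id2 K f) = f"
  using category.ide_hom[OF category_vcat, of f] assms by (simp_all add: vcat_def hom_def)

lemma vcomp [simp]:
  assumes "\<alpha> \<in> Ar2 K" "\<beta> \<in> Ar2 K" "tgt2 K \<alpha> = src2 K \<beta>"
  shows "\<beta> \<cdot> \<alpha> \<in> Ar2 K" "src2 K (\<beta> \<cdot> \<alpha>) = src2 K \<alpha>" "tgt2 K (\<beta> \<cdot> \<alpha>) = tgt2 K \<beta>"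
  using category.cmp_hom[OF category_vcat, of \<alpha> "src2 K \<alpha>" "tgt2 K \<alpha>" \<beta> "tgt2 K \<beta>"] assms
  by (simp_all add: vcat_def hom_def)

lemma vcomp_assoc [simp]:
  assumes "\<alpha> \<in> Ar2 K" "\<beta> \<in> Ar2 K" "\<gamma> \<in> Ar2 K" "tgt2 K \<alpha> = src2 K \<beta>" "tgt2 K \<beta> = src2 K \<gamma>"
  shows "(\<gamma> \<cdot> \<beta>) \<cdot> \<alpha> = \<gamma> \<cdot> \<beta> \<cdot> \<alpha>"
  using category.cmp_assoc[OF category_vcat, of \<alpha> "src2 K \<alpha>" "tgt2 K \<alpha>" \<beta> "tgt2 K \<beta>" \<gamma> "tgt2 K \<gamma>"] assms
  by (simp add: vcat_def hom_def)

lemma vcomp_id [simp]: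
  assumes "\<alpha> \<in> Ar2 K"
  shows "src2 K \<alpha> = f \<Longrightarrow> \<alpha> \<cdot> id2 K f = \<alpha>" "tgt2 K \<alpha> = f \<Longrightarrow> id2 K f \<cdot> \<alpha> = \<alpha>"
  using category.cmp_ide_right[OF category_vcat, of \<alpha> "src2 K \<alpha>" "tgt2 K \<alpha>"]
    category.cmp_ide_left[OF category_vcat, of \<alpha> "src2 K \<alpha>" "tgt2 K \<alpha>"] assms
  by (auto simp add: vcat_def hom_def)

lemma hcomp [simp]:
  assumes "\<alpha> \<in> Ar2 K" "\<beta> \<in> Ar2 K" "tgt K (src2 K \<alpha>) = src K (src2 K \<beta>)"
  shows "\<beta> \<star> \<alpha> \<in> Ar2 K" "src2 K (\<beta> \<star> \<alpha>) = src2 K \<beta> \<odot> src2 K \<alpha>"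
    "tgt2 K (\<beta> \<star> \<alpha>) = tgt2 K \<beta> \<odot> tgt2 K \<alpha>"
proof -
  have *: "\<alpha> \<in> hom (hcat K) (src K (src2 K \<alpha>)) (tgt K (src2 K \<alpha>))"
    "\<beta> \<in> hom (hcat K) (tgt K (src2 K \<alpha>)) (tgt K (src2 K \<beta>))"
    using assms by (simp_all add: hom_hcat)
  show "\<beta> \<star> \<alpha> \<in> Ar2 K" "src2 K (\<beta> \<star> \<alpha>) = src2 K \<beta> \<odot> src2 K \<alpha>"
    "tgt2 K (\<beta> \<star> \<alpha>) = tgt2 K \<beta> \<odot> tgt2 K \<alpha>"
    using category.cmp_hom[OF category_hcat *] hcomp_src2[OF *] hcomp_tgt2[OF *]
    by (simp_all add: hcat_def hom_def)
qed

lemma hcomp_assoc [simp]: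
  assumes "\<alpha> \<in> Ar2 K" "\<beta> \<in> Ar2 K" "\<gamma> \<in> Ar2 K"
    "tgt K (src2 K \<alpha>) = src K (src2 K \<beta>)" "tgt K (src2 K \<beta>) = src K (src2 K \<gamma>)"
  shows "(\<gamma> \<star> \<beta>) \<star> \<alpha> = \<gamma> \<star> \<beta> \<star> \<alpha>"
  using category.cmp_assoc[OF category_hcat, of \<alpha> "src K (src2 K \<alpha>)" "tgt K (src2 K \<alpha>)"
      \<beta> "tgt K (src2 K \<beta>)" \<gamma> "tgt K (src2 K \<gamma>)"] assms
  by (simp add: hcat_def hom_def)

lemma id2_hcomp_id2 [simp]:
  assumes "f \<in> Ar1 K" "g \<in> Ar1 K" "tgt K f = src K g"
  shows "id2 K g \<star> id2 K f = id2 K (g \<odot> f)"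
  using hcomp_id2[of f "src K f" "tgt K f" g "tgt K g"] assms by simp

text \<open>Together with \<open>hcomp_assoc\<close> and \<open>id2_hcomp_id2\<close> this fixes the
  normal form of whiskerings: a left whiskering by a composite is split into successive ones,
  whereas successive right whiskerings are merged into one by the composite.\<close>

lemma lwhisker_comp1 [simp]:
  assumes "\<alpha> \<in> Ar2 K" "g \<in> Ar1 K" "h \<in> Ar1 K" "tgt K (src2 K \<alpha>) = src K g" "tgt K g = src K h"
  shows "id2 K (h \<odot> g) \<star> \<alpha> = id2 K h \<star> id2 K g \<star> \<alpha>"
  using hcomp_assoc[of \<alpha> "id2 K g" "id2 K h"] assms by (simp del: hcomp_assoc)

lemma whisker_id [simp]:
  assumes "\<alpha> \<in> Ar2 K"
  shows "tgt K (src2 K \<alpha>) = x \<Longrightarrow> id2 K (id1 K x) \<star> \<alpha> = \<alpha>"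
    "src K (src2 K \<alpha>) = x \<Longrightarrow> \<alpha> \<star> id2 K (id1 K x) = \<alpha>"
  using category.cmp_ide_right[OF category_hcat, of \<alpha> "src K (src2 K \<alpha>)" "tgt K (src2 K \<alpha>)"]
    category.cmp_ide_left[OF category_hcat, of \<alpha> "src K (src2 K \<alpha>)" "tgt K (src2 K \<alpha>)"] assms
  by (auto simp add: hcat_def hom_def)

lemma hcomp_vcomp:
  assumes "\<alpha> \<in> Ar2 K" "\<alpha>' \<in> Ar2 K" "tgt2 K \<alpha> = src2 K \<alpha>'"
    "\<beta> \<in> Ar2 K" "\<beta>' \<in> Ar2 K" "tgt2 K \<beta> = src2 K \<beta>'" "tgt K (src2 K \<alpha>) = src K (src2 K \<beta>)"
  shows "(\<beta>' \<cdot> \<beta>) \<star> (\<alpha>' \<cdot> \<alpha>) = (\<beta>' \<star> \<alpha>') \<cdot> (\<beta> \<star> \<alpha>)"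
  using interchange[of \<alpha> "src2 K \<alpha>" "tgt2 K \<alpha>" \<alpha>' "tgt2 K \<alpha>'" \<beta> "src2 K \<beta>" "tgt2 K \<beta>" \<beta>' "tgt2 K \<beta>'"]
    assms by simp

lemma lwhisker_vcomp [simp]:
  assumes "\<alpha> \<in> Ar2 K" "\<alpha>' \<in> Ar2 K" "tgt2 K \<alpha> = src2 K \<alpha>'" "h \<in> Ar1 K" "tgt K (src2 K \<alpha>) = src K h"
  shows "id2 K h \<star> (\<alpha>' \<cdot> \<alpha>) = (id2 K h \<star> \<alpha>') \<cdot> (id2 K h \<star> \<alpha>)"
  using hcomp_vcomp[of \<alpha> \<alpha>' "id2 K h" "id2 K h"] assms by simp

lemma rwhisker_vcomp [simp]:
  assumes "\<beta> \<in> Ar2 K" "\<beta>' \<in> Ar2 K" "tgt2 K \<beta> = src2 K \<beta>'" "q \<in> Ar1 K" "tgt K q = src K (src2 K \<beta>)"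
  shows "(\<beta>' \<cdot> \<beta>) \<star> id2 K q = (\<beta>' \<star> id2 K q) \<cdot> (\<beta> \<star> id2 K q)"
  using hcomp_vcomp[of "id2 K q" "id2 K q" \<beta> \<beta>'] assms by simp

text \<open>Both sides equal \<open>\<alpha> \<star> \<theta>\<close> by interchange. This is the
  naturality that lets a 2-arrow between 1-arrows be moved past the 2-arrows of a
  representative.\<close>

lemma whisker_swap:
  assumes "\<alpha> \<in> Ar2 K" "\<theta> \<in> Ar2 K" "tgt K (src2 K \<theta>) = src K (src2 K \<alpha>)"
  shows "(\<alpha> \<star> id2 K (tgt2 K \<theta>)) \<cdot> (id2 K (src2 K \<alpha>) \<star> \<theta>)
    = (id2 K (tgt2 K \<alpha>) \<star> \<theta>) \<cdot> (\<alpha> \<star> id2 K (src2 K \<theta>))"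
  using hcomp_vcomp[of \<theta> "id2 K (tgt2 K \<theta>)" "id2 K (src2 K \<alpha>)" \<alpha>]
    hcomp_vcomp[of "id2 K (src2 K \<theta>)" \<theta> \<alpha> "id2 K (tgt2 K \<alpha>)"] assms by simp

section \<open>Calculus of invertible 2-arrows\<close>

lemma iso2D:
  assumes "\<theta> \<in> iso2 K f g"
  shows "\<theta> \<in> Ar2 K" "src2 K \<theta> = f" "tgt2 K \<theta> = g" "f \<in> Ar1 K" "g \<in> Ar1 K"
    "src K g = src K f" "tgt K g = tgt K f"
  using assms end_tgt2[of \<theta>] by (auto simp: isos_def)

lemma iso2E:
  assumes "\<theta> \<in> iso2 K f g"
  obtains \<theta>' where "\<theta>' \<in> iso2 K g f" "\<theta>' \<cdot> \<theta> = id2 K f" "\<theta> \<cdot> \<theta>' = id2 K g"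
  using assms unfolding isos_def by (auto simp: vcat_def hom_def)

lemma iso2I:
  assumes "\<theta> \<in> Ar2 K" "src2 K \<theta> = f" "tgt2 K \<theta> = g" "\<theta>' \<in> Ar2 K" "src2 K \<theta>' = g" "tgt2 K \<theta>' = f"
    "\<theta>' \<cdot> \<theta> = id2 K f" "\<theta> \<cdot> \<theta>' = id2 K g"
  shows "\<theta> \<in> iso2 K f g"
  using assms unfolding isos_def by (auto simp: vcat_def hom_def)

lemma iso2_id [simp]: "f \<in> Ar1 K \<Longrightarrow> id2 K f \<in> iso2 K f f"
  by (rule iso2I[of _ _ _ "id2 K f"]) simp_all

lemma iso2_vcomp:
  assumes "\<theta> \<in> iso2 K f g" "\<phi> \<in> iso2 K g h"
  shows "\<phi> \<cdot> \<theta> \<in> iso2 K f h"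
proof -
  obtain \<theta>' where \<theta>': "\<theta>' \<in> iso2 K g f" "\<theta>' \<cdot> \<theta> = id2 K f" "\<theta> \<cdot> \<theta>' = id2 K g"
    using assms(1) by (rule iso2E)
  obtain \<phi>' where \<phi>': "\<phi>' \<in> iso2 K h g" "\<phi>' \<cdot> \<phi> = id2 K g" "\<phi> \<cdot> \<phi>' = id2 K h"
    using assms(2) by (rule iso2E)
  note [simp] = iso2D[OF assms(1)] iso2D[OF assms(2)] iso2D(1-5)[OF \<theta>'(1)] iso2D(1-5)[OF \<phi>'(1)]
  have 1: "\<phi>' \<cdot> \<phi> \<cdot> \<theta> = \<theta>"
    using vcomp_assoc[of \<theta> \<phi> \<phi>'] \<phi>' by (simp del: vcomp_assoc)
  have 2: "\<theta> \<cdot> \<theta>' \<cdot> \<phi>' = \<phi>'"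
    using vcomp_assoc[of \<phi>' \<theta>' \<theta>] \<theta>' by (simp del: vcomp_assoc)
  show ?thesis
    by (rule iso2I[of _ _ _ "\<theta>' \<cdot> \<phi>'"]) (simp_all add: 1 2 \<theta>' \<phi>')
qed

lemma iso2_lwhisker:
  assumes "\<theta> \<in> iso2 K f g" "h \<in> Ar1 K" "tgt K f = src K h"
  shows "id2 K h \<star> \<theta> \<in> iso2 K (h \<odot> f) (h \<odot> g)"
proof -
  obtain \<theta>' where \<theta>': "\<theta>' \<in> iso2 K g f" "\<theta>' \<cdot> \<theta> = id2 K f" "\<theta> \<cdot> \<theta>' = id2 K g"
    using assms(1) by (rule iso2E)
  note [simp] = iso2D[OF assms(1)] iso2D(1-5)[OF \<theta>'(1)]
  show ?thesis
    using lwhisker_vcomp[of \<theta> \<theta>' h] lwhisker_vcomp[of \<theta>' \<theta> h] assms(2,3)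
    by (intro iso2I[of _ _ _ "id2 K h \<star> \<theta>'"]) (simp_all add: \<theta>' del: lwhisker_vcomp)
qed

lemma iso2_rwhisker:
  assumes "\<theta> \<in> iso2 K f g" "q \<in> Ar1 K" "tgt K q = src K f"
  shows "\<theta> \<star> id2 K q \<in> iso2 K (f \<odot> q) (g \<odot> q)"
proof -
  obtain \<theta>' where \<theta>': "\<theta>' \<in> iso2 K g f" "\<theta>' \<cdot> \<theta> = id2 K f" "\<theta> \<cdot> \<theta>' = id2 K g"
    using assms(1) by (rule iso2E)
  note [simp] = iso2D[OF assms(1)] iso2D(1-5)[OF \<theta>'(1)]
  show ?thesis
    using rwhisker_vcomp[of \<theta> \<theta>' q] rwhisker_vcomp[of \<theta>' \<theta> q] assms(2,3)
    by (intro iso2I[of _ _ _ "\<theta>' \<star> id2 K q"]) (simp_all add: \<theta>' del: rwhisker_vcomp)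
qed

lemma iso2_cancel_left:
  assumes "\<theta> \<cdot> \<alpha> = \<theta> \<cdot> \<beta>" "\<theta> \<in> iso2 K g h"
    "\<alpha> \<in> Ar2 K" "tgt2 K \<alpha> = g" "\<beta> \<in> Ar2 K" "tgt2 K \<beta> = g"
  shows "\<alpha> = \<beta>"
proof -
  obtain \<theta>' where \<theta>': "\<theta>' \<in> iso2 K h g" "\<theta>' \<cdot> \<theta> = id2 K g" using assms(2) by (rule iso2E)
  note [simp] = iso2D[OF assms(2)] iso2D(1-5)[OF \<theta>'(1)]
  have "(\<theta>' \<cdot> \<theta>) \<cdot> \<alpha> = (\<theta>' \<cdot> \<theta>) \<cdot> \<beta>" using assms by simp
  then show ?thesis using assms(3-) by (simp add: \<theta>' del: vcomp_assoc)
qed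

lemma iso2_cancel_right:
  assumes "\<alpha> \<cdot> \<theta> = \<beta> \<cdot> \<theta>" "\<theta> \<in> iso2 K f g"
    "\<alpha> \<in> Ar2 K" "src2 K \<alpha> = g" "\<beta> \<in> Ar2 K" "src2 K \<beta> = g"
  shows "\<alpha> = \<beta>"
proof -
  obtain \<theta>' where \<theta>': "\<theta>' \<in> iso2 K g f" "\<theta> \<cdot> \<theta>' = id2 K g" using assms(2) by (rule iso2E)
  note [simp] = iso2D[OF assms(2)] iso2D(1-5)[OF \<theta>'(1)]
  have "(\<alpha> \<cdot> \<theta>) \<cdot> \<theta>' = (\<beta> \<cdot> \<theta>) \<cdot> \<theta>'" using assms(1) by simp
  then show ?thesis using assms(3-) by (simp add: \<theta>')
qed

end


section \<open>Consequences of BF1 to BF4\<close>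

locale fractions = two_category K for K :: "('o, 'a, 'c) two_precategory" (structure) +
  fixes W :: "'a set"
  assumes W_Ar1: "W \<subseteq> Ar1 K"
    and BF1: "BF1 K W" and BF2: "BF2 K W" and BF3: "BF3 K W" and BF4: "BF4 K W"
begin

lemma W_arr: "w \<in> W \<Longrightarrow> w \<in> Ar1 K"
  using W_Ar1 by auto

lemma W_comp1: "v \<in> W \<Longrightarrow> w \<in> W \<Longrightarrow> tgt K v = src K w \<Longrightarrow> w \<odot> v \<in> W"
  using BF2 by (auto simp: BF2_def)

text \<open>BF2 gives one direction, and BF2 applied to the inverse of \<theta> gives the other. The
  equivalence serves to transport membership in \<open>W\<close> along any invertible
  2-arrow.\<close>

lemma W_iso2: "\<theta> \<in> iso2 K f g \<Longrightarrow> f \<in> W \<longleftrightarrow> g \<in> W"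
  using BF2 iso2D[of \<theta> f g] iso2E[of \<theta> f g] unfolding BF2_def by (metis empty_iff)

text \<open>An identity is an equivalence with itself as quasi-inverse, so BF1 applies.\<close>

lemma W_id1 [simp]:
  assumes "x \<in> Ob K" shows "id1 K x \<in> W"
proof -
  have "equivalence1 K (id1 K x)"
    unfolding equivalence1_def
  proof (intro conjI bexI[of _ "id1 K x"])
    have "id2 K (id1 K x) \<in> iso2 K (id1 K x) (id1 K x)" using assms by simp
    then show "iso2 K (id1 K x \<odot> id1 K x) (id1 K (src K (id1 K x))) \<noteq> {}"
      "iso2 K (id1 K x \<odot> id1 K x) (id1 K (tgt K (id1 K x))) \<noteq> {}"
      using assms by (auto simp del: iso2_id)
  qed (use assms in simp_all)
  then show ?thesis using BF1 by (simp add: BF1_def)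
qed

text \<open>The existence half of BF4 for invertible \<alpha>; the comparison half is exploited in
  \<open>iso2_faithful\<close>.\<close>

lemma iso2_lift:
  assumes "w \<in> W" "\<alpha> \<in> iso2 K (w \<odot> f) (w \<odot> g)"
    "f \<in> Ar1 K" "g \<in> Ar1 K" "src K f = src K g" "tgt K f = src K w" "tgt K g = src K w"
  obtains v \<beta> where "v \<in> W" "tgt K v = src K f" "\<beta> \<in> iso2 K (f \<odot> v) (g \<odot> v)"
    "\<alpha> \<star> id2 K v = id2 K w \<star> \<beta>"
proof -
  have "\<exists>v \<beta>. BF4_pair K W w f g \<alpha> v \<beta>"
    using BF4[unfolded BF4_def, rule_format, of w "src K f" f g \<alpha>] assms iso2D[OF assms(2)]
    by auto
  then show thesis using assms(2) that by (auto simp: BF4_pair_def)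
qed

text \<open>
  BF3 completes the cospan \<open>w \<odot> a\<close>, \<open>w \<odot> b\<close> to a square; lifting its invertible 2-arrow
  along \<open>w\<close> then cancels \<open>w\<close>.
\<close>

lemma square_completion:
  assumes "w \<in> W" "w \<odot> a \<in> W" "w \<odot> b \<in> W"
    "a \<in> Ar1 K" "b \<in> Ar1 K" "tgt K a = src K w" "tgt K b = src K w"
  obtains r r' \<delta> where "r \<in> Ar1 K" "r' \<in> Ar1 K" "src K r = src K r'" "tgt K r = src K a"
    "tgt K r' = src K b" "\<delta> \<in> iso2 K (a \<odot> r) (b \<odot> r')" "w \<odot> a \<odot> r \<in> W" "w \<odot> b \<odot> r' \<in> W"
proof -
  have [simp]: "w \<in> Ar1 K" using assms by (blast intro: W_arr)
  note [simp] = assms(4-7)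
  obtain p v g where "v \<in> hom (cat1 K) p (src K (w \<odot> b))" "g \<in> hom (cat1 K) p (src K (w \<odot> a))"
    and v: "v \<in> W" and "iso2 K ((w \<odot> a) \<odot> g) ((w \<odot> b) \<odot> v) \<noteq> {}"
    using BF3[unfolded BF3_def, rule_format, of "w \<odot> a" "w \<odot> b"] assms(2,3) by (auto simp del: hom_cat1)
  moreover from this have [simp]: "g \<in> Ar1 K" "src K g = src K v" "tgt K v = src K b" "tgt K g = src K a"
    by simp_all
  ultimately obtain \<alpha> where \<alpha>: "\<alpha> \<in> iso2 K (w \<odot> a \<odot> g) (w \<odot> b \<odot> v)" by auto
  have [simp]: "v \<in> Ar1 K" using v by (blast intro: W_arr)
  obtain z \<beta> where z: "z \<in> W" and [simp]: "tgt K z = src K v"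
    and \<beta>: "\<beta> \<in> iso2 K ((a \<odot> g) \<odot> z) ((b \<odot> v) \<odot> z)"
    by (rule iso2_lift[OF assms(1) \<alpha>]) auto
  have [simp]: "z \<in> Ar1 K" using z by (blast intro: W_arr)
  have 1: "w \<odot> b \<odot> v \<odot> z \<in> W"
    using W_comp1[OF W_comp1[OF z v] assms(3)] by simp
  have "w \<odot> a \<odot> g \<odot> z \<in> W"
    using W_iso2[OF iso2_lwhisker[OF \<beta>, of w]] 1 by simp
  then show thesis
    using that[of "g \<odot> z" "v \<odot> z" \<beta>] 1 \<beta> by simp
qed

text \<open>
  Paired with an identity 1-arrow, both \<open>\<phi>\<close> and \<open>\<psi>\<close> are liftings of the same 2-arrow,
  so BF4 compares each of them with a common third lifting. Only invertible liftings are comparable here, since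
  \<open>BF4_pair\<close> demands invertibility of every lifting of an invertible 2-arrow.
\<close>

lemma iso2_faithful:
  assumes "w \<in> W" "\<phi> \<in> iso2 K f g" "\<psi> \<in> iso2 K f g" "tgt K f = src K w"
    and eq: "id2 K w \<star> \<phi> = id2 K w \<star> \<psi>"
  obtains z where "z \<in> W" "tgt K z = src K f" "\<phi> \<star> id2 K z = \<psi> \<star> id2 K z"
proof -
  note [simp] = iso2D[OF assms(2)] iso2D(1-5)[OF assms(3)] assms(4)
  have wA [simp]: "w \<in> Ar1 K" using assms by (blast intro: W_arr)
  define \<alpha> where "\<alpha> = id2 K w \<star> \<phi>"
  obtain v \<beta> where p: "BF4_pair K W w f g \<alpha> v \<beta>" and
    uniq: "\<And>v' \<beta>'. BF4_pair K W w f g \<alpha> v' \<beta>' \<Longrightarrow>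
          (\<exists>t \<in> Ob K. \<exists>u \<in> hom (cat1 K) t (src K v). \<exists>u' \<in> hom (cat1 K) t (src K v').
             comp1 K v u \<in> W \<and> comp1 K v' u' \<in> W \<and>
             (\<exists>\<epsilon> \<in> iso2 K (comp1 K v u) (comp1 K v' u').
                vcomp K (lwhisker K g \<epsilon>) (rwhisker K \<beta> u)
                  = vcomp K (rwhisker K \<beta>' u') (lwhisker K f \<epsilon>)))"
    using BF4[unfolded BF4_def, rule_format, of w "src K f" f g \<alpha>] assms(1)
    by (auto simp: \<alpha>_def)
  have v: "v \<in> W" and [simp]: "tgt K v = src K f" "\<beta> \<in> Ar2 K" "src2 K \<beta> = f \<odot> v" "tgt2 K \<beta> = g \<odot> v"
    using p by (auto simp: BF4_pair_def)
  have [simp]: "v \<in> Ar1 K" using v by (blast intro: W_arr)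
  \<comment> \<open>Here \<chi> stands for either of \<phi> and \<psi>. Paired with the identity it
    is a lifting of \<alpha>, and the conclusion is its comparison with the lifting \<beta> along
    \<open>v\<close>.\<close>
  have P: "\<exists>u u' \<epsilon>. u \<in> Ar1 K \<and> u' \<in> Ar1 K \<and> src K u = src K u' \<and> tgt K u = src K v
      \<and> tgt K u' = src K f \<and> v \<odot> u \<in> W \<and> u' \<in> W \<and> \<epsilon> \<in> iso2 K (v \<odot> u) u' \<and>
      (id2 K g \<star> \<epsilon>) \<cdot> (\<beta> \<star> id2 K u) = (\<chi> \<star> id2 K u') \<cdot> (id2 K f \<star> \<epsilon>)"
    if \<chi>: "\<chi> \<in> iso2 K f g" "id2 K w \<star> \<chi> = \<alpha>" for \<chi>
  proof -
    note [simp] = iso2D(1-5)[OF \<chi>(1)]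
    have "BF4_pair K W w f g \<alpha> (id1 K (src K f)) \<chi>"
      using \<chi> by (auto simp: BF4_pair_def \<alpha>_def)
    from uniq[OF this] obtain t u u' \<epsilon> where "u \<in> hom (cat1 K) t (src K v)"
      "u' \<in> hom (cat1 K) t (src K (id1 K (src K f)))" "v \<odot> u \<in> W" "id1 K (src K f) \<odot> u' \<in> W"
      "\<epsilon> \<in> iso2 K (v \<odot> u) (id1 K (src K f) \<odot> u')" and
      "(id2 K g \<star> \<epsilon>) \<cdot> (\<beta> \<star> id2 K u) = (\<chi> \<star> id2 K u') \<cdot> (id2 K f \<star> \<epsilon>)"
      by (elim bexE conjE)
    then show ?thesis by (intro exI[of _ u] exI[of _ u'] exI[of _ \<epsilon>]) simp
  qed
  obtain u u' \<epsilon> where [simp]: "u \<in> Ar1 K" "u' \<in> Ar1 K" "src K u = src K u'" "tgt K u = src K v"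
      "tgt K u' = src K f" and u: "v \<odot> u \<in> W" "u' \<in> W" and \<epsilon>: "\<epsilon> \<in> iso2 K (v \<odot> u) u'" and
      E: "(id2 K g \<star> \<epsilon>) \<cdot> (\<beta> \<star> id2 K u) = (\<phi> \<star> id2 K u') \<cdot> (id2 K f \<star> \<epsilon>)"
    using P[OF assms(2) \<alpha>_def[symmetric]] by blast
  obtain s s' \<eta> where [simp]: "s \<in> Ar1 K" "s' \<in> Ar1 K" "src K s = src K s'" "tgt K s = src K v"
      "tgt K s' = src K f" and s: "v \<odot> s \<in> W" "s' \<in> W" and \<eta>: "\<eta> \<in> iso2 K (v \<odot> s) s'" and
      H: "(id2 K g \<star> \<eta>) \<cdot> (\<beta> \<star> id2 K s) = (\<psi> \<star> id2 K s') \<cdot> (id2 K f \<star> \<eta>)"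
    using P[OF assms(3)] eq[folded \<alpha>_def] by metis
  \<comment> \<open>The two comparisons live over different 1-arrows \<open>u\<close> and
    \<open>s\<close> into the source of \<open>v\<close>. Completing the cospan of
    \<open>v \<odot> u\<close> and \<open>v \<odot> s\<close> and cancelling \<open>v\<close> brings
    both to one apex.\<close>
  obtain a b \<theta> where [simp]: "a \<in> Ar1 K" "b \<in> Ar1 K" "src K a = src K b" "tgt K a = src K u"
      "tgt K b = src K s" and \<theta>: "\<theta> \<in> iso2 K (u \<odot> a) (s \<odot> b)" and a: "v \<odot> u \<odot> a \<in> W"
    by (rule square_completion[OF v u(1) s(1)]) simp_all
  note [simp] = iso2D(1-5)[OF \<epsilon>] iso2D(1-5)[OF \<eta>] iso2D(1-5)[OF \<theta>]
  have \<epsilon>a: "\<epsilon> \<star> id2 K a \<in> iso2 K (v \<odot> u \<odot> a) (u' \<odot> a)"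
    using iso2_rwhisker[OF \<epsilon>, of a] by simp
  define \<kappa> where "\<kappa> = (\<eta> \<star> id2 K b) \<cdot> (id2 K v \<star> \<theta>)"
  have \<kappa>: "\<kappa> \<in> iso2 K (v \<odot> u \<odot> a) (s' \<odot> b)"
    unfolding \<kappa>_def
  proof (rule iso2_vcomp)
    show "id2 K v \<star> \<theta> \<in> iso2 K (v \<odot> u \<odot> a) (v \<odot> s \<odot> b)"
      by (rule iso2_lwhisker[OF \<theta>]) simp_all
    show "\<eta> \<star> id2 K b \<in> iso2 K (v \<odot> s \<odot> b) (s' \<odot> b)"
      using iso2_rwhisker[OF \<eta>, of b] by simp
  qed
  have \<kappa>A [simp]: "\<kappa> \<in> Ar2 K" "src2 K \<kappa> = v \<odot> u \<odot> a" "tgt2 K \<kappa> = s' \<odot> b"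
    using iso2D[OF \<kappa>] by simp_all
  obtain \<epsilon>' where \<epsilon>': "\<epsilon>' \<in> iso2 K (u' \<odot> a) (v \<odot> u \<odot> a)" "\<epsilon>' \<cdot> (\<epsilon> \<star> id2 K a) = id2 K (v \<odot> u \<odot> a)"
    using \<epsilon>a by (rule iso2E)
  \<comment> \<open>The comparison of \<open>u' \<odot> a\<close> with \<open>s' \<odot> b\<close>
    through \<open>v\<close>, designed so that precomposing it with the whiskered \<epsilon> gives
    \<kappa>.\<close>
  define \<rho> where "\<rho> = \<kappa> \<cdot> \<epsilon>'"
  have \<rho>: "\<rho> \<in> iso2 K (u' \<odot> a) (s' \<odot> b)"
    unfolding \<rho>_def by (rule iso2_vcomp[OF \<epsilon>'(1) \<kappa>])
  note [simp] = iso2D(1-5)[OF \<epsilon>'(1)] iso2D(1-5)[OF \<rho>]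
  have \<rho>\<epsilon>: "\<rho> \<cdot> (\<epsilon> \<star> id2 K a) = \<kappa>"
    by (simp add: \<rho>_def \<epsilon>'(2))
  have "(id2 K g \<star> \<kappa>) \<cdot> (\<beta> \<star> id2 K (u \<odot> a))
      = (id2 K g \<star> \<eta> \<star> id2 K b) \<cdot> (id2 K g \<star> id2 K v \<star> \<theta>) \<cdot> (\<beta> \<star> id2 K (u \<odot> a))"
    by (simp add: \<kappa>_def)
  also have "\<dots> = (id2 K g \<star> \<eta> \<star> id2 K b) \<cdot> (\<beta> \<star> id2 K (s \<odot> b)) \<cdot> (id2 K f \<star> id2 K v \<star> \<theta>)"
    using whisker_swap[of \<beta> \<theta>] by simp
  also have "\<dots> = (((id2 K g \<star> \<eta>) \<cdot> (\<beta> \<star> id2 K s)) \<star> id2 K b) \<cdot> (id2 K f \<star> id2 K v \<star> \<theta>)"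
    by simp
  also have "\<dots> = (\<psi> \<star> id2 K (s' \<odot> b)) \<cdot> (id2 K f \<star> \<kappa>)"
    unfolding H by (simp add: \<kappa>_def)
  finally have \<psi>: "(id2 K g \<star> \<kappa>) \<cdot> (\<beta> \<star> id2 K (u \<odot> a)) = (\<psi> \<star> id2 K (s' \<odot> b)) \<cdot> (id2 K f \<star> \<kappa>)" .
  \<comment> \<open>The equation \<open>E\<close> replaces \<phi> by \<beta>, and the equation just
    proved replaces \<beta> by \<psi>. Naturality of \<psi> with respect to \<rho> then puts \<psi>
    in the place of \<phi>, and the invertible factors cancel on both sides.\<close>
  have "((id2 K g \<star> \<rho>) \<cdot> (\<phi> \<star> id2 K (u' \<odot> a))) \<cdot> (id2 K f \<star> \<epsilon> \<star> id2 K a)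
      = (id2 K g \<star> \<rho>) \<cdot> (((\<phi> \<star> id2 K u') \<cdot> (id2 K f \<star> \<epsilon>)) \<star> id2 K a)"
    by simp
  also have "\<dots> = (id2 K g \<star> (\<rho> \<cdot> (\<epsilon> \<star> id2 K a))) \<cdot> (\<beta> \<star> id2 K (u \<odot> a))"
    unfolding E[symmetric] by simp
  also have "\<dots> = (\<psi> \<star> id2 K (s' \<odot> b)) \<cdot> (id2 K f \<star> (\<rho> \<cdot> (\<epsilon> \<star> id2 K a)))"
    unfolding \<rho>\<epsilon> by (rule \<psi>)
  also have "\<dots> = ((\<psi> \<star> id2 K (s' \<odot> b)) \<cdot> (id2 K f \<star> \<rho>)) \<cdot> (id2 K f \<star> \<epsilon> \<star> id2 K a)"
    by simp
  also have "\<dots> = ((id2 K g \<star> \<rho>) \<cdot> (\<psi> \<star> id2 K (u' \<odot> a))) \<cdot> (id2 K f \<star> \<epsilon> \<star> id2 K a)"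
    using whisker_swap[of \<psi> \<rho>] by simp
  finally have *: "(id2 K g \<star> \<rho>) \<cdot> (\<phi> \<star> id2 K (u' \<odot> a)) = (id2 K g \<star> \<rho>) \<cdot> (\<psi> \<star> id2 K (u' \<odot> a))"
    by (rule iso2_cancel_right[OF _ iso2_lwhisker[OF \<epsilon>a, of f]]) simp_all
  have "\<phi> \<star> id2 K (u' \<odot> a) = \<psi> \<star> id2 K (u' \<odot> a)"
    by (rule iso2_cancel_left[OF * iso2_lwhisker[OF \<rho>, of g]]) simp_all
  moreover have "u' \<odot> a \<in> W"
    using W_iso2[OF \<epsilon>a] a by simp
  ultimately show thesis using that[of "u' \<odot> a"] by simp
qed

text \<open>
  Lifting along \<open>w \<odot> p\<close> yields the required equation only after whiskering with \<open>w\<close>;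
  \<open>iso2_faithful\<close> then cancels \<open>w\<close>.
\<close>

lemma iso2_lift_through:
  assumes "w \<in> W" "w \<odot> p \<in> W" "\<delta> \<in> iso2 K (p \<odot> f) (p \<odot> g)"
    "p \<in> Ar1 K" "f \<in> Ar1 K" "g \<in> Ar1 K" "src K f = src K g"
    "tgt K f = src K p" "tgt K g = src K p" "tgt K p = src K w"
  obtains z \<phi> where "z \<in> W" "tgt K z = src K f" "\<phi> \<in> iso2 K (f \<odot> z) (g \<odot> z)"
    "id2 K p \<star> \<phi> = \<delta> \<star> id2 K z"
proof -
  note [simp] = assms(4-) iso2D(1-5)[OF assms(3)]
  have [simp]: "w \<in> Ar1 K" using assms by (blast intro: W_arr)
  have "id2 K w \<star> \<delta> \<in> iso2 K ((w \<odot> p) \<odot> f) ((w \<odot> p) \<odot> g)"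
    using iso2_lwhisker[OF assms(3), of w] by simp
  then obtain v \<beta> where v: "v \<in> W" "tgt K v = src K f" and \<beta>: "\<beta> \<in> iso2 K (f \<odot> v) (g \<odot> v)"
    and 1: "(id2 K w \<star> \<delta>) \<star> id2 K v = id2 K (w \<odot> p) \<star> \<beta>"
    by (rule iso2_lift[OF assms(2)]) auto
  have [simp]: "v \<in> Ar1 K" "tgt K v = src K g" using v by (simp_all add: W_arr)
  note [simp] = iso2D(1-5)[OF \<beta>]
  have a: "id2 K p \<star> \<beta> \<in> iso2 K (p \<odot> f \<odot> v) (p \<odot> g \<odot> v)"
    using iso2_lwhisker[OF \<beta>, of p] by simp
  have b: "\<delta> \<star> id2 K v \<in> iso2 K (p \<odot> f \<odot> v) (p \<odot> g \<odot> v)"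
    using iso2_rwhisker[OF assms(3), of v] by simp
  \<comment> \<open>The lifting equation, rebracketed: it asserts the desired identity only under
    \<open>w\<close>, which is the situation of \<open>iso2_faithful\<close>.\<close>
  have "id2 K w \<star> (id2 K p \<star> \<beta>) = id2 K w \<star> (\<delta> \<star> id2 K v)"
    using 1 by simp
  then obtain z where z: "z \<in> W" "tgt K z = src K v"
    and 2: "(id2 K p \<star> \<beta>) \<star> id2 K z = (\<delta> \<star> id2 K v) \<star> id2 K z"
    using iso2_faithful[OF assms(1) a b] by auto
  have [simp]: "z \<in> Ar1 K" using z by (blast intro: W_arr)
  show thesis
    using that[of "v \<odot> z" "\<beta> \<star> id2 K z"] v z 2 iso2_rwhisker[OF \<beta>, of z] W_comp1[OF z(1) v(1)] by simp
qed


section \<open>Representatives of 2-arrows of fractions\<close>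

lemma spansD:
  assumes "(w, f) \<in> spans K W x y"
  shows "w \<in> W" "w \<in> Ar1 K" "f \<in> Ar1 K" "src K f = src K w" "tgt K w = x" "tgt K f = y"
  using assms W_arr by (auto simp: spans_def)

text \<open>The defining equations are kept out of automation. They are opened once each, in
  \<open>reps_iff\<close>, \<open>rep_equiv_iff\<close> and \<open>rep_comp_iff\<close>, which
  restate them with the existential apex eliminated.\<close>

declare reps.simps [simp del] rep_equiv.simps [simp del] rep_comp.simps [simp del]

lemma reps_iff:
  "(p1, p2, \<alpha>, \<beta>) \<in> reps K W (w1, f1) (w2, f2) \<longleftrightarrow>
    p1 \<in> Ar1 K \<and> p2 \<in> Ar1 K \<and> src K p2 = src K p1 \<and> tgt K p1 = src K w1 \<and> tgt K p2 = src K w2 \<and>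
    w1 \<odot> p1 \<in> W \<and> w2 \<odot> p2 \<in> W \<and> \<alpha> \<in> iso2 K (w1 \<odot> p1) (w2 \<odot> p2) \<and>
    \<beta> \<in> Ar2 K \<and> src2 K \<beta> = f1 \<odot> p1 \<and> tgt2 K \<beta> = f2 \<odot> p2"
  by (auto simp: reps.simps)

lemma repsD:
  assumes "(p1, p2, \<alpha>, \<beta>) \<in> reps K W (w1, f1) (w2, f2)"
  shows "p1 \<in> Ar1 K" "p2 \<in> Ar1 K" "src K p2 = src K p1" "tgt K p1 = src K w1" "tgt K p2 = src K w2"
    "\<beta> \<in> Ar2 K" "src2 K \<beta> = f1 \<odot> p1" "tgt2 K \<beta> = f2 \<odot> p2"
    "\<alpha> \<in> Ar2 K" "src2 K \<alpha> = w1 \<odot> p1" "tgt2 K \<alpha> = w2 \<odot> p2"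
    "w1 \<odot> p1 \<in> W" "w2 \<odot> p2 \<in> W" "\<alpha> \<in> iso2 K (w1 \<odot> p1) (w2 \<odot> p2)"
  using assms iso2D(1-3)[of \<alpha> "w1 \<odot> p1" "w2 \<odot> p2"] by (simp_all add: reps_iff)

fun restrict :: "('a, 'c) rep \<Rightarrow> 'a \<Rightarrow> ('a, 'c) rep" where
  "restrict (p1, p2, \<alpha>, \<beta>) q = (p1 \<odot> q, p2 \<odot> q, \<alpha> \<star> id2 K q, \<beta> \<star> id2 K q)"

text \<open>An isomorphism of representatives over one and the same apex. The two components are
  arguments because pasting two such isomorphisms requires an equation between the right component
  of the first and the left component of the second.\<close>

fun rep_iso_by :: "'a span \<Rightarrow> 'a span \<Rightarrow> 'c \<Rightarrow> 'c \<Rightarrow> ('a, 'c) rep \<Rightarrow> ('a, 'c) rep \<Rightarrow> bool" where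
  "rep_iso_by (w1, f1) (w2, f2) \<gamma>1 \<gamma>2 (p1, p2, \<alpha>, \<beta>) (p1', p2', \<alpha>', \<beta>') \<longleftrightarrow>
    \<gamma>1 \<in> iso2 K p1 p1' \<and> \<gamma>2 \<in> iso2 K p2 p2' \<and>
    (id2 K w2 \<star> \<gamma>2) \<cdot> \<alpha> = \<alpha>' \<cdot> (id2 K w1 \<star> \<gamma>1) \<and>
    (id2 K f2 \<star> \<gamma>2) \<cdot> \<beta> = \<beta>' \<cdot> (id2 K f1 \<star> \<gamma>1)"

definition rep_iso :: "'a span \<Rightarrow> 'a span \<Rightarrow> ('a, 'c) rep \<Rightarrow> ('a, 'c) rep \<Rightarrow> bool" where
  "rep_iso S T d d' \<longleftrightarrow> (\<exists>\<gamma>1 \<gamma>2. rep_iso_by S T \<gamma>1 \<gamma>2 d d')"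

text \<open>Composition of representatives that already share their apex, with \<delta> identifying
  the two middle legs. A general composite is the paste of two restrictions, so that making a choice
  and computing the 2-arrows become separate matters.\<close>

fun paste :: "'a span \<Rightarrow> 'c \<Rightarrow> ('a, 'c) rep \<Rightarrow> ('a, 'c) rep \<Rightarrow> ('a, 'c) rep" where
  "paste (w2, f2) \<delta> (p1, p2, \<alpha>, \<beta>) (p1', p2', \<alpha>', \<beta>') =
    (p1, p2', \<alpha>' \<cdot> (id2 K w2 \<star> \<delta>) \<cdot> \<alpha>, \<beta>' \<cdot> (id2 K f2 \<star> \<delta>) \<cdot> \<beta>)"

abbreviation left_leg :: "('a, 'c) rep \<Rightarrow> 'a" where "left_leg d \<equiv> fst d"
abbreviation right_leg :: "('a, 'c) rep \<Rightarrow> 'a" where "right_leg d \<equiv> fst (snd d)"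
abbreviation apex :: "('a, 'c) rep \<Rightarrow> 'o" where "apex d \<equiv> src K (left_leg d)"

text \<open>The 1-arrows along which \<open>d\<close> may be restricted. The condition asks the
  composite with the left leg to be in \<open>W\<close>, not \<open>q\<close> itself; the
  corresponding fact for the other leg follows since \<alpha> is invertible.\<close>

definition covers :: "'a span \<Rightarrow> ('a, 'c) rep \<Rightarrow> 'a \<Rightarrow> bool" where
  "covers S d q \<longleftrightarrow> q \<in> Ar1 K \<and> tgt K q = apex d \<and> fst S \<odot> left_leg d \<odot> q \<in> W"

lemma left_leg_restrict [simp]: "left_leg (restrict d q) = left_leg d \<odot> q"
  and right_leg_restrict [simp]: "right_leg (restrict d q) = right_leg d \<odot> q"
  by (cases d; simp)+

lemma legs_paste [simp]: "left_leg (paste S \<delta> d d') = left_leg d" "right_leg (paste S \<delta> d d') = right_leg d'"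
  by (cases S; cases d; cases d'; simp)+

lemma legs_reps:
  assumes "d \<in> reps K W S T"
  shows "left_leg d \<in> Ar1 K" "right_leg d \<in> Ar1 K" "src K (right_leg d) = apex d"
    "tgt K (left_leg d) = src K (fst S)" "tgt K (right_leg d) = src K (fst T)"
    "fst S \<odot> left_leg d \<in> W" "fst T \<odot> right_leg d \<in> W"
  using assms by (cases S; cases T; cases d; simp add: reps_iff)+

lemma spans_fst:
  assumes "S \<in> spans K W x y"
  shows "fst S \<in> W" "fst S \<in> Ar1 K" "tgt K (fst S) = x"
  using assms W_arr by (auto simp: spans_def)

lemma covers_id:
  assumes "d \<in> reps K W S T"
  shows "covers S d (id1 K (apex d))"
  using legs_reps[OF assms] by (simp add: covers_def)

lemma covers_W:
  assumes "S \<in> spans K W x y" "d \<in> reps K W S T" "covers S d q" "v \<in> W" "tgt K v = src K q"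
  shows "covers S d (q \<odot> v)"
proof -
  note [simp] = legs_reps(1-5)[OF assms(2)] spans_fst(2)[OF assms(1)]
  have "v \<in> Ar1 K" using assms(4) by (rule W_arr)
  then show ?thesis
    using assms(3,5) W_comp1[OF assms(4), of "fst S \<odot> left_leg d \<odot> q"] by (simp add: covers_def)
qed

lemma restrict_reps:
  assumes "S \<in> spans K W x y" "T \<in> spans K W x y" "d \<in> reps K W S T" "covers S d q"
  shows "restrict d q \<in> reps K W S T"
proof -
  obtain w1 f1 where S: "S = (w1, f1)" by fastforce
  obtain w2 f2 where T: "T = (w2, f2)" by fastforce
  obtain p1 p2 \<alpha> \<beta> where d: "d = (p1, p2, \<alpha>, \<beta>)" by (rule prod_cases4)
  note [simp] = spansD[OF assms(1)[unfolded S]] spansD[OF assms(2)[unfolded T]]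
    repsD(1-11)[OF assms(3)[unfolded S T d]]
  have q: "q \<in> Ar1 K" "tgt K q = src K p1" "w1 \<odot> p1 \<odot> q \<in> W"
    using assms(4) by (simp_all add: covers_def d S)
  have i: "\<alpha> \<star> id2 K q \<in> iso2 K (w1 \<odot> p1 \<odot> q) (w2 \<odot> p2 \<odot> q)"
    using iso2_rwhisker[OF repsD(14)[OF assms(3)[unfolded S T d]], of q] q by simp
  show ?thesis
    using i q W_iso2[OF i] by (simp add: S T d reps_iff)
qed

lemma restrict_id:
  assumes "d \<in> reps K W S T" "S \<in> spans K W x y" "T \<in> spans K W x y"
  shows "restrict d (id1 K (apex d)) = d"
proof -
  obtain w1 f1 where S: "S = (w1, f1)" by fastforce
  obtain w2 f2 where T: "T = (w2, f2)" by fastforce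
  obtain p1 p2 \<alpha> \<beta> where d: "d = (p1, p2, \<alpha>, \<beta>)" by (rule prod_cases4)
  note [simp] = spansD[OF assms(2)[unfolded S]] spansD[OF assms(3)[unfolded T]]
    repsD(1-11)[OF assms(1)[unfolded S T d]]
  show ?thesis by (simp add: d)
qed

lemma restrict_restrict:
  assumes "d \<in> reps K W S T" "S \<in> spans K W x y" "T \<in> spans K W x y"
    "q \<in> Ar1 K" "r \<in> Ar1 K" "tgt K q = apex d" "tgt K r = src K q"
  shows "restrict (restrict d q) r = restrict d (q \<odot> r)"
proof -
  obtain w1 f1 where S: "S = (w1, f1)" by fastforce
  obtain w2 f2 where T: "T = (w2, f2)" by fastforce
  obtain p1 p2 \<alpha> \<beta> where d: "d = (p1, p2, \<alpha>, \<beta>)" by (rule prod_cases4)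
  note [simp] = spansD[OF assms(2)[unfolded S]] spansD[OF assms(3)[unfolded T]]
    repsD(1-11)[OF assms(1)[unfolded S T d]]
  show ?thesis using assms(4-) by (simp add: d)
qed

section \<open>Isomorphisms of representatives over a fixed apex\<close>

lemma rep_iso_refl:
  assumes "d \<in> reps K W S T" "S \<in> spans K W x y" "T \<in> spans K W x y"
  shows "rep_iso_by S T (id2 K (left_leg d)) (id2 K (right_leg d)) d d"
proof -
  obtain w1 f1 where S: "S = (w1, f1)" by fastforce
  obtain w2 f2 where T: "T = (w2, f2)" by fastforce
  obtain p1 p2 \<alpha> \<beta> where d: "d = (p1, p2, \<alpha>, \<beta>)" by (rule prod_cases4)
  note [simp] = spansD[OF assms(2)[unfolded S]] spansD[OF assms(3)[unfolded T]]
    repsD(1-11)[OF assms(1)[unfolded S T d]]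
  show ?thesis by (simp add: S T d)
qed

text \<open>A representative carries two squares, an invertible one over the legs in
  \<open>W\<close> and one over the other legs. With arbitrary legs \<open>u1\<close>,
  \<open>u2\<close> and arbitrary 2-arrows a single statement serves both;
  \<open>square_vcomp\<close>, \<open>square_restrict\<close> and \<open>square_paste\<close> have
  this form for the same reason.\<close>

lemma square_inverse:
  assumes "\<gamma>1 \<in> iso2 K p1 p1'" "\<gamma>1' \<in> iso2 K p1' p1" "\<gamma>1 \<cdot> \<gamma>1' = id2 K p1'"
    "\<gamma>2 \<in> iso2 K p2 p2'" "\<gamma>2' \<in> iso2 K p2' p2" "\<gamma>2' \<cdot> \<gamma>2 = id2 K p2"
    "\<alpha> \<in> Ar2 K" "src2 K \<alpha> = u1 \<odot> p1" "tgt2 K \<alpha> = u2 \<odot> p2"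
    "\<alpha>' \<in> Ar2 K" "src2 K \<alpha>' = u1 \<odot> p1'" "tgt2 K \<alpha>' = u2 \<odot> p2'"
    "u1 \<in> Ar1 K" "u2 \<in> Ar1 K" "tgt K p1 = src K u1" "tgt K p2 = src K u2"
    and eq: "(id2 K u2 \<star> \<gamma>2) \<cdot> \<alpha> = \<alpha>' \<cdot> (id2 K u1 \<star> \<gamma>1)"
  shows "(id2 K u2 \<star> \<gamma>2') \<cdot> \<alpha>' = \<alpha> \<cdot> (id2 K u1 \<star> \<gamma>1')"
proof -
  note [simp] = assms(7-16) iso2D[OF assms(1)] iso2D[OF assms(4)] iso2D(1-5)[OF assms(2)] iso2D(1-5)[OF assms(5)]
  have "(id2 K u2 \<star> \<gamma>2') \<cdot> \<alpha>' = (id2 K u2 \<star> \<gamma>2') \<cdot> \<alpha>' \<cdot> (id2 K u1 \<star> (\<gamma>1 \<cdot> \<gamma>1'))"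
    by (simp add: assms(3) del: lwhisker_vcomp)
  also have "\<dots> = (id2 K u2 \<star> \<gamma>2') \<cdot> (\<alpha>' \<cdot> (id2 K u1 \<star> \<gamma>1)) \<cdot> (id2 K u1 \<star> \<gamma>1')"
    by simp
  also have "\<dots> = (id2 K u2 \<star> (\<gamma>2' \<cdot> \<gamma>2)) \<cdot> \<alpha> \<cdot> (id2 K u1 \<star> \<gamma>1')"
    unfolding eq[symmetric] by simp
  also have "\<dots> = \<alpha> \<cdot> (id2 K u1 \<star> \<gamma>1')"
    by (simp add: assms(6) del: lwhisker_vcomp)
  finally show ?thesis .
qed

lemma rep_iso_sym:
  assumes "rep_iso S T d d'" "d \<in> reps K W S T" "d' \<in> reps K W S T" "S \<in> spans K W x y" "T \<in> spans K W x y"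
  shows "rep_iso S T d' d"
proof -
  obtain w1 f1 where S: "S = (w1, f1)" by fastforce
  obtain w2 f2 where T: "T = (w2, f2)" by fastforce
  obtain p1 p2 \<alpha> \<beta> where d: "d = (p1, p2, \<alpha>, \<beta>)" by (rule prod_cases4)
  obtain p1' p2' \<alpha>' \<beta>' where d': "d' = (p1', p2', \<alpha>', \<beta>')" by (rule prod_cases4)
  note [simp] = spansD[OF assms(4)[unfolded S]] spansD[OF assms(5)[unfolded T]]
    repsD(1-11)[OF assms(2)[unfolded S T d]] repsD(1-11)[OF assms(3)[unfolded S T d']]
  obtain \<gamma>1 \<gamma>2 where \<gamma>: "\<gamma>1 \<in> iso2 K p1 p1'" "\<gamma>2 \<in> iso2 K p2 p2'"
    "(id2 K w2 \<star> \<gamma>2) \<cdot> \<alpha> = \<alpha>' \<cdot> (id2 K w1 \<star> \<gamma>1)"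
    "(id2 K f2 \<star> \<gamma>2) \<cdot> \<beta> = \<beta>' \<cdot> (id2 K f1 \<star> \<gamma>1)"
    using assms(1) by (auto simp: rep_iso_def S T d d')
  obtain \<gamma>1' where 1: "\<gamma>1' \<in> iso2 K p1' p1" "\<gamma>1 \<cdot> \<gamma>1' = id2 K p1'"
    using \<gamma>(1) by (auto elim: iso2E)
  obtain \<gamma>2' where 2: "\<gamma>2' \<in> iso2 K p2' p2" "\<gamma>2' \<cdot> \<gamma>2 = id2 K p2"
    using \<gamma>(2) by (auto elim: iso2E)
  have "rep_iso_by S T \<gamma>1' \<gamma>2' d' d"
    using square_inverse[OF \<gamma>(1) 1 \<gamma>(2) 2 _ _ _ _ _ _ _ _ _ _ \<gamma>(3)]
      square_inverse[OF \<gamma>(1) 1 \<gamma>(2) 2 _ _ _ _ _ _ _ _ _ _ \<gamma>(4)] 1 2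
    by (simp add: S T d d')
  then show ?thesis by (auto simp: rep_iso_def)
qed

lemma square_vcomp:
  assumes "\<gamma>1 \<in> iso2 K p1 p1'" "\<gamma>1' \<in> iso2 K p1' p1''"
    "\<gamma>2 \<in> iso2 K p2 p2'" "\<gamma>2' \<in> iso2 K p2' p2''"
    "\<alpha> \<in> Ar2 K" "src2 K \<alpha> = u1 \<odot> p1" "tgt2 K \<alpha> = u2 \<odot> p2"
    "\<alpha>' \<in> Ar2 K" "src2 K \<alpha>' = u1 \<odot> p1'" "tgt2 K \<alpha>' = u2 \<odot> p2'"
    "\<alpha>'' \<in> Ar2 K" "src2 K \<alpha>'' = u1 \<odot> p1''" "tgt2 K \<alpha>'' = u2 \<odot> p2''"
    "u1 \<in> Ar1 K" "u2 \<in> Ar1 K" "tgt K p1 = src K u1" "tgt K p2 = src K u2"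
    and eq: "(id2 K u2 \<star> \<gamma>2) \<cdot> \<alpha> = \<alpha>' \<cdot> (id2 K u1 \<star> \<gamma>1)"
    and eq': "(id2 K u2 \<star> \<gamma>2') \<cdot> \<alpha>' = \<alpha>'' \<cdot> (id2 K u1 \<star> \<gamma>1')"
  shows "(id2 K u2 \<star> (\<gamma>2' \<cdot> \<gamma>2)) \<cdot> \<alpha> = \<alpha>'' \<cdot> (id2 K u1 \<star> (\<gamma>1' \<cdot> \<gamma>1))"
proof -
  note [simp] = assms(5-17) iso2D[OF assms(1)] iso2D[OF assms(2)] iso2D[OF assms(3)] iso2D[OF assms(4)]
  have "(id2 K u2 \<star> (\<gamma>2' \<cdot> \<gamma>2)) \<cdot> \<alpha> = ((id2 K u2 \<star> \<gamma>2') \<cdot> \<alpha>') \<cdot> (id2 K u1 \<star> \<gamma>1)"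
    by (simp add: eq)
  also have "\<dots> = \<alpha>'' \<cdot> (id2 K u1 \<star> (\<gamma>1' \<cdot> \<gamma>1))"
    unfolding eq' by simp
  finally show ?thesis .
qed

lemma rep_iso_trans:
  assumes "rep_iso S T d d'" "rep_iso S T d' d''" "d \<in> reps K W S T" "d' \<in> reps K W S T" "d'' \<in> reps K W S T"
    "S \<in> spans K W x y" "T \<in> spans K W x y"
  shows "rep_iso S T d d''"
proof -
  obtain w1 f1 where S: "S = (w1, f1)" by fastforce
  obtain w2 f2 where T: "T = (w2, f2)" by fastforce
  obtain p1 p2 \<alpha> \<beta> where d: "d = (p1, p2, \<alpha>, \<beta>)" by (rule prod_cases4)
  obtain p1' p2' \<alpha>' \<beta>' where d': "d' = (p1', p2', \<alpha>', \<beta>')" by (rule prod_cases4)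
  obtain p1'' p2'' \<alpha>'' \<beta>'' where d'': "d'' = (p1'', p2'', \<alpha>'', \<beta>'')" by (rule prod_cases4)
  note [simp] = spansD[OF assms(6)[unfolded S]] spansD[OF assms(7)[unfolded T]]
    repsD(1-11)[OF assms(3)[unfolded S T d]] repsD(1-11)[OF assms(4)[unfolded S T d']]
    repsD(1-11)[OF assms(5)[unfolded S T d'']]
  obtain \<gamma>1 \<gamma>2 where \<gamma>: "\<gamma>1 \<in> iso2 K p1 p1'" "\<gamma>2 \<in> iso2 K p2 p2'"
    "(id2 K w2 \<star> \<gamma>2) \<cdot> \<alpha> = \<alpha>' \<cdot> (id2 K w1 \<star> \<gamma>1)"
    "(id2 K f2 \<star> \<gamma>2) \<cdot> \<beta> = \<beta>' \<cdot> (id2 K f1 \<star> \<gamma>1)"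
    using assms(1) by (auto simp: rep_iso_def S T d d')
  obtain \<gamma>1' \<gamma>2' where \<gamma>': "\<gamma>1' \<in> iso2 K p1' p1''" "\<gamma>2' \<in> iso2 K p2' p2''"
    "(id2 K w2 \<star> \<gamma>2') \<cdot> \<alpha>' = \<alpha>'' \<cdot> (id2 K w1 \<star> \<gamma>1')"
    "(id2 K f2 \<star> \<gamma>2') \<cdot> \<beta>' = \<beta>'' \<cdot> (id2 K f1 \<star> \<gamma>1')"
    using assms(2) by (auto simp: rep_iso_def S T d' d'')
  have "rep_iso_by S T (\<gamma>1' \<cdot> \<gamma>1) (\<gamma>2' \<cdot> \<gamma>2) d d''"
    unfolding S T d d'' rep_iso_by.simps
  proof (intro conjI)
    show "(id2 K w2 \<star> (\<gamma>2' \<cdot> \<gamma>2)) \<cdot> \<alpha> = \<alpha>'' \<cdot> (id2 K w1 \<star> (\<gamma>1' \<cdot> \<gamma>1))"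
      by (rule square_vcomp[OF \<gamma>(1) \<gamma>'(1) \<gamma>(2) \<gamma>'(2) _ _ _ _ _ _ _ _ _ _ _ _ _ \<gamma>(3) \<gamma>'(3)]) simp_all
    show "(id2 K f2 \<star> (\<gamma>2' \<cdot> \<gamma>2)) \<cdot> \<beta> = \<beta>'' \<cdot> (id2 K f1 \<star> (\<gamma>1' \<cdot> \<gamma>1))"
      by (rule square_vcomp[OF \<gamma>(1) \<gamma>'(1) \<gamma>(2) \<gamma>'(2) _ _ _ _ _ _ _ _ _ _ _ _ _ \<gamma>(4) \<gamma>'(4)]) simp_all
  qed (use \<gamma> \<gamma>' iso2_vcomp in blast)+
  then show ?thesis by (auto simp: rep_iso_def)
qed

lemma square_restrict:
  assumes "\<gamma>1 \<in> iso2 K p1 p1'" "\<gamma>2 \<in> iso2 K p2 p2'"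
    "\<alpha> \<in> Ar2 K" "src2 K \<alpha> = u1 \<odot> p1" "tgt2 K \<alpha> = u2 \<odot> p2"
    "\<alpha>' \<in> Ar2 K" "src2 K \<alpha>' = u1 \<odot> p1'" "tgt2 K \<alpha>' = u2 \<odot> p2'"
    "u1 \<in> Ar1 K" "u2 \<in> Ar1 K" "tgt K p1 = src K u1" "tgt K p2 = src K u2"
    "q \<in> Ar1 K" "src K p1 = tgt K q" "src K p2 = tgt K q"
    and eq: "(id2 K u2 \<star> \<gamma>2) \<cdot> \<alpha> = \<alpha>' \<cdot> (id2 K u1 \<star> \<gamma>1)"
  shows "(id2 K u2 \<star> (\<gamma>2 \<star> id2 K q)) \<cdot> (\<alpha> \<star> id2 K q) = (\<alpha>' \<star> id2 K q) \<cdot> (id2 K u1 \<star> (\<gamma>1 \<star> id2 K q))"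
proof -
  note [simp] = assms(3-15) iso2D[OF assms(1)] iso2D[OF assms(2)]
  have "((id2 K u2 \<star> \<gamma>2) \<cdot> \<alpha>) \<star> id2 K q = (\<alpha>' \<cdot> (id2 K u1 \<star> \<gamma>1)) \<star> id2 K q"
    by (simp only: eq)
  then show ?thesis by simp
qed

lemma rep_iso_by_restrict:
  assumes "rep_iso_by S T \<gamma>1 \<gamma>2 d d'" "d \<in> reps K W S T" "d' \<in> reps K W S T"
    "S \<in> spans K W x y" "T \<in> spans K W x y" "q \<in> Ar1 K" "tgt K q = apex d"
  shows "rep_iso_by S T (\<gamma>1 \<star> id2 K q) (\<gamma>2 \<star> id2 K q) (restrict d q) (restrict d' q)"
proof -
  obtain w1 f1 where S: "S = (w1, f1)" by fastforce
  obtain w2 f2 where T: "T = (w2, f2)" by fastforce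
  obtain p1 p2 \<alpha> \<beta> where d: "d = (p1, p2, \<alpha>, \<beta>)" by (rule prod_cases4)
  obtain p1' p2' \<alpha>' \<beta>' where d': "d' = (p1', p2', \<alpha>', \<beta>')" by (rule prod_cases4)
  note [simp] = spansD[OF assms(4)[unfolded S]] spansD[OF assms(5)[unfolded T]]
    repsD(1-11)[OF assms(2)[unfolded S T d]] repsD(1-11)[OF assms(3)[unfolded S T d']]
  have \<gamma>: "\<gamma>1 \<in> iso2 K p1 p1'" "\<gamma>2 \<in> iso2 K p2 p2'"
    "(id2 K w2 \<star> \<gamma>2) \<cdot> \<alpha> = \<alpha>' \<cdot> (id2 K w1 \<star> \<gamma>1)"
    "(id2 K f2 \<star> \<gamma>2) \<cdot> \<beta> = \<beta>' \<cdot> (id2 K f1 \<star> \<gamma>1)"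
    using assms(1) by (auto simp: S T d d')
  have q: "q \<in> Ar1 K" "tgt K q = src K p1" using assms(6,7) by (simp_all add: d)
  show ?thesis
    unfolding S T d d' rep_iso_by.simps restrict.simps
    using q iso2_rwhisker[OF \<gamma>(1)] iso2_rwhisker[OF \<gamma>(2)]
      square_restrict[OF \<gamma>(1,2) _ _ _ _ _ _ _ _ _ _ _ _ _ \<gamma>(3), of q]
      square_restrict[OF \<gamma>(1,2) _ _ _ _ _ _ _ _ _ _ _ _ _ \<gamma>(4), of q]
    by simp
qed

text \<open>Both squares commute by \<open>whisker_swap\<close>. Thus the restriction of a
  representative depends on \<open>q\<close> only up to isomorphism.\<close>

lemma rep_iso_along:
  assumes "d \<in> reps K W S T" "S \<in> spans K W x y" "T \<in> spans K W x y"
    "\<theta> \<in> iso2 K q q'" "tgt K q = apex d"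
  shows "rep_iso_by S T (id2 K (left_leg d) \<star> \<theta>) (id2 K (right_leg d) \<star> \<theta>) (restrict d q) (restrict d q')"
proof -
  obtain w1 f1 where S: "S = (w1, f1)" by fastforce
  obtain w2 f2 where T: "T = (w2, f2)" by fastforce
  obtain p1 p2 \<alpha> \<beta> where d: "d = (p1, p2, \<alpha>, \<beta>)" by (rule prod_cases4)
  note [simp] = spansD[OF assms(2)[unfolded S]] spansD[OF assms(3)[unfolded T]]
    repsD(1-11)[OF assms(1)[unfolded S T d]] iso2D[OF assms(4)]
  have [simp]: "tgt K q = src K p1" using assms(5) by (simp add: d)
  show ?thesis
    using iso2_lwhisker[OF assms(4), of p1] iso2_lwhisker[OF assms(4), of p2]
      whisker_swap[of \<alpha> \<theta>] whisker_swap[of \<beta> \<theta>]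
    by (simp add: S T d)
qed

text \<open>The isomorphism of left legs forces a common apex and, whiskered on both sides,
  transports membership in \<open>W\<close>.\<close>

lemma rep_iso_covers:
  assumes "rep_iso S T d d'" "d \<in> reps K W S T" "d' \<in> reps K W S T"
    "S \<in> spans K W x y" "T \<in> spans K W x y"
  shows "apex d' = apex d" "covers S d q \<longleftrightarrow> covers S d' q"
proof -
  obtain w1 f1 where S: "S = (w1, f1)" by fastforce
  obtain w2 f2 where T: "T = (w2, f2)" by fastforce
  obtain p1 p2 \<alpha> \<beta> where d: "d = (p1, p2, \<alpha>, \<beta>)" by (rule prod_cases4)
  obtain p1' p2' \<alpha>' \<beta>' where d': "d' = (p1', p2', \<alpha>', \<beta>')" by (rule prod_cases4)
  note [simp] = spansD[OF assms(4)[unfolded S]] spansD[OF assms(5)[unfolded T]]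
    repsD(1-11)[OF assms(2)[unfolded S T d]] repsD(1-11)[OF assms(3)[unfolded S T d']]
  obtain \<gamma>1 where \<gamma>: "\<gamma>1 \<in> iso2 K p1 p1'"
    using assms(1) by (auto simp: rep_iso_def S T d d')
  note [simp] = iso2D(6,7)[OF \<gamma>]
  show "apex d' = apex d" by (simp add: d d')
  show "covers S d q \<longleftrightarrow> covers S d' q"
  proof (cases "q \<in> Ar1 K \<and> tgt K q = src K p1")
    case True
    then have "id2 K w1 \<star> \<gamma>1 \<star> id2 K q \<in> iso2 K (w1 \<odot> p1 \<odot> q) (w1 \<odot> p1' \<odot> q)"
      by (intro iso2_lwhisker iso2_rwhisker \<gamma>) simp_all
    from W_iso2[OF this] show ?thesis by (simp add: covers_def S d d')
  qed (auto simp: covers_def S d d')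
qed

text \<open>In \<open>rep_equiv\<close> the 2-arrow between left legs runs against the one between
  right legs. Moving its inverse across the equation turns the pasted equation into a commuting
  square.\<close>

lemma iso2_transpose:
  assumes "\<gamma> \<in> iso2 K a b" "\<gamma>' \<in> iso2 K b a" "\<gamma>' \<cdot> \<gamma> = id2 K a" "\<gamma> \<cdot> \<gamma>' = id2 K b"
    "u \<in> Ar1 K" "tgt K a = src K u" "X \<in> Ar2 K" "src2 K X = u \<odot> a" "Z \<in> Ar2 K" "src2 K Z = u \<odot> b"
  shows "X = Z \<cdot> (id2 K u \<star> \<gamma>) \<longleftrightarrow> X \<cdot> (id2 K u \<star> \<gamma>') = Z"
proof -
  note [simp] = assms(5-) iso2D[OF assms(1)] iso2D(1-5)[OF assms(2)]
  have 1: "(id2 K u \<star> \<gamma>) \<cdot> (id2 K u \<star> \<gamma>') = id2 K (u \<odot> b)"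
    using lwhisker_vcomp[of \<gamma>' \<gamma> u] by (simp add: assms(4) del: lwhisker_vcomp)
  have 2: "(id2 K u \<star> \<gamma>') \<cdot> (id2 K u \<star> \<gamma>) = id2 K (u \<odot> a)"
    using lwhisker_vcomp[of \<gamma> \<gamma>' u] by (simp add: assms(3) del: lwhisker_vcomp)
  show ?thesis
  proof
    assume "X = Z \<cdot> (id2 K u \<star> \<gamma>)"
    then have "X \<cdot> (id2 K u \<star> \<gamma>') = Z \<cdot> (id2 K u \<star> \<gamma>) \<cdot> (id2 K u \<star> \<gamma>')" by simp
    then show "X \<cdot> (id2 K u \<star> \<gamma>') = Z" by (simp add: 1)
  next
    assume "X \<cdot> (id2 K u \<star> \<gamma>') = Z"
    then have "Z \<cdot> (id2 K u \<star> \<gamma>) = X \<cdot> (id2 K u \<star> \<gamma>') \<cdot> (id2 K u \<star> \<gamma>)" by auto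
    then show "X = Z \<cdot> (id2 K u \<star> \<gamma>)" by (simp add: 2)
  qed
qed

text \<open>
  Turning \<open>\<gamma>1\<close> around makes the equations of \<open>rep_equiv\<close> a pair of commuting squares:
  equivalent representatives are those that become isomorphic after restriction along covers.
\<close>

lemma rep_equiv_iff:
  assumes "d \<in> reps K W S T" "d' \<in> reps K W S T" "S \<in> spans K W x y" "T \<in> spans K W x y"
  shows "rep_equiv K W S T d d' \<longleftrightarrow>
    (\<exists>q q'. covers S d q \<and> covers S d' q' \<and> rep_iso S T (restrict d q) (restrict d' q'))"
proof -
  obtain w1 f1 where S: "S = (w1, f1)" by fastforce
  obtain w2 f2 where T: "T = (w2, f2)" by fastforce
  obtain p1 p2 \<alpha> \<beta> where d: "d = (p1, p2, \<alpha>, \<beta>)" by (rule prod_cases4)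
  obtain p1' p2' \<alpha>' \<beta>' where d': "d' = (p1', p2', \<alpha>', \<beta>')" by (rule prod_cases4)
  note [simp] = spansD[OF assms(3)[unfolded S]] spansD[OF assms(4)[unfolded T]]
    repsD(1-11)[OF assms(1)[unfolded S T d]] repsD(1-11)[OF assms(2)[unfolded S T d']]
  have key: "(id2 K w2 \<star> \<gamma>2) \<cdot> (\<alpha> \<star> id2 K q) = (\<alpha>' \<star> id2 K q') \<cdot> (id2 K w1 \<star> \<gamma>1) \<and>
      (id2 K f2 \<star> \<gamma>2) \<cdot> (\<beta> \<star> id2 K q) = (\<beta>' \<star> id2 K q') \<cdot> (id2 K f1 \<star> \<gamma>1) \<longleftrightarrow>
      (id2 K w2 \<star> \<gamma>2) \<cdot> (\<alpha> \<star> id2 K q) \<cdot> (id2 K w1 \<star> \<gamma>1') = \<alpha>' \<star> id2 K q' \<and>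
      (id2 K f2 \<star> \<gamma>2) \<cdot> (\<beta> \<star> id2 K q) \<cdot> (id2 K f1 \<star> \<gamma>1') = \<beta>' \<star> id2 K q'"
    if q: "q \<in> Ar1 K" "tgt K q = src K p1" "q' \<in> Ar1 K" "tgt K q' = src K p1'"
      and \<gamma>: "\<gamma>1 \<in> iso2 K (p1 \<odot> q) (p1' \<odot> q')" "\<gamma>1' \<in> iso2 K (p1' \<odot> q') (p1 \<odot> q)"
        "\<gamma>1' \<cdot> \<gamma>1 = id2 K (p1 \<odot> q)" "\<gamma>1 \<cdot> \<gamma>1' = id2 K (p1' \<odot> q')"
      and \<gamma>2: "\<gamma>2 \<in> iso2 K (p2 \<odot> q) (p2' \<odot> q')" for q q' \<gamma>1 \<gamma>1' \<gamma>2
  proof -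
    note [simp] = q iso2D(1-3)[OF \<gamma>(1)] iso2D(1-3)[OF \<gamma>(2)] iso2D(1-3)[OF \<gamma>2]
    show ?thesis
      using iso2_transpose[OF \<gamma>, of w1 "(id2 K w2 \<star> \<gamma>2) \<cdot> (\<alpha> \<star> id2 K q)" "\<alpha>' \<star> id2 K q'"]
        iso2_transpose[OF \<gamma>, of f1 "(id2 K f2 \<star> \<gamma>2) \<cdot> (\<beta> \<star> id2 K q)" "\<beta>' \<star> id2 K q'"]
      by simp
  qed
  show ?thesis
  proof
    assume "rep_equiv K W S T d d'"
    then obtain t q q' \<gamma>1' \<gamma>2 where q: "q \<in> hom (cat1 K) t (src K p1)" "q' \<in> hom (cat1 K) t (src K p1')"
      and \<gamma>1': "\<gamma>1' \<in> iso2 K (p1' \<odot> q') (p1 \<odot> q)" and \<gamma>2: "\<gamma>2 \<in> iso2 K (p2 \<odot> q) (p2' \<odot> q')"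
      and W: "w1 \<odot> p1 \<odot> q \<in> W" "w1 \<odot> p1' \<odot> q' \<in> W"
      and eqs: "(id2 K w2 \<star> \<gamma>2) \<cdot> (\<alpha> \<star> id2 K q) \<cdot> (id2 K w1 \<star> \<gamma>1') = \<alpha>' \<star> id2 K q'"
      "(id2 K f2 \<star> \<gamma>2) \<cdot> (\<beta> \<star> id2 K q) \<cdot> (id2 K f1 \<star> \<gamma>1') = \<beta>' \<star> id2 K q'"
      unfolding rep_equiv.simps S T d d' by blast
    obtain \<gamma>1 where \<gamma>1: "\<gamma>1 \<in> iso2 K (p1 \<odot> q) (p1' \<odot> q')"
      "\<gamma>1' \<cdot> \<gamma>1 = id2 K (p1 \<odot> q)" "\<gamma>1 \<cdot> \<gamma>1' = id2 K (p1' \<odot> q')"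
      using \<gamma>1' by (auto elim: iso2E)
    have q': "q \<in> Ar1 K" "tgt K q = src K p1" "q' \<in> Ar1 K" "tgt K q' = src K p1'" using q by simp_all
    show "\<exists>q q'. covers S d q \<and> covers S d' q' \<and> rep_iso S T (restrict d q) (restrict d' q')"
    proof (intro exI conjI)
      show "covers S d q" "covers S d' q'" using q' W by (simp_all add: covers_def S d d')
      have "rep_iso_by S T \<gamma>1 \<gamma>2 (restrict d q) (restrict d' q')"
        using key[OF q' \<gamma>1(1) \<gamma>1' \<gamma>1(2,3) \<gamma>2] eqs \<gamma>1(1) \<gamma>2 by (simp add: S T d d')
      then show "rep_iso S T (restrict d q) (restrict d' q')" by (auto simp: rep_iso_def)
    qed
  next
    assume "\<exists>q q'. covers S d q \<and> covers S d' q' \<and> rep_iso S T (restrict d q) (restrict d' q')"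
    then obtain q q' \<gamma>1 \<gamma>2 where c: "covers S d q" "covers S d' q'"
      and "rep_iso_by S T \<gamma>1 \<gamma>2 (restrict d q) (restrict d' q')"
      by (auto simp: rep_iso_def)
    then have \<gamma>1: "\<gamma>1 \<in> iso2 K (p1 \<odot> q) (p1' \<odot> q')" and \<gamma>2: "\<gamma>2 \<in> iso2 K (p2 \<odot> q) (p2' \<odot> q')"
      and eqs: "(id2 K w2 \<star> \<gamma>2) \<cdot> (\<alpha> \<star> id2 K q) = (\<alpha>' \<star> id2 K q') \<cdot> (id2 K w1 \<star> \<gamma>1)"
      "(id2 K f2 \<star> \<gamma>2) \<cdot> (\<beta> \<star> id2 K q) = (\<beta>' \<star> id2 K q') \<cdot> (id2 K f1 \<star> \<gamma>1)"
      by (simp_all add: S T d d')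
    have q: "q \<in> Ar1 K" "tgt K q = src K p1" "q' \<in> Ar1 K" "tgt K q' = src K p1'"
      and W: "w1 \<odot> p1 \<odot> q \<in> W" "w1 \<odot> p1' \<odot> q' \<in> W"
      using c by (simp_all add: covers_def S d d')
    obtain \<gamma>1' where \<gamma>1': "\<gamma>1' \<in> iso2 K (p1' \<odot> q') (p1 \<odot> q)"
      "\<gamma>1' \<cdot> \<gamma>1 = id2 K (p1 \<odot> q)" "\<gamma>1 \<cdot> \<gamma>1' = id2 K (p1' \<odot> q')"
      using \<gamma>1 by (auto elim: iso2E)
    have "src K q' = src K q" using iso2D(6)[OF \<gamma>1] q by simp
    then have "q \<in> hom (cat1 K) (src K q) (src K p1)" "q' \<in> hom (cat1 K) (src K q) (src K p1')"
      "src K q \<in> Ob K" using q by simp_all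
    moreover note \<gamma>1'(1) \<gamma>2 W conjunct1[OF iffD1[OF key[OF q \<gamma>1 \<gamma>1' \<gamma>2] conjI[OF eqs]]]
      conjunct2[OF iffD1[OF key[OF q \<gamma>1 \<gamma>1' \<gamma>2] conjI[OF eqs]]]
    ultimately show "rep_equiv K W S T d d'"
      unfolding rep_equiv.simps S T d d' by blast
  qed
qed

section \<open>Representatives up to restriction and isomorphism\<close>

lemma rep_iso_equiv:
  assumes "rep_iso S T d d'" "d \<in> reps K W S T" "d' \<in> reps K W S T" "S \<in> spans K W x y" "T \<in> spans K W x y"
  shows "rep_equiv K W S T d d'"
  using assms covers_id[OF assms(2)] covers_id[OF assms(3)]
    restrict_id[OF assms(2,4,5)] restrict_id[OF assms(3,4,5)] rep_equiv_iff[OF assms(2-5)]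
  by metis

text \<open>This is \<open>square_completion\<close> for \<open>q\<close> and \<open>q'\<close> over
  \<open>fst S \<odot> left_leg d\<close>, which is in \<open>W\<close>. It makes any two
  restrictions of one representative comparable.\<close>

lemma common_cover:
  assumes "S \<in> spans K W x y" "T \<in> spans K W x y" "d \<in> reps K W S T" "covers S d q" "covers S d q'"
  obtains a b \<theta> where "a \<in> Ar1 K" "b \<in> Ar1 K" "tgt K a = src K q" "tgt K b = src K q'"
    "covers S d (q \<odot> a)" "covers S d (q' \<odot> b)" "\<theta> \<in> iso2 K (q \<odot> a) (q' \<odot> b)" "src K b = src K a"
proof -
  note [simp] = legs_reps(1-5)[OF assms(3)] spans_fst(2)[OF assms(1)]
  have q: "q \<in> Ar1 K" "tgt K q = apex d" "q' \<in> Ar1 K" "tgt K q' = apex d"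
    "fst S \<odot> left_leg d \<odot> q \<in> W" "fst S \<odot> left_leg d \<odot> q' \<in> W"
    using assms(4,5) by (simp_all add: covers_def)
  show thesis
  proof (rule square_completion[of "fst S \<odot> left_leg d" q q'])
    fix r r' \<delta>
    assume "r \<in> Ar1 K" "r' \<in> Ar1 K" "src K r = src K r'" "tgt K r = src K q" "tgt K r' = src K q'"
      "\<delta> \<in> iso2 K (q \<odot> r) (q' \<odot> r')" "(fst S \<odot> left_leg d) \<odot> q \<odot> r \<in> W"
      "(fst S \<odot> left_leg d) \<odot> q' \<odot> r' \<in> W"
    then show thesis using q by (intro that[of r r' \<delta>]) (simp_all add: covers_def)
  qed (use q legs_reps(6)[OF assms(3)] in simp_all)
qed

lemma covers_restrict:
  assumes "S \<in> spans K W x y" "d \<in> reps K W S T" "covers S d q"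
    "a \<in> Ar1 K" "tgt K a = src K q"
  shows "covers S (restrict d q) a \<longleftrightarrow> covers S d (q \<odot> a)"
proof -
  note [simp] = legs_reps(1-5)[OF assms(2)] spans_fst(2)[OF assms(1)]
  show ?thesis using assms(3-) by (simp add: covers_def)
qed

lemma coversD: "covers S d q \<Longrightarrow> q \<in> Ar1 K" "covers S d q \<Longrightarrow> tgt K q = apex d"
  by (simp_all add: covers_def)

text \<open>An isomorphism between restrictions can be restricted further. The covering condition is
  needed on one side only, since isomorphic representatives have the same covers.\<close>

lemma rep_iso_restrict:
  assumes "rep_iso S T (restrict d q) (restrict d' q')" "S \<in> spans K W x y" "T \<in> spans K W x y"
    "d \<in> reps K W S T" "d' \<in> reps K W S T" "covers S d q" "covers S d' q'" "covers S d (q \<odot> a)"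
    "a \<in> Ar1 K" "tgt K a = src K q"
  shows "rep_iso S T (restrict d (q \<odot> a)) (restrict d' (q' \<odot> a))" "covers S d' (q' \<odot> a)"
    "src K q' = src K q"
proof -
  note q = coversD[OF assms(6)] coversD[OF assms(7)]
  note [simp] = legs_reps(1-5)[OF assms(4)] legs_reps(1-5)[OF assms(5)]
  note R = restrict_reps[OF assms(2-4,6)] restrict_reps[OF assms(2,3,5,7)]
  have "apex (restrict d' q') = apex (restrict d q)"
    by (rule rep_iso_covers(1)[OF assms(1) R assms(2,3)])
  then show src: "src K q' = src K q" using q by simp
  have cov: "covers S (restrict d q) a"
    using covers_restrict[OF assms(2,4,6,9,10)] assms(8) by simp
  then have "covers S (restrict d' q') a"
    using rep_iso_covers(2)[OF assms(1) R assms(2,3)] by simp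
  then show "covers S d' (q' \<odot> a)"
    using covers_restrict[OF assms(2,5,7,9)] assms(10) src by simp
  obtain \<gamma>1 \<gamma>2 where "rep_iso_by S T \<gamma>1 \<gamma>2 (restrict d q) (restrict d' q')"
    using assms(1) by (auto simp: rep_iso_def)
  from rep_iso_by_restrict[OF this R assms(2,3) coversD[OF cov]]
  have "rep_iso S T (restrict (restrict d q) a) (restrict (restrict d' q') a)"
    by (auto simp: rep_iso_def)
  then show "rep_iso S T (restrict d (q \<odot> a)) (restrict d' (q' \<odot> a))"
    using q assms(9,10) src restrict_restrict[OF assms(4,2,3), of q a] restrict_restrict[OF assms(5,2,3), of q' a]
    by simp
qed

lemma equiv_rep_rel:
  assumes S: "S \<in> spans K W x y" and T: "T \<in> spans K W x y"
  shows "equiv (reps K W S T) (rep_rel K W S T)"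
proof (rule equivI)
  show "rep_rel K W S T \<subseteq> reps K W S T \<times> reps K W S T" by (auto simp: rep_rel_def)
  show "refl_on (reps K W S T) (rep_rel K W S T)"
  proof (rule refl_onI)
    fix d assume d: "d \<in> reps K W S T"
    then have "rep_iso S T d d" unfolding rep_iso_def using rep_iso_refl[OF d S T] by blast
    then have "rep_equiv K W S T d d" by (rule rep_iso_equiv[OF _ d d S T])
    then show "(d, d) \<in> rep_rel K W S T" using d by (simp add: rep_rel_def)
  qed
  show "sym (rep_rel K W S T)"
  proof (rule symI)
    fix d d' assume "(d, d') \<in> rep_rel K W S T"
    then have d: "d \<in> reps K W S T" "d' \<in> reps K W S T" and "rep_equiv K W S T d d'"
      by (auto simp: rep_rel_def)
    then obtain q q' where q: "covers S d q" "covers S d' q'" and "rep_iso S T (restrict d q) (restrict d' q')"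
      using rep_equiv_iff[OF d S T] by blast
    with rep_iso_sym[OF _ restrict_reps[OF S T d(1) q(1)] restrict_reps[OF S T d(2) q(2)] S T]
    have "rep_equiv K W S T d' d" using rep_equiv_iff[OF d(2,1) S T] by blast
    then show "(d', d) \<in> rep_rel K W S T" using d by (simp add: rep_rel_def)
  qed
  show "trans (rep_rel K W S T)"
  proof (rule transI)
    fix d d' d'' assume "(d, d') \<in> rep_rel K W S T" "(d', d'') \<in> rep_rel K W S T"
    then have d: "d \<in> reps K W S T" "d' \<in> reps K W S T" "d'' \<in> reps K W S T"
      and "rep_equiv K W S T d d'" "rep_equiv K W S T d' d''"
      by (auto simp: rep_rel_def)
    then obtain q q' r r' where q: "covers S d q" "covers S d' q'" and iq: "rep_iso S T (restrict d q) (restrict d' q')"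
      and r: "covers S d' r" "covers S d'' r'" and ir: "rep_iso S T (restrict d' r) (restrict d'' r')"
      using rep_equiv_iff[OF _ _ S T] by metis
    \<comment> \<open>The two hypotheses restrict the middle representative along different covers
      \<open>q'\<close> and \<open>r\<close>. Over a common cover its two restrictions are
      isomorphic by \<open>rep_iso_along\<close>, which joins the given isomorphisms into
      one.\<close>
    obtain a b \<theta> where ab: "a \<in> Ar1 K" "b \<in> Ar1 K" "tgt K a = src K q'" "tgt K b = src K r"
      "covers S d' (q' \<odot> a)" "covers S d' (r \<odot> b)" "\<theta> \<in> iso2 K (q' \<odot> a) (r \<odot> b)"
      using common_cover[OF S T d(2) q(2) r(1)] by metis
    have iq': "rep_iso S T (restrict d' q') (restrict d q)"
      by (rule rep_iso_sym[OF iq restrict_reps[OF S T d(1) q(1)] restrict_reps[OF S T d(2) q(2)] S T])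
    note Q = rep_iso_restrict[OF iq' S T d(2,1) q(2,1) ab(5,1,3)]
    note R = rep_iso_restrict[OF ir S T d(2,3) r ab(6,2,4)]
    have rd: "restrict d (q \<odot> a) \<in> reps K W S T" "restrict d' (q' \<odot> a) \<in> reps K W S T"
      "restrict d' (r \<odot> b) \<in> reps K W S T" "restrict d'' (r' \<odot> b) \<in> reps K W S T"
      using restrict_reps[OF S T] d ab(5,6) Q(2) R(2) by blast+
    have "rep_iso S T (restrict d' (q' \<odot> a)) (restrict d' (r \<odot> b))"
      using rep_iso_along[OF d(2) S T ab(7)] coversD[OF ab(5)] by (auto simp: rep_iso_def)
    with rep_iso_sym[OF Q(1) rd(2,1) S T] R(1)
    have "rep_iso S T (restrict d (q \<odot> a)) (restrict d'' (r' \<odot> b))"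
      using rep_iso_trans S T rd by blast
    then have "rep_equiv K W S T d d''" using rep_equiv_iff[OF d(1,3) S T] Q(2) R(2) by blast
    then show "(d, d'') \<in> rep_rel K W S T" using d by (simp add: rep_rel_def)
  qed
qed


section \<open>Vertical composition\<close>

text \<open>The choice made in a vertical composition, put symmetrically. Both covering conditions
  are recorded because both restrictions have to be representatives; \<open>composableI\<close>
  derives the second from the first.\<close>

definition composable :: "'a span \<Rightarrow> 'a span \<Rightarrow> ('a, 'c) rep \<Rightarrow> ('a, 'c) rep \<Rightarrow> 'a \<Rightarrow> 'a \<Rightarrow> 'c \<Rightarrow> bool" where
  "composable S1 S2 d d' r r' \<delta> \<longleftrightarrow> covers S1 d r \<and> covers S2 d' r' \<and>
    \<delta> \<in> iso2 K (right_leg d \<odot> r) (left_leg d' \<odot> r')"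

lemma paste_reps:
  assumes "S1 \<in> spans K W x y" "S2 \<in> spans K W x y" "S3 \<in> spans K W x y"
    "d \<in> reps K W S1 S2" "d' \<in> reps K W S2 S3" "\<delta> \<in> iso2 K (right_leg d) (left_leg d')"
  shows "paste S2 \<delta> d d' \<in> reps K W S1 S3"
proof -
  obtain w1 f1 where S1: "S1 = (w1, f1)" by fastforce
  obtain w2 f2 where S2: "S2 = (w2, f2)" by fastforce
  obtain w3 f3 where S3: "S3 = (w3, f3)" by fastforce
  obtain p1 p2 \<alpha> \<beta> where d: "d = (p1, p2, \<alpha>, \<beta>)" by (rule prod_cases4)
  obtain p1' p2' \<alpha>' \<beta>' where d': "d' = (p1', p2', \<alpha>', \<beta>')" by (rule prod_cases4)
  note D = repsD[OF assms(4)[unfolded S1 S2 d]] and D' = repsD[OF assms(5)[unfolded S2 S3 d']]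
  note [simp] = spansD(2-)[OF assms(1)[unfolded S1]] spansD(2-)[OF assms(2)[unfolded S2]]
    spansD(2-)[OF assms(3)[unfolded S3]] D(1-11) D'(1-11)
  have \<delta>: "\<delta> \<in> iso2 K p2 p1'" using assms(6) by (simp add: d d')
  note [simp] = iso2D[OF \<delta>]
  have "id2 K w2 \<star> \<delta> \<in> iso2 K (w2 \<odot> p2) (w2 \<odot> p1')"
    by (rule iso2_lwhisker[OF \<delta>]) simp_all
  then have "\<alpha>' \<cdot> (id2 K w2 \<star> \<delta>) \<cdot> \<alpha> \<in> iso2 K (w1 \<odot> p1) (w3 \<odot> p2')"
    using iso2_vcomp[OF iso2_vcomp[OF D(14)] D'(14)] by blast
  moreover have "src K p2' = src K p1" using iso2D(6)[OF \<delta>] by simp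
  ultimately show ?thesis using D(12) D'(13) by (simp add: S1 S2 S3 d d' reps_iff)
qed

lemma restrict_paste:
  assumes "S1 \<in> spans K W x y" "S2 \<in> spans K W x y" "S3 \<in> spans K W x y"
    "d \<in> reps K W S1 S2" "d' \<in> reps K W S2 S3" "\<delta> \<in> iso2 K (right_leg d) (left_leg d')"
    "q \<in> Ar1 K" "tgt K q = apex d"
  shows "restrict (paste S2 \<delta> d d') q = paste S2 (\<delta> \<star> id2 K q) (restrict d q) (restrict d' q)"
proof -
  obtain w1 f1 where S1: "S1 = (w1, f1)" by fastforce
  obtain w2 f2 where S2: "S2 = (w2, f2)" by fastforce
  obtain w3 f3 where S3: "S3 = (w3, f3)" by fastforce
  obtain p1 p2 \<alpha> \<beta> where d: "d = (p1, p2, \<alpha>, \<beta>)" by (rule prod_cases4)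
  obtain p1' p2' \<alpha>' \<beta>' where d': "d' = (p1', p2', \<alpha>', \<beta>')" by (rule prod_cases4)
  note [simp] = spansD(2-)[OF assms(1)[unfolded S1]] spansD(2-)[OF assms(2)[unfolded S2]]
    spansD(2-)[OF assms(3)[unfolded S3]]
    repsD(1-11)[OF assms(4)[unfolded S1 S2 d]] repsD(1-11)[OF assms(5)[unfolded S2 S3 d']]
  have \<delta>: "\<delta> \<in> iso2 K p2 p1'" using assms(6) by (simp add: d d')
  note [simp] = iso2D[OF \<delta>]
  have [simp]: "q \<in> Ar1 K" "tgt K q = src K p1" using assms(7,8) by (simp_all add: d)
  have [simp]: "src K p1' = src K p1" using iso2D(6)[OF \<delta>] by simp
  show ?thesis by (simp add: S2 d d')
qed

text \<open>Three squares are glued: the one of the first factor, the one comparing \<delta> with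
  \<epsilon> whiskered by the middle leg \<open>u2\<close>, and the one of the second
  factor.\<close>

lemma square_paste:
  assumes "\<gamma>1 \<in> iso2 K p1 s1" "\<gamma>2 \<in> iso2 K p2 s2" "\<gamma>1' \<in> iso2 K p1' s1'" "\<gamma>2' \<in> iso2 K p2' s2'"
    "\<delta> \<in> iso2 K p2 p1'" "\<epsilon> \<in> iso2 K s2 s1'"
    "\<alpha> \<in> Ar2 K" "src2 K \<alpha> = u1 \<odot> p1" "tgt2 K \<alpha> = u2 \<odot> p2"
    "\<alpha>' \<in> Ar2 K" "src2 K \<alpha>' = u2 \<odot> p1'" "tgt2 K \<alpha>' = u3 \<odot> p2'"
    "\<sigma> \<in> Ar2 K" "src2 K \<sigma> = u1 \<odot> s1" "tgt2 K \<sigma> = u2 \<odot> s2"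
    "\<sigma>' \<in> Ar2 K" "src2 K \<sigma>' = u2 \<odot> s1'" "tgt2 K \<sigma>' = u3 \<odot> s2'"
    "u1 \<in> Ar1 K" "u2 \<in> Ar1 K" "u3 \<in> Ar1 K"
    "tgt K p1 = src K u1" "tgt K p2 = src K u2" "tgt K p2' = src K u3"
    and eqs: "(id2 K u2 \<star> \<gamma>2) \<cdot> \<alpha> = \<sigma> \<cdot> (id2 K u1 \<star> \<gamma>1)"
    "(id2 K u3 \<star> \<gamma>2') \<cdot> \<alpha>' = \<sigma>' \<cdot> (id2 K u2 \<star> \<gamma>1')" "\<gamma>1' \<cdot> \<delta> = \<epsilon> \<cdot> \<gamma>2"
  shows "(id2 K u3 \<star> \<gamma>2') \<cdot> (\<alpha>' \<cdot> (id2 K u2 \<star> \<delta>) \<cdot> \<alpha>)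
    = (\<sigma>' \<cdot> (id2 K u2 \<star> \<epsilon>) \<cdot> \<sigma>) \<cdot> (id2 K u1 \<star> \<gamma>1)"
proof -
  note [simp] = assms(7-24) iso2D(1-5)[OF assms(1)] iso2D(1-5)[OF assms(2)] iso2D(1-5)[OF assms(3)]
    iso2D(1-5)[OF assms(4)] iso2D(1-5)[OF assms(5)] iso2D(1-5)[OF assms(6)]
  have [simp]: "tgt K p1' = src K u2" "tgt K s2 = src K u2" "tgt K s1' = src K u2" "tgt K s2' = src K u3"
    "tgt K s1 = src K u1"
    using iso2D(7)[OF assms(5)] iso2D(7)[OF assms(2)] iso2D(7)[OF assms(3)] iso2D(7)[OF assms(4)]
      iso2D(7)[OF assms(1)] by simp_all
  have "(id2 K u3 \<star> \<gamma>2') \<cdot> (\<alpha>' \<cdot> (id2 K u2 \<star> \<delta>) \<cdot> \<alpha>)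
      = ((id2 K u3 \<star> \<gamma>2') \<cdot> \<alpha>') \<cdot> (id2 K u2 \<star> \<delta>) \<cdot> \<alpha>" by simp
  also have "\<dots> = \<sigma>' \<cdot> (id2 K u2 \<star> (\<gamma>1' \<cdot> \<delta>)) \<cdot> \<alpha>"
    unfolding eqs(2) by simp
  also have "\<dots> = \<sigma>' \<cdot> (id2 K u2 \<star> \<epsilon>) \<cdot> (id2 K u2 \<star> \<gamma>2) \<cdot> \<alpha>"
    unfolding eqs(3) by simp
  also have "\<dots> = (\<sigma>' \<cdot> (id2 K u2 \<star> \<epsilon>) \<cdot> \<sigma>) \<cdot> (id2 K u1 \<star> \<gamma>1)"
    unfolding eqs(1) by simp
  finally show ?thesis .
qed

text \<open>The outer components \<gamma>1 and \<gamma>2' form the new isomorphism. The inner ones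
  cancel against \<delta> and \<epsilon>, which is the purpose of the last hypothesis.\<close>

lemma paste_iso:
  assumes "S1 \<in> spans K W x y" "S2 \<in> spans K W x y" "S3 \<in> spans K W x y"
    "d \<in> reps K W S1 S2" "d' \<in> reps K W S2 S3" "e \<in> reps K W S1 S2" "e' \<in> reps K W S2 S3"
    "\<delta> \<in> iso2 K (right_leg d) (left_leg d')" "\<epsilon> \<in> iso2 K (right_leg e) (left_leg e')"
    "rep_iso_by S1 S2 \<gamma>1 \<gamma>2 d e" "rep_iso_by S2 S3 \<gamma>1' \<gamma>2' d' e'" "\<gamma>1' \<cdot> \<delta> = \<epsilon> \<cdot> \<gamma>2"
  shows "rep_iso_by S1 S3 \<gamma>1 \<gamma>2' (paste S2 \<delta> d d') (paste S2 \<epsilon> e e')"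
proof -
  obtain w1 f1 where S1: "S1 = (w1, f1)" by fastforce
  obtain w2 f2 where S2: "S2 = (w2, f2)" by fastforce
  obtain w3 f3 where S3: "S3 = (w3, f3)" by fastforce
  obtain p1 p2 \<alpha> \<beta> where d: "d = (p1, p2, \<alpha>, \<beta>)" by (rule prod_cases4)
  obtain p1' p2' \<alpha>' \<beta>' where d': "d' = (p1', p2', \<alpha>', \<beta>')" by (rule prod_cases4)
  obtain s1 s2 \<sigma> \<tau> where e: "e = (s1, s2, \<sigma>, \<tau>)" by (rule prod_cases4)
  obtain s1' s2' \<sigma>' \<tau>' where e': "e' = (s1', s2', \<sigma>', \<tau>')" by (rule prod_cases4)
  note [simp] = spansD(2-)[OF assms(1)[unfolded S1]] spansD(2-)[OF assms(2)[unfolded S2]]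
    spansD(2-)[OF assms(3)[unfolded S3]]
    repsD(1-11)[OF assms(4)[unfolded S1 S2 d]] repsD(1-11)[OF assms(5)[unfolded S2 S3 d']]
    repsD(1-11)[OF assms(6)[unfolded S1 S2 e]] repsD(1-11)[OF assms(7)[unfolded S2 S3 e']]
  have \<delta>: "\<delta> \<in> iso2 K p2 p1'" and \<epsilon>: "\<epsilon> \<in> iso2 K s2 s1'"
    using assms(8,9) by (simp_all add: d d' e e')
  have \<gamma>: "\<gamma>1 \<in> iso2 K p1 s1" "\<gamma>2 \<in> iso2 K p2 s2" "\<gamma>1' \<in> iso2 K p1' s1'" "\<gamma>2' \<in> iso2 K p2' s2'"
    and w: "(id2 K w2 \<star> \<gamma>2) \<cdot> \<alpha> = \<sigma> \<cdot> (id2 K w1 \<star> \<gamma>1)"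
    "(id2 K w3 \<star> \<gamma>2') \<cdot> \<alpha>' = \<sigma>' \<cdot> (id2 K w2 \<star> \<gamma>1')"
    and f: "(id2 K f2 \<star> \<gamma>2) \<cdot> \<beta> = \<tau> \<cdot> (id2 K f1 \<star> \<gamma>1)"
    "(id2 K f3 \<star> \<gamma>2') \<cdot> \<beta>' = \<tau>' \<cdot> (id2 K f2 \<star> \<gamma>1')"
    using assms(10,11) by (simp_all add: S1 S2 S3 d d' e e')
  show ?thesis
    unfolding S1 S2 S3 d d' e e' paste.simps rep_iso_by.simps
  proof (intro conjI)
    show "(id2 K w3 \<star> \<gamma>2') \<cdot> (\<alpha>' \<cdot> (id2 K w2 \<star> \<delta>) \<cdot> \<alpha>)
      = (\<sigma>' \<cdot> (id2 K w2 \<star> \<epsilon>) \<cdot> \<sigma>) \<cdot> (id2 K w1 \<star> \<gamma>1)"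
      by (rule square_paste[OF \<gamma> \<delta> \<epsilon> _ _ _ _ _ _ _ _ _ _ _ _ _ _ _ _ _ _ w assms(12)]) simp_all
    show "(id2 K f3 \<star> \<gamma>2') \<cdot> (\<beta>' \<cdot> (id2 K f2 \<star> \<delta>) \<cdot> \<beta>)
      = (\<tau>' \<cdot> (id2 K f2 \<star> \<epsilon>) \<cdot> \<tau>) \<cdot> (id2 K f1 \<star> \<gamma>1)"
      by (rule square_paste[OF \<gamma> \<delta> \<epsilon> _ _ _ _ _ _ _ _ _ _ _ _ _ _ _ _ _ _ f assms(12)]) simp_all
  qed (use \<gamma> in simp_all)
qed

text \<open>Membership in \<open>W\<close> travels from the left leg of \<open>d\<close> to its
  right leg through the invertible 2-arrow of \<open>d\<close>, and from there to the left leg of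
  \<open>d'\<close> through \<delta>.\<close>

lemma composableI:
  assumes "S1 \<in> spans K W x y" "S2 \<in> spans K W x y"
    "d \<in> reps K W S1 S2" "d' \<in> reps K W S2 S3" "covers S1 d r"
    "r' \<in> Ar1 K" "tgt K r' = apex d'" "\<delta> \<in> iso2 K (right_leg d \<odot> r) (left_leg d' \<odot> r')"
  shows "composable S1 S2 d d' r r' \<delta>"
proof -
  note [simp] = legs_reps(1-5)[OF assms(3)] legs_reps(1-5)[OF assms(4)] spans_fst(2)[OF assms(2)]
    coversD[OF assms(5)] assms(6,7)
  have "fst S2 \<odot> right_leg d \<odot> r \<in> W"
    using legs_reps(7)[OF restrict_reps[OF assms(1,2,3,5)]] by simp
  moreover have "id2 K (fst S2) \<star> \<delta> \<in> iso2 K (fst S2 \<odot> right_leg d \<odot> r) (fst S2 \<odot> left_leg d' \<odot> r')"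
    by (rule iso2_lwhisker[OF assms(8)]) simp_all
  ultimately show ?thesis
    using assms W_iso2 by (auto simp: composable_def covers_def)
qed

lemma composableD:
  assumes "composable S1 S2 d d' r r' \<delta>"
  shows "covers S1 d r" "covers S2 d' r'" "\<delta> \<in> iso2 K (right_leg d \<odot> r) (left_leg d' \<odot> r')"
    "\<delta> \<in> iso2 K (right_leg (restrict d r)) (left_leg (restrict d' r'))"
  using assms by (simp_all add: composable_def)

lemma composable_src:
  assumes "composable S1 S2 d d' r r' \<delta>" "d \<in> reps K W S1 S2" "d' \<in> reps K W S2 S3"
  shows "src K r' = src K r"
  using iso2D(6)[OF composableD(3)[OF assms(1)]] legs_reps(1-3)[OF assms(2)] legs_reps(1-3)[OF assms(3)]
    coversD[OF composableD(1)[OF assms(1)]] coversD[OF composableD(2)[OF assms(1)]] by simp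

lemma rep_comp_iff:
  assumes "S1 \<in> spans K W x y" "S2 \<in> spans K W x y" "S3 \<in> spans K W x y"
    "d \<in> reps K W S1 S2" "d' \<in> reps K W S2 S3"
  shows "rep_comp K W S1 S2 S3 d d' e \<longleftrightarrow>
    (\<exists>r r' \<delta>. composable S1 S2 d d' r r' \<delta> \<and> e = paste S2 \<delta> (restrict d r) (restrict d' r'))"
proof -
  obtain w1 f1 where S1: "S1 = (w1, f1)" by fastforce
  obtain w2 f2 where S2: "S2 = (w2, f2)" by fastforce
  obtain w3 f3 where S3: "S3 = (w3, f3)" by fastforce
  obtain p1 p2 \<alpha> \<beta> where d: "d = (p1, p2, \<alpha>, \<beta>)" by (rule prod_cases4)
  obtain p1' p2' \<alpha>' \<beta>' where d': "d' = (p1', p2', \<alpha>', \<beta>')" by (rule prod_cases4)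
  show ?thesis
  proof
    assume "rep_comp K W S1 S2 S3 d d' e"
    then obtain t r r' \<delta> where r: "r \<in> hom (cat1 K) t (src K p1)" "r' \<in> hom (cat1 K) t (src K p1')"
      "\<delta> \<in> iso2 K (p2 \<odot> r) (p1' \<odot> r')" "w1 \<odot> p1 \<odot> r \<in> W"
      and e: "e = (p1 \<odot> r, p2' \<odot> r', (\<alpha>' \<star> id2 K r') \<cdot> (id2 K w2 \<star> \<delta>) \<cdot> (\<alpha> \<star> id2 K r),
        (\<beta>' \<star> id2 K r') \<cdot> (id2 K f2 \<star> \<delta>) \<cdot> (\<beta> \<star> id2 K r))"
      unfolding rep_comp.simps S1 S2 S3 d d' by blast
    have "composable S1 S2 d d' r r' \<delta>"
      by (rule composableI[OF assms(1,2,4,5)]) (use r in \<open>simp_all add: covers_def S1 d d'\<close>)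
    then show "\<exists>r r' \<delta>. composable S1 S2 d d' r r' \<delta> \<and> e = paste S2 \<delta> (restrict d r) (restrict d' r')"
      using e by (intro exI conjI) (simp_all add: S2 d d')
  next
    assume "\<exists>r r' \<delta>. composable S1 S2 d d' r r' \<delta> \<and> e = paste S2 \<delta> (restrict d r) (restrict d' r')"
    then obtain r r' \<delta> where c: "composable S1 S2 d d' r r' \<delta>"
      and e: "e = paste S2 \<delta> (restrict d r) (restrict d' r')" by blast
    have r: "r \<in> Ar1 K" "tgt K r = src K p1" "w1 \<odot> p1 \<odot> r \<in> W" "r' \<in> Ar1 K" "tgt K r' = src K p1'"
      "\<delta> \<in> iso2 K (p2 \<odot> r) (p1' \<odot> r')"
      using c by (simp_all add: composable_def covers_def S1 S2 d d')
    have "r \<in> hom (cat1 K) (src K r) (src K p1)" "r' \<in> hom (cat1 K) (src K r) (src K p1')" "src K r \<in> Ob K"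
      using r composable_src[OF c assms(4,5)] by simp_all
    then show "rep_comp K W S1 S2 S3 d d' e"
      unfolding rep_comp.simps S1 S2 S3 d d' e restrict.simps paste.simps using r by blast
  qed
qed

lemma rep_comp_reps:
  assumes "S1 \<in> spans K W x y" "S2 \<in> spans K W x y" "S3 \<in> spans K W x y"
    "d \<in> reps K W S1 S2" "d' \<in> reps K W S2 S3" "rep_comp K W S1 S2 S3 d d' e"
  shows "e \<in> reps K W S1 S3"
proof -
  obtain r r' \<delta> where c: "composable S1 S2 d d' r r' \<delta>"
    and e: "e = paste S2 \<delta> (restrict d r) (restrict d' r')"
    using assms(6) unfolding rep_comp_iff[OF assms(1-5)] by blast
  show ?thesis unfolding e
    by (rule paste_reps[OF assms(1-3) restrict_reps[OF assms(1,2,4) composableD(1)[OF c]]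
          restrict_reps[OF assms(2,3,5) composableD(2)[OF c]] composableD(4)[OF c]])
qed

lemma rep_comp_exists:
  assumes "S1 \<in> spans K W x y" "S2 \<in> spans K W x y" "S3 \<in> spans K W x y"
    "d \<in> reps K W S1 S2" "d' \<in> reps K W S2 S3"
  obtains e where "rep_comp K W S1 S2 S3 d d' e"
proof -
  note [simp] = legs_reps(1-5)[OF assms(4)] legs_reps(1-5)[OF assms(5)] spans_fst(2)[OF assms(1)]
    spans_fst(2)[OF assms(2)]
  \<comment> \<open>Both middle legs become elements of \<open>W\<close> after composition with the
    left leg of \<open>S2\<close>, so \<open>square_completion\<close> applies to them.\<close>
  obtain r r' \<delta> where r: "r \<in> Ar1 K" "r' \<in> Ar1 K" "src K r = src K r'" "tgt K r = src K (right_leg d)"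
    "tgt K r' = apex d'" "\<delta> \<in> iso2 K (right_leg d \<odot> r) (left_leg d' \<odot> r')"
    "fst S2 \<odot> right_leg d \<odot> r \<in> W"
    by (rule square_completion[OF spans_fst(1)[OF assms(2)] legs_reps(7)[OF assms(4)] legs_reps(6)[OF assms(5)]])
      simp_all
  obtain w1 f1 where S1: "S1 = (w1, f1)" by fastforce
  obtain w2 f2 where S2: "S2 = (w2, f2)" by fastforce
  obtain p1 p2 \<alpha> \<beta> where d: "d = (p1, p2, \<alpha>, \<beta>)" by (rule prod_cases4)
  \<comment> \<open>The completed square controls the right leg of \<open>d\<close>, whereas
    \<open>covers\<close> concerns the left leg; the invertible \<alpha> carries membership in
    \<open>W\<close> over.\<close>
  have "\<alpha> \<star> id2 K r \<in> iso2 K ((w1 \<odot> p1) \<odot> r) ((w2 \<odot> p2) \<odot> r)"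
    by (rule iso2_rwhisker[OF repsD(14)[OF assms(4)[unfolded S1 S2 d]]])
      (use r legs_reps(1-5)[OF assms(4)] spans_fst(2)[OF assms(1)] in \<open>simp_all add: d S1\<close>)
  then have "fst S1 \<odot> left_leg d \<odot> r \<in> W"
    using W_iso2 r(1,4,7) legs_reps(1-5)[OF assms(4)] spans_fst(2)[OF assms(1)] spans_fst(2)[OF assms(2)]
    by (simp add: S1 S2 d)
  then have "composable S1 S2 d d' r r' \<delta>"
    using r by (intro composableI[OF assms(1,2,4,5)]) (simp_all add: covers_def)
  then show thesis using that rep_comp_iff[OF assms] by blast
qed

text \<open>
  For two choices, a common cover of \<open>r\<close> and \<open>s\<close> makes \<open>left_leg d' \<odot> r'\<close> and
  \<open>left_leg d' \<odot> s'\<close> isomorphic. Lifting this isomorphism to one of \<open>r'\<close> and \<open>s'\<close>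
  absorbs the difference between \<open>\<delta>\<close> and \<open>\<epsilon>\<close>.
\<close>

lemma rep_comp_unique:
  assumes "S1 \<in> spans K W x y" "S2 \<in> spans K W x y" "S3 \<in> spans K W x y"
    "d \<in> reps K W S1 S2" "d' \<in> reps K W S2 S3"
    "rep_comp K W S1 S2 S3 d d' e" "rep_comp K W S1 S2 S3 d d' e'"
  shows "rep_equiv K W S1 S3 e e'"
proof -
  note S = assms(1-3) and d = assms(4,5)
  obtain r r' \<delta> where r: "composable S1 S2 d d' r r' \<delta>"
    and e: "e = paste S2 \<delta> (restrict d r) (restrict d' r')"
    using assms(6) unfolding rep_comp_iff[OF S d] by blast
  obtain s s' \<epsilon> where s: "composable S1 S2 d d' s s' \<epsilon>"
    and e': "e' = paste S2 \<epsilon> (restrict d s) (restrict d' s')"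
    using assms(7) unfolding rep_comp_iff[OF S d] by blast
  note R = composableD[OF r] composable_src[OF r d] and Q = composableD[OF s] composable_src[OF s d]
  obtain a b \<theta> where ab: "a \<in> Ar1 K" "b \<in> Ar1 K" "tgt K a = src K r" "tgt K b = src K s"
    "covers S1 d (r \<odot> a)" "covers S1 d (s \<odot> b)" "\<theta> \<in> iso2 K (r \<odot> a) (s \<odot> b)" "src K b = src K a"
    by (rule common_cover[OF S(1,2) d(1) R(1) Q(1)])
  define p p' where "p = right_leg d" and "p' = left_leg d'"
  note [simp] = ab(1-4,8) coversD[OF R(1)] coversD[OF Q(1)] coversD[OF R(2)] coversD[OF Q(2)]
    legs_reps(1-5)[OF d(1)] legs_reps(1-5)[OF d(2)] R(5) Q(5) spans_fst(2)[OF S(2)]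
    legs_reps(1-5)[OF d(1), folded p_def] legs_reps(1-5)[OF d(2), folded p'_def]
  have [simp]: "src K p' = apex d'" by (simp add: p'_def)
  have \<delta>: "\<delta> \<in> iso2 K (p \<odot> r) (p' \<odot> r')" using R(3) by (simp add: p_def p'_def)
  have \<epsilon>: "\<epsilon> \<in> iso2 K (p \<odot> s) (p' \<odot> s')" using Q(3) by (simp add: p_def p'_def)
  have \<delta>a: "\<delta> \<star> id2 K a \<in> iso2 K (p \<odot> r \<odot> a) (p' \<odot> r' \<odot> a)"
    using iso2_rwhisker[OF \<delta>, of a] by (simp add: p'_def)
  have \<epsilon>b: "\<epsilon> \<star> id2 K b \<in> iso2 K (p \<odot> s \<odot> b) (p' \<odot> s' \<odot> b)"
    using iso2_rwhisker[OF \<epsilon>, of b] by (simp add: p'_def)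
  have p\<theta>: "id2 K p \<star> \<theta> \<in> iso2 K (p \<odot> r \<odot> a) (p \<odot> s \<odot> b)"
    by (rule iso2_lwhisker[OF ab(7)]) simp_all
  obtain \<delta>' where \<delta>': "\<delta>' \<in> iso2 K (p' \<odot> r' \<odot> a) (p \<odot> r \<odot> a)"
    "\<delta>' \<cdot> (\<delta> \<star> id2 K a) = id2 K (p \<odot> r \<odot> a)"
    using \<delta>a by (auto elim: iso2E)
  \<comment> \<open>The way round through the first factor: back along \<delta>, across the common
    cover by \<theta>, and forward along \<epsilon>. Hence \<zeta> is an isomorphism of the
    composites of \<open>p'\<close> with \<open>r' \<odot> a\<close> and
    \<open>s' \<odot> b\<close>.\<close>
  define \<zeta> where "\<zeta> = (\<epsilon> \<star> id2 K b) \<cdot> (id2 K p \<star> \<theta>) \<cdot> \<delta>'"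
  have \<zeta>: "\<zeta> \<in> iso2 K (p' \<odot> r' \<odot> a) (p' \<odot> s' \<odot> b)"
    unfolding \<zeta>_def using iso2_vcomp[OF iso2_vcomp[OF \<delta>'(1) p\<theta>] \<epsilon>b] by blast
  note [simp] = iso2D(1-5)[OF \<delta>] iso2D(1-5)[OF \<epsilon>] iso2D(1-5)[OF ab(7)] iso2D(1-5)[OF \<delta>'(1)] iso2D(1-5)[OF \<zeta>]
  have \<zeta>\<delta>: "\<zeta> \<cdot> (\<delta> \<star> id2 K a) = (\<epsilon> \<star> id2 K b) \<cdot> (id2 K p \<star> \<theta>)"
    by (simp add: \<zeta>_def \<delta>'(2) p'_def)
  \<comment> \<open>The leg \<open>p'\<close> is cancelled from \<zeta> at the price of a further
    restriction along \<open>z\<close>; what is known is that \<open>fst S2 \<odot> p'\<close> is in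
    \<open>W\<close>.\<close>
  obtain z \<phi> where z: "z \<in> W" "tgt K z = src K a" and \<phi>: "\<phi> \<in> iso2 K ((r' \<odot> a) \<odot> z) ((s' \<odot> b) \<odot> z)"
    and p\<phi>: "id2 K p' \<star> \<phi> = \<zeta> \<star> id2 K z"
    by (rule iso2_lift_through[OF spans_fst(1)[OF S(2)] legs_reps(6)[OF d(2), folded p'_def] \<zeta>])
      (simp_all add: p'_def)
  have zA [simp]: "z \<in> Ar1 K" using z(1) by (rule W_arr)
  note [simp] = z(2)
  have \<phi>': "\<phi> \<in> iso2 K (r' \<odot> a \<odot> z) (s' \<odot> b \<odot> z)" using \<phi> by simp
  have c1: "covers S1 d (r \<odot> a \<odot> z)" "covers S1 d (s \<odot> b \<odot> z)"
    using covers_W[OF S(1) d(1) ab(5) z(1)] covers_W[OF S(1) d(1) ab(6) z(1)] by simp_all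
  have \<theta>z: "\<theta> \<star> id2 K z \<in> iso2 K (r \<odot> a \<odot> z) (s \<odot> b \<odot> z)"
    using iso2_rwhisker[OF ab(7), of z] by simp
  have er: "e \<in> reps K W S1 S3" "e' \<in> reps K W S1 S3"
    using rep_comp_reps[OF S d] assms(6,7) by blast+
  have ce: "covers S1 e (a \<odot> z)" "covers S1 e' (b \<odot> z)"
    using c1 spans_fst(2)[OF S(1)] by (simp_all add: covers_def e e')
  have c2: "covers S2 d' (r' \<odot> a \<odot> z)" "covers S2 d' (s' \<odot> b \<odot> z)"
  proof -
    have "\<delta> \<star> id2 K (a \<odot> z) \<in> iso2 K (right_leg d \<odot> r \<odot> a \<odot> z) (left_leg d' \<odot> r' \<odot> a \<odot> z)"
      using iso2_rwhisker[OF R(3), of "a \<odot> z"] by simp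
    from composableI[OF S(1,2) d c1(1) _ _ this] show "covers S2 d' (r' \<odot> a \<odot> z)"
      by (auto dest: composableD)
    have "\<epsilon> \<star> id2 K (b \<odot> z) \<in> iso2 K (right_leg d \<odot> s \<odot> b \<odot> z) (left_leg d' \<odot> s' \<odot> b \<odot> z)"
      using iso2_rwhisker[OF Q(3), of "b \<odot> z"] by simp
    from composableI[OF S(1,2) d c1(2) _ _ this] show "covers S2 d' (s' \<odot> b \<odot> z)"
      by (auto dest: composableD)
  qed
  note rr = restrict_reps[OF S(1,2) d(1) c1(1)] restrict_reps[OF S(2,3) d(2) c2(1)]
    restrict_reps[OF S(1,2) d(1) c1(2)] restrict_reps[OF S(2,3) d(2) c2(2)]
  have ea: "restrict e (a \<odot> z) = paste S2 (\<delta> \<star> id2 K (a \<odot> z)) (restrict d (r \<odot> a \<odot> z)) (restrict d' (r' \<odot> a \<odot> z))"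
    unfolding e
    using restrict_paste[OF S restrict_reps[OF S(1,2) d(1) R(1)] restrict_reps[OF S(2,3) d(2) R(2)] R(4), of "a \<odot> z"]
      restrict_restrict[OF d(1) S(1,2), of r "a \<odot> z"] restrict_restrict[OF d(2) S(2,3), of r' "a \<odot> z"] by simp
  have eb: "restrict e' (b \<odot> z) = paste S2 (\<epsilon> \<star> id2 K (b \<odot> z)) (restrict d (s \<odot> b \<odot> z)) (restrict d' (s' \<odot> b \<odot> z))"
    unfolding e'
    using restrict_paste[OF S restrict_reps[OF S(1,2) d(1) Q(1)] restrict_reps[OF S(2,3) d(2) Q(2)] Q(4), of "b \<odot> z"]
      restrict_restrict[OF d(1) S(1,2), of s "b \<odot> z"] restrict_restrict[OF d(2) S(2,3), of s' "b \<odot> z"] by simp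
  \<comment> \<open>The compatibility of inner components required by \<open>paste_iso\<close>. It
    is the defining property of \<zeta> whiskered with \<open>z\<close>, with \<zeta> replaced by
    its lifting \<phi>.\<close>
  have match: "(id2 K p' \<star> \<phi>) \<cdot> (\<delta> \<star> id2 K (a \<odot> z)) = (\<epsilon> \<star> id2 K (b \<odot> z)) \<cdot> (id2 K p \<star> \<theta> \<star> id2 K z)"
  proof -
    have "(id2 K p' \<star> \<phi>) \<cdot> (\<delta> \<star> id2 K (a \<odot> z)) = (\<zeta> \<cdot> (\<delta> \<star> id2 K a)) \<star> id2 K z"
      by (simp add: p\<phi>)
    also have "\<dots> = (\<epsilon> \<star> id2 K (b \<odot> z)) \<cdot> (id2 K p \<star> \<theta> \<star> id2 K z)"
      unfolding \<zeta>\<delta> by simp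
    finally show ?thesis .
  qed
  have "rep_iso_by S1 S3 (id2 K (left_leg d) \<star> \<theta> \<star> id2 K z) (id2 K (right_leg d') \<star> \<phi>)
      (restrict e (a \<odot> z)) (restrict e' (b \<odot> z))"
    unfolding ea eb
  proof (rule paste_iso[OF S rr])
    show "\<delta> \<star> id2 K (a \<odot> z) \<in> iso2 K (right_leg (restrict d (r \<odot> a \<odot> z))) (left_leg (restrict d' (r' \<odot> a \<odot> z)))"
      using iso2_rwhisker[OF R(3), of "a \<odot> z"] by simp
    show "\<epsilon> \<star> id2 K (b \<odot> z) \<in> iso2 K (right_leg (restrict d (s \<odot> b \<odot> z))) (left_leg (restrict d' (s' \<odot> b \<odot> z)))"
      using iso2_rwhisker[OF Q(3), of "b \<odot> z"] by simp
    show "rep_iso_by S1 S2 (id2 K (left_leg d) \<star> \<theta> \<star> id2 K z) (id2 K (right_leg d) \<star> \<theta> \<star> id2 K z)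
        (restrict d (r \<odot> a \<odot> z)) (restrict d (s \<odot> b \<odot> z))"
      by (rule rep_iso_along[OF d(1) S(1,2) \<theta>z]) simp
    show "rep_iso_by S2 S3 (id2 K (left_leg d') \<star> \<phi>) (id2 K (right_leg d') \<star> \<phi>)
        (restrict d' (r' \<odot> a \<odot> z)) (restrict d' (s' \<odot> b \<odot> z))"
      by (rule rep_iso_along[OF d(2) S(2,3) \<phi>']) simp
    show "(id2 K (left_leg d') \<star> \<phi>) \<cdot> (\<delta> \<star> id2 K (a \<odot> z))
        = (\<epsilon> \<star> id2 K (b \<odot> z)) \<cdot> (id2 K (right_leg d) \<star> \<theta> \<star> id2 K z)"
      using match by (simp only: p_def p'_def)
  qed
  then show ?thesis
    using rep_equiv_iff[OF er S(1,3)] ce by (auto simp: rep_iso_def)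
qed

section \<open>Independence of composites from the representatives of the factors\<close>

lemma rep_comp_restrict_left:
  assumes "S1 \<in> spans K W x y" "S2 \<in> spans K W x y" "S3 \<in> spans K W x y"
    "d \<in> reps K W S1 S2" "d' \<in> reps K W S2 S3" "covers S1 d q"
    "rep_comp K W S1 S2 S3 (restrict d q) d' e"
  shows "rep_comp K W S1 S2 S3 d d' e"
proof -
  note [simp] = legs_reps(1-5)[OF assms(4)] coversD[OF assms(6)]
  note R = restrict_reps[OF assms(1,2,4,6)]
  obtain r r' \<delta> where c: "composable S1 S2 (restrict d q) d' r r' \<delta>"
    and e: "e = paste S2 \<delta> (restrict (restrict d q) r) (restrict d' r')"
    using assms(7) unfolding rep_comp_iff[OF assms(1-3) R assms(5)] by blast
  note C = composableD[OF c]
  have r [simp]: "r \<in> Ar1 K" "tgt K r = src K q" using coversD[OF C(1)] by simp_all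
  have "composable S1 S2 d d' (q \<odot> r) r' \<delta>"
    unfolding composable_def using C covers_restrict[OF assms(1,4,6) r] by simp
  moreover have "e = paste S2 \<delta> (restrict d (q \<odot> r)) (restrict d' r')"
    using e restrict_restrict[OF assms(4,1,2), of q r] by simp
  ultimately show ?thesis unfolding rep_comp_iff[OF assms(1-5)] by blast
qed

text \<open>A choice \<open>r'\<close> for the restricted factor is the choice
  \<open>q \<odot> r'\<close> for the original one, with the same composite;
  \<open>rep_comp_restrict_left\<close> rests on the same observation. This direction suffices,
  since all composites of the original factors are equivalent by
  \<open>rep_comp_unique\<close>.\<close>

lemma rep_comp_restrict_right:
  assumes "S1 \<in> spans K W x y" "S2 \<in> spans K W x y" "S3 \<in> spans K W x y"
    "d \<in> reps K W S1 S2" "d' \<in> reps K W S2 S3" "covers S2 d' q"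
    "rep_comp K W S1 S2 S3 d (restrict d' q) e"
  shows "rep_comp K W S1 S2 S3 d d' e"
proof -
  note [simp] = legs_reps(1-5)[OF assms(5)] coversD[OF assms(6)]
  note R = restrict_reps[OF assms(2,3,5,6)]
  obtain r r' \<delta> where c: "composable S1 S2 d (restrict d' q) r r' \<delta>"
    and e: "e = paste S2 \<delta> (restrict d r) (restrict (restrict d' q) r')"
    using assms(7) unfolding rep_comp_iff[OF assms(1-4) R] by blast
  note C = composableD[OF c]
  have r [simp]: "r' \<in> Ar1 K" "tgt K r' = src K q" using coversD[OF C(2)] by simp_all
  have "composable S1 S2 d d' r (q \<odot> r') \<delta>"
    unfolding composable_def using C covers_restrict[OF assms(2,5,6) r] by simp
  moreover have "e = paste S2 \<delta> (restrict d r) (restrict d' (q \<odot> r'))"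
    using e restrict_restrict[OF assms(5,2,3), of q r'] by simp
  ultimately show ?thesis unfolding rep_comp_iff[OF assms(1-5)] by blast
qed

lemma rep_iso_byD:
  assumes "rep_iso_by S T \<gamma>1 \<gamma>2 d d'"
  shows "\<gamma>1 \<in> iso2 K (left_leg d) (left_leg d')" "\<gamma>2 \<in> iso2 K (right_leg d) (right_leg d')"
  using assms by (cases S; cases T; cases d; cases d'; simp)+

text \<open>The 1-arrows \<open>r\<close> and \<open>r'\<close> are kept, and \<delta> is corrected
  by the right component of the isomorphism. The corrected \<delta> then satisfies the compatibility
  condition of \<open>paste_iso\<close> with an identity on the second factor.\<close>

lemma rep_comp_iso_left:
  assumes "S1 \<in> spans K W x y" "S2 \<in> spans K W x y" "S3 \<in> spans K W x y"
    "d \<in> reps K W S1 S2" "d' \<in> reps K W S2 S3" "d1 \<in> reps K W S1 S2" "rep_iso S1 S2 d1 d"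
    "rep_comp K W S1 S2 S3 d d' e"
  obtains e1 where "rep_comp K W S1 S2 S3 d1 d' e1" "rep_iso S1 S3 e1 e"
proof -
  note S = assms(1-3)
  obtain r r' \<delta> where c: "composable S1 S2 d d' r r' \<delta>"
    and e: "e = paste S2 \<delta> (restrict d r) (restrict d' r')"
    using assms(8) unfolding rep_comp_iff[OF S assms(4,5)] by blast
  note C = composableD[OF c] and src = composable_src[OF c assms(4,5)]
  obtain \<gamma>1 \<gamma>2 where \<gamma>: "rep_iso_by S1 S2 \<gamma>1 \<gamma>2 d1 d"
    using assms(7) by (auto simp: rep_iso_def)
  note apex = rep_iso_covers[OF assms(7,6,4) S(1,2)]
  have cov: "covers S1 d1 r" using apex(2) C(1) by simp
  note [simp] = coversD[OF cov] coversD[OF C(2)] legs_reps(1-5)[OF assms(4)] legs_reps(1-5)[OF assms(5)]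
    legs_reps(1-5)[OF assms(6)] apex(1) src
  note I = rep_iso_by_restrict[OF \<gamma> assms(6,4) S(1,2) coversD[OF cov]]
  have g: "\<gamma>2 \<star> id2 K r \<in> iso2 K (right_leg d1 \<odot> r) (right_leg d \<odot> r)"
    using rep_iso_byD(2)[OF I] by simp
  define \<delta>1 where "\<delta>1 = \<delta> \<cdot> (\<gamma>2 \<star> id2 K r)"
  have \<delta>1: "\<delta>1 \<in> iso2 K (right_leg d1 \<odot> r) (left_leg d' \<odot> r')"
    unfolding \<delta>1_def by (rule iso2_vcomp[OF g C(3)])
  have c1: "composable S1 S2 d1 d' r r' \<delta>1"
    using cov C(2) \<delta>1 by (simp add: composable_def)
  note R = restrict_reps[OF S(1,2) assms(6) cov] restrict_reps[OF S(2,3) assms(5) C(2)]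
    restrict_reps[OF S(1,2) assms(4) C(1)]
  note [simp] = iso2D(1-3)[OF C(3)] iso2D(1-3)[OF g] iso2D(1-3)[OF \<delta>1]
  have "rep_iso_by S1 S3 (\<gamma>1 \<star> id2 K r) (id2 K (right_leg (restrict d' r')))
      (paste S2 \<delta>1 (restrict d1 r) (restrict d' r')) e"
    unfolding e
  proof (rule paste_iso[OF S R(1,2) R(3,2) composableD(4)[OF c1] C(4) I rep_iso_refl[OF R(2) S(2,3)]])
    have "left_leg (restrict d' r') \<in> Ar1 K" by simp
    then show "id2 K (left_leg (restrict d' r')) \<cdot> \<delta>1 = \<delta> \<cdot> (\<gamma>2 \<star> id2 K r)"
      by (simp add: \<delta>1_def)
  qed
  moreover have "rep_comp K W S1 S2 S3 d1 d' (paste S2 \<delta>1 (restrict d1 r) (restrict d' r'))"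
    unfolding rep_comp_iff[OF S assms(6,5)] using c1 by blast
  ultimately show thesis using that unfolding rep_iso_def by blast
qed

lemma rep_comp_iso_right:
  assumes "S1 \<in> spans K W x y" "S2 \<in> spans K W x y" "S3 \<in> spans K W x y"
    "d \<in> reps K W S1 S2" "d' \<in> reps K W S2 S3" "d1 \<in> reps K W S2 S3" "rep_iso S2 S3 d' d1"
    "rep_comp K W S1 S2 S3 d d' e"
  obtains e1 where "rep_comp K W S1 S2 S3 d d1 e1" "rep_iso S1 S3 e e1"
proof -
  note S = assms(1-3)
  obtain r r' \<delta> where c: "composable S1 S2 d d' r r' \<delta>"
    and e: "e = paste S2 \<delta> (restrict d r) (restrict d' r')"
    using assms(8) unfolding rep_comp_iff[OF S assms(4,5)] by blast
  note C = composableD[OF c] and src = composable_src[OF c assms(4,5)]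
  obtain \<gamma>1 \<gamma>2 where \<gamma>: "rep_iso_by S2 S3 \<gamma>1 \<gamma>2 d' d1"
    using assms(7) by (auto simp: rep_iso_def)
  note apex = rep_iso_covers[OF assms(7,5,6) S(2,3)]
  have cov: "covers S2 d1 r'" using apex(2) C(2) by simp
  note [simp] = coversD[OF C(1)] coversD[OF C(2)] legs_reps(1-5)[OF assms(4)] legs_reps(1-5)[OF assms(5)]
    legs_reps(1-5)[OF assms(6)] apex(1) src
  note I = rep_iso_by_restrict[OF \<gamma> assms(5,6) S(2,3) coversD[OF C(2)]]
  have g: "\<gamma>1 \<star> id2 K r' \<in> iso2 K (left_leg d' \<odot> r') (left_leg d1 \<odot> r')"
    using rep_iso_byD(1)[OF I] by simp
  define \<delta>1 where "\<delta>1 = (\<gamma>1 \<star> id2 K r') \<cdot> \<delta>"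
  have \<delta>1: "\<delta>1 \<in> iso2 K (right_leg d \<odot> r) (left_leg d1 \<odot> r')"
    unfolding \<delta>1_def by (rule iso2_vcomp[OF C(3) g])
  have c1: "composable S1 S2 d d1 r r' \<delta>1"
    using cov C(1) \<delta>1 by (simp add: composable_def)
  note R = restrict_reps[OF S(1,2) assms(4) C(1)] restrict_reps[OF S(2,3) assms(5) C(2)]
    restrict_reps[OF S(2,3) assms(6) cov]
  note [simp] = iso2D(1-3)[OF C(3)] iso2D(1-3)[OF g] iso2D(1-3)[OF \<delta>1]
  have "rep_iso_by S1 S3 (id2 K (left_leg (restrict d r))) (\<gamma>2 \<star> id2 K r')
      e (paste S2 \<delta>1 (restrict d r) (restrict d1 r'))"
    unfolding e
  proof (rule paste_iso[OF S R(1,2) R(1,3) C(4) composableD(4)[OF c1] rep_iso_refl[OF R(1) S(1,2)] I])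
    have "right_leg (restrict d r) \<in> Ar1 K" by simp
    then show "(\<gamma>1 \<star> id2 K r') \<cdot> \<delta> = \<delta>1 \<cdot> id2 K (right_leg (restrict d r))"
      by (simp add: \<delta>1_def)
  qed
  moreover have "rep_comp K W S1 S2 S3 d d1 (paste S2 \<delta>1 (restrict d r) (restrict d1 r'))"
    unfolding rep_comp_iff[OF S assms(4,6)] using c1 by blast
  ultimately show thesis using that unfolding rep_iso_def by blast
qed

lemma rep_rel_iff: "(d, d') \<in> rep_rel K W S T \<longleftrightarrow> d \<in> reps K W S T \<and> d' \<in> reps K W S T \<and> rep_equiv K W S T d d'"
  by (simp add: rep_rel_def)

lemma rep_rel_trans:
  assumes "S \<in> spans K W x y" "T \<in> spans K W x y" "(d, e) \<in> rep_rel K W S T" "(e, g) \<in> rep_rel K W S T"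
  shows "(d, g) \<in> rep_rel K W S T"
  using equiv_rep_rel[OF assms(1,2)] assms(3,4) by (meson equivE transD)

text \<open>One factor is exchanged at a time. For each exchange one pair of equivalent composites
  is exhibited over suitable restrictions, and uniqueness of composites links these pairs with each
  other and with the given \<open>e\<close> and \<open>e1\<close>.\<close>

lemma rep_comp_cong:
  assumes "S1 \<in> spans K W x y" "S2 \<in> spans K W x y" "S3 \<in> spans K W x y"
    "(d, d1) \<in> rep_rel K W S1 S2" "(d', d1') \<in> rep_rel K W S2 S3"
    "rep_comp K W S1 S2 S3 d d' e" "rep_comp K W S1 S2 S3 d1 d1' e1"
  shows "(e, e1) \<in> rep_rel K W S1 S3"
proof -
  note S = assms(1-3)
  have d: "d \<in> reps K W S1 S2" "d1 \<in> reps K W S1 S2" "d' \<in> reps K W S2 S3" "d1' \<in> reps K W S2 S3"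
    using assms(4,5) by (auto simp: rep_rel_iff)
  have unique: "(a, b) \<in> rep_rel K W S1 S3"
    if "u \<in> reps K W S1 S2" "u' \<in> reps K W S2 S3"
      "rep_comp K W S1 S2 S3 u u' a" "rep_comp K W S1 S2 S3 u u' b" for u u' a b
    using rep_comp_unique[OF S that] rep_comp_reps[OF S that(1,2)] that(3,4) by (auto simp: rep_rel_iff)
  have iso: "(a, b) \<in> rep_rel K W S1 S3"
    if "rep_iso S1 S3 a b" "a \<in> reps K W S1 S3" "b \<in> reps K W S1 S3" for a b
    using rep_iso_equiv[OF that S(1,3)] that(2,3) by (simp add: rep_rel_iff)
  have left: "\<exists>a b. rep_comp K W S1 S2 S3 d d' a \<and> rep_comp K W S1 S2 S3 d1 d' b \<and> (a, b) \<in> rep_rel K W S1 S3"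
  proof -
    obtain q q1 where q: "covers S1 d q" "covers S1 d1 q1" and i: "rep_iso S1 S2 (restrict d q) (restrict d1 q1)"
      using assms(4) rep_equiv_iff[OF d(1,2) S(1,2)] by (auto simp: rep_rel_iff)
    note R = restrict_reps[OF S(1,2) d(1) q(1)] restrict_reps[OF S(1,2) d(2) q(2)]
    obtain b where b: "rep_comp K W S1 S2 S3 (restrict d1 q1) d' b" by (rule rep_comp_exists[OF S R(2) d(3)])
    obtain a where a: "rep_comp K W S1 S2 S3 (restrict d q) d' a" "rep_iso S1 S3 a b"
      by (rule rep_comp_iso_left[OF S R(2) d(3) R(1) i b])
    from iso[OF a(2) rep_comp_reps[OF S R(1) d(3) a(1)] rep_comp_reps[OF S R(2) d(3) b]]
    show ?thesis using rep_comp_restrict_left[OF S d(1,3) q(1) a(1)] rep_comp_restrict_left[OF S d(2,3) q(2) b]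
      by blast
  qed
  have right: "\<exists>a b. rep_comp K W S1 S2 S3 d1 d' a \<and> rep_comp K W S1 S2 S3 d1 d1' b \<and> (a, b) \<in> rep_rel K W S1 S3"
  proof -
    obtain q q1 where q: "covers S2 d' q" "covers S2 d1' q1" and i: "rep_iso S2 S3 (restrict d' q) (restrict d1' q1)"
      using assms(5) rep_equiv_iff[OF d(3,4) S(2,3)] by (auto simp: rep_rel_iff)
    note R = restrict_reps[OF S(2,3) d(3) q(1)] restrict_reps[OF S(2,3) d(4) q(2)]
    obtain a where a: "rep_comp K W S1 S2 S3 d1 (restrict d' q) a" by (rule rep_comp_exists[OF S d(2) R(1)])
    obtain b where b: "rep_comp K W S1 S2 S3 d1 (restrict d1' q1) b" "rep_iso S1 S3 a b"
      by (rule rep_comp_iso_right[OF S d(2) R(1,2) i a])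
    from iso[OF b(2) rep_comp_reps[OF S d(2) R(1) a] rep_comp_reps[OF S d(2) R(2) b(1)]]
    show ?thesis using rep_comp_restrict_right[OF S d(2,3) q(1) a] rep_comp_restrict_right[OF S d(2,4) q(2) b(1)]
      by blast
  qed
  obtain a b where ab: "rep_comp K W S1 S2 S3 d d' a" "rep_comp K W S1 S2 S3 d1 d' b" "(a, b) \<in> rep_rel K W S1 S3"
    using left by blast
  obtain a' b' where ab': "rep_comp K W S1 S2 S3 d1 d' a'" "rep_comp K W S1 S2 S3 d1 d1' b'" "(a', b') \<in> rep_rel K W S1 S3"
    using right by blast
  \<comment> \<open>The chain of equivalent composites is \<open>e\<close>, \<open>a\<close>,
    \<open>b\<close>, \<open>a'\<close>, \<open>b'\<close>, \<open>e1\<close>: three links come from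
    uniqueness for fixed factors and two from the exchanges.\<close>
  show ?thesis
    using unique[OF d(1,3) assms(6) ab(1)] ab(3) unique[OF d(2,3) ab(2) ab'(1)] ab'(3)
      unique[OF d(2,4) ab'(2) assms(7)] rep_rel_trans[OF S(1,3)] by meson
qed

text \<open>An equality on the nose: with a common apex only the associativity of vertical
  composition is involved.\<close>

lemma paste_assoc:
  assumes "S1 \<in> spans K W x y" "S2 \<in> spans K W x y" "S3 \<in> spans K W x y" "S4 \<in> spans K W x y"
    "d \<in> reps K W S1 S2" "d' \<in> reps K W S2 S3" "d'' \<in> reps K W S3 S4"
    "\<delta> \<in> iso2 K (right_leg d) (left_leg d')" "\<epsilon> \<in> iso2 K (right_leg d') (left_leg d'')"
  shows "paste S3 \<epsilon> (paste S2 \<delta> d d') d'' = paste S2 \<delta> d (paste S3 \<epsilon> d' d'')"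
proof -
  obtain w1 f1 where S1: "S1 = (w1, f1)" by fastforce
  obtain w2 f2 where S2: "S2 = (w2, f2)" by fastforce
  obtain w3 f3 where S3: "S3 = (w3, f3)" by fastforce
  obtain w4 f4 where S4: "S4 = (w4, f4)" by fastforce
  obtain p1 p2 \<alpha> \<beta> where d: "d = (p1, p2, \<alpha>, \<beta>)" by (rule prod_cases4)
  obtain p1' p2' \<alpha>' \<beta>' where d': "d' = (p1', p2', \<alpha>', \<beta>')" by (rule prod_cases4)
  obtain p1'' p2'' \<alpha>'' \<beta>'' where d'': "d'' = (p1'', p2'', \<alpha>'', \<beta>'')" by (rule prod_cases4)
  note [simp] = spansD(2-)[OF assms(1)[unfolded S1]] spansD(2-)[OF assms(2)[unfolded S2]]
    spansD(2-)[OF assms(3)[unfolded S3]] spansD(2-)[OF assms(4)[unfolded S4]]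
    repsD(1-11)[OF assms(5)[unfolded S1 S2 d]] repsD(1-11)[OF assms(6)[unfolded S2 S3 d']]
    repsD(1-11)[OF assms(7)[unfolded S3 S4 d'']]
  have \<delta>: "\<delta> \<in> iso2 K p2 p1'" and \<epsilon>: "\<epsilon> \<in> iso2 K p2' p1''"
    using assms(8,9) by (simp_all add: d d' d'')
  note [simp] = iso2D(1-3)[OF \<delta>] iso2D(1-3)[OF \<epsilon>]
  show ?thesis by (simp add: S2 S3 d d' d'')
qed

text \<open>The choices for one bracketing yield choices for the other with literally the same
  composite \<open>g\<close>. The first choice is restricted along \<open>s\<close>, so that the
  composite \<open>e'\<close> of the last two factors already has the right apex and is composed
  with \<open>d\<close> using an identity.\<close>

lemma rep_comp_assoc:
  assumes "S1 \<in> spans K W x y" "S2 \<in> spans K W x y" "S3 \<in> spans K W x y" "S4 \<in> spans K W x y"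
    "d \<in> reps K W S1 S2" "d' \<in> reps K W S2 S3" "d'' \<in> reps K W S3 S4"
    "rep_comp K W S1 S2 S3 d d' e" "rep_comp K W S1 S3 S4 e d'' g"
  obtains e' where "rep_comp K W S2 S3 S4 d' d'' e'" "rep_comp K W S1 S2 S4 d e' g"
proof -
  note S = assms(1-4) and d = assms(5-7)
  have er: "e \<in> reps K W S1 S3" by (rule rep_comp_reps[OF S(1-3) d(1,2) assms(8)])
  obtain r r' \<delta> where c: "composable S1 S2 d d' r r' \<delta>"
    and e: "e = paste S2 \<delta> (restrict d r) (restrict d' r')"
    using assms(8) unfolding rep_comp_iff[OF S(1-3) d(1,2)] by blast
  obtain s s'' \<epsilon> where k: "composable S1 S3 e d'' s s'' \<epsilon>"
    and g: "g = paste S3 \<epsilon> (restrict e s) (restrict d'' s'')"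
    using assms(9) unfolding rep_comp_iff[OF S(1,3,4) er d(3)] by blast
  note C = composableD[OF c] composable_src[OF c d(1,2)] and D = composableD[OF k] composable_src[OF k er d(3)]
  note [simp] = coversD[OF C(1)] coversD[OF C(2)] C(5) legs_reps(1-5)[OF d(1)] legs_reps(1-5)[OF d(2)]
    legs_reps(1-5)[OF d(3)] spans_fst(2)[OF S(1)]
  have s [simp]: "s \<in> Ar1 K" "tgt K s = src K r" using coversD[OF D(1)] by (simp_all add: e)
  have rs: "covers S1 d (r \<odot> s)" using D(1) by (simp add: covers_def e)
  have \<delta>s: "\<delta> \<star> id2 K s \<in> iso2 K (right_leg d \<odot> r \<odot> s) (left_leg d' \<odot> r' \<odot> s)"
    using iso2_rwhisker[OF C(3), of s] by simp
  have r's: "covers S2 d' (r' \<odot> s)"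
    using composableD(2)[OF composableI[OF S(1,2) d(1,2) rs _ _ \<delta>s]] by simp
  have c': "composable S2 S3 d' d'' (r' \<odot> s) s'' \<epsilon>"
    using r's D(2,3) by (simp add: composable_def e)
  define e' where "e' = paste S3 \<epsilon> (restrict d' (r' \<odot> s)) (restrict d'' s'')"
  have e'c: "rep_comp K W S2 S3 S4 d' d'' e'"
    unfolding rep_comp_iff[OF S(2-4) d(2,3)] e'_def using c' by blast
  have e'r: "e' \<in> reps K W S2 S4" by (rule rep_comp_reps[OF S(2-4) d(2,3) e'c])
  have "composable S1 S2 d e' (r \<odot> s) (id1 K (apex e')) (\<delta> \<star> id2 K s)"
    by (rule composableI[OF S(1,2) d(1) e'r rs]) (use \<delta>s in \<open>simp_all add: e'_def\<close>)
  moreover have "g = paste S2 (\<delta> \<star> id2 K s) (restrict d (r \<odot> s)) (restrict e' (id1 K (apex e')))"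
  proof -
    have "restrict e s = paste S2 (\<delta> \<star> id2 K s) (restrict d (r \<odot> s)) (restrict d' (r' \<odot> s))"
      using restrict_paste[OF S(1-3) restrict_reps[OF S(1,2) d(1) C(1)] restrict_reps[OF S(2,3) d(2) C(2)] C(4), of s]
        restrict_restrict[OF d(1) S(1,2), of r s] restrict_restrict[OF d(2) S(2,3), of r' s]
      by (simp add: e)
    then show ?thesis
      unfolding restrict_id[OF e'r S(2,4)] unfolding g e'_def
      using paste_assoc[OF S restrict_reps[OF S(1,2) d(1) rs] restrict_reps[OF S(2,3) d(2) r's]
          restrict_reps[OF S(3,4) d(3) D(2)] _ composableD(4)[OF c'], of "\<delta> \<star> id2 K s"] \<delta>s
      by simp
  qed
  ultimately have "rep_comp K W S1 S2 S4 d e' g"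
    unfolding rep_comp_iff[OF S(1,2,4) d(1) e'r] by blast
  then show thesis using that e'c by blast
qed

section \<open>Identity and inverse representatives\<close>

fun id_rep :: "'a span \<Rightarrow> ('a, 'c) rep" where
  "id_rep (w, f) = (id1 K (src K w), id1 K (src K w), id2 K w, id2 K f)"

lemma id_rep_reps:
  assumes "S \<in> spans K W x y"
  shows "id_rep S \<in> reps K W S S"
proof -
  obtain w f where S: "S = (w, f)" by fastforce
  show ?thesis using spansD[OF assms[unfolded S]] by (simp add: S reps_iff)
qed

lemma covers_id_rep:
  assumes "S \<in> spans K W x y" "d \<in> reps K W S T"
  shows "covers S (id_rep S) (left_leg d)"
proof -
  obtain w f where S: "S = (w, f)" by fastforce
  show ?thesis using spansD[OF assms(1)[unfolded S]] legs_reps[OF assms(2)] by (simp add: S covers_def)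
qed

text \<open>With \<open>r = p1\<close>, \<open>r'\<close> an identity and \<delta> an identity, the
  composite is \<open>d\<close> itself and not merely equivalent to it.\<close>

lemma rep_comp_id_left:
  assumes "S \<in> spans K W x y" "T \<in> spans K W x y" "d \<in> reps K W S T"
  shows "rep_comp K W S S T (id_rep S) d d"
proof -
  obtain w1 f1 where S: "S = (w1, f1)" by fastforce
  obtain w2 f2 where T: "T = (w2, f2)" by fastforce
  obtain p1 p2 \<alpha> \<beta> where d: "d = (p1, p2, \<alpha>, \<beta>)" by (rule prod_cases4)
  note [simp] = spansD(2-)[OF assms(1)[unfolded S]] spansD(2-)[OF assms(2)[unfolded T]]
    repsD(1-11)[OF assms(3)[unfolded S T d]]
  have "composable S S (id_rep S) d p1 (id1 K (src K p1)) (id2 K p1)"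
    by (rule composableI[OF assms(1,1) id_rep_reps[OF assms(1)] assms(3)])
      (use covers_id_rep[OF assms(1,3)] in \<open>simp_all add: S d\<close>)
  moreover have "d = paste S (id2 K p1) (restrict (id_rep S) p1) (restrict d (id1 K (src K p1)))"
    by (simp add: S d)
  ultimately show ?thesis
    unfolding rep_comp_iff[OF assms(1,1,2) id_rep_reps[OF assms(1)] assms(3)] by blast
qed

lemma rep_comp_id_right:
  assumes "S \<in> spans K W x y" "T \<in> spans K W x y" "d \<in> reps K W S T"
  shows "rep_comp K W S T T d (id_rep T) d"
proof -
  obtain w1 f1 where S: "S = (w1, f1)" by fastforce
  obtain w2 f2 where T: "T = (w2, f2)" by fastforce
  obtain p1 p2 \<alpha> \<beta> where d: "d = (p1, p2, \<alpha>, \<beta>)" by (rule prod_cases4)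
  note [simp] = spansD(2-)[OF assms(1)[unfolded S]] spansD(2-)[OF assms(2)[unfolded T]]
    repsD(1-11)[OF assms(3)[unfolded S T d]]
  have "composable S T d (id_rep T) (id1 K (src K p1)) p2 (id2 K p2)"
    by (rule composableI[OF assms(1,2,3) id_rep_reps[OF assms(2)]])
      (use covers_id[OF assms(3)] in \<open>simp_all add: T d\<close>)
  moreover have "d = paste T (id2 K p2) (restrict d (id1 K (src K p1))) (restrict (id_rep T) p2)"
    by (simp add: T d)
  ultimately show ?thesis
    unfolding rep_comp_iff[OF assms(1,2,2,3) id_rep_reps[OF assms(2)]] by blast
qed

text \<open>Composing along identities cancels \<alpha> and \<beta> and leaves the restriction of
  \<open>id_rep S\<close> along \<open>p1\<close>, which is equivalent to \<open>id_rep S\<close>.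
  One-sided inverses suffice as hypotheses because the other side is obtained by exchanging the
  roles of the two representatives.\<close>

lemma rep_comp_inverse:
  assumes "S \<in> spans K W x y" "T \<in> spans K W x y"
    "(p1, p2, \<alpha>, \<beta>) \<in> reps K W S T" "\<beta> \<in> iso2 K (snd S \<odot> p1) (snd T \<odot> p2)"
    "\<alpha>' \<in> iso2 K (fst T \<odot> p2) (fst S \<odot> p1)" "\<alpha>' \<cdot> \<alpha> = id2 K (fst S \<odot> p1)"
    "\<beta>' \<in> iso2 K (snd T \<odot> p2) (snd S \<odot> p1)" "\<beta>' \<cdot> \<beta> = id2 K (snd S \<odot> p1)"
  shows "(p2, p1, \<alpha>', \<beta>') \<in> reps K W T S"
    and "\<exists>e. rep_comp K W S T S (p1, p2, \<alpha>, \<beta>) (p2, p1, \<alpha>', \<beta>') e \<and> (id_rep S, e) \<in> rep_rel K W S S"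
proof -
  obtain w1 f1 where S: "S = (w1, f1)" by fastforce
  obtain w2 f2 where T: "T = (w2, f2)" by fastforce
  note d = assms(3)
  note [simp] = spansD(2-)[OF assms(1)[unfolded S]] spansD(2-)[OF assms(2)[unfolded T]]
    repsD(1-11)[OF assms(3)[unfolded S T]]
  have i: "\<alpha>' \<in> iso2 K (w2 \<odot> p2) (w1 \<odot> p1)" "\<alpha>' \<cdot> \<alpha> = id2 K (w1 \<odot> p1)"
    "\<beta>' \<in> iso2 K (f2 \<odot> p2) (f1 \<odot> p1)" "\<beta>' \<cdot> \<beta> = id2 K (f1 \<odot> p1)"
    using assms(5-8) by (simp_all add: S T)
  note [simp] = iso2D(1-3)[OF i(1)] iso2D(1-3)[OF i(3)]
  show d': "(p2, p1, \<alpha>', \<beta>') \<in> reps K W T S"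
    using i repsD(12,13)[OF assms(3)[unfolded S T]] by (simp add: S T reps_iff)
  let ?d = "(p1, p2, \<alpha>, \<beta>)" and ?d' = "(p2, p1, \<alpha>', \<beta>')"
  let ?e = "restrict (id_rep S) p1"
  have "composable S T ?d ?d' (id1 K (src K p1)) (id1 K (src K p1)) (id2 K p2)"
    by (rule composableI[OF assms(1,2) d d']) (use covers_id[OF d] in simp_all)
  moreover have "?e = paste T (id2 K p2) (restrict ?d (id1 K (src K p1))) (restrict ?d' (id1 K (src K p1)))"
    by (simp add: S T i)
  ultimately have "rep_comp K W S T S ?d ?d' ?e"
    unfolding rep_comp_iff[OF assms(1,2,1) d d'] by blast
  moreover have "(id_rep S, ?e) \<in> rep_rel K W S S"
  proof -
    have c: "covers S (id_rep S) p1" using covers_id_rep[OF assms(1) d] by simp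
    note R = id_rep_reps[OF assms(1)] restrict_reps[OF assms(1,1) id_rep_reps[OF assms(1)] c]
    have "rep_iso S S ?e (restrict ?e (id1 K (apex ?e)))"
      using rep_iso_refl[OF R(2) assms(1,1)] restrict_id[OF R(2) assms(1,1)] by (auto simp: rep_iso_def)
    then have "rep_equiv K W S S (id_rep S) ?e"
      using c covers_id[OF R(2)] rep_equiv_iff[OF R assms(1,1)] by blast
    then show ?thesis using R by (simp add: rep_rel_iff)
  qed
  ultimately show "\<exists>e. rep_comp K W S T S ?d ?d' e \<and> (id_rep S, e) \<in> rep_rel K W S S" by blast
qed


section \<open>The hom-categories of fractions\<close>

definition rep_class :: "'a span \<Rightarrow> 'a span \<Rightarrow> ('a, 'c) rep \<Rightarrow> ('a, 'c) frac2" where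
  "rep_class S T d = (S, T, rep_rel K W S T `` {d})"

lemma hom_frac:
  "a \<in> hom (frac_hom_category K W x y) S T \<longleftrightarrow>
    S \<in> spans K W x y \<and> T \<in> spans K W x y \<and> (\<exists>d \<in> reps K W S T. a = rep_class S T d)"
  by (auto simp: hom_def frac_hom_category_def rep_class_def quotient_def)

lemma rep_class_eq:
  assumes "S \<in> spans K W x y" "T \<in> spans K W x y" "(d, e) \<in> rep_rel K W S T"
  shows "rep_class S T d = rep_class S T e"
  using equiv_class_eq[OF equiv_rep_rel[OF assms(1,2)] assms(3)] by (simp add: rep_class_def)

text \<open>The image defining \<open>frac_comp\<close> ranges over composites of all
  representatives of the two classes. By \<open>rep_comp_cong\<close> these are equivalent to each
  other, so any single composite \<open>e\<close> determines the result.\<close>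

lemma frac_comp_class:
  assumes "S1 \<in> spans K W x y" "S2 \<in> spans K W x y" "S3 \<in> spans K W x y"
    "d \<in> reps K W S1 S2" "d' \<in> reps K W S2 S3" "rep_comp K W S1 S2 S3 d d' e"
  shows "frac_comp K W (rep_class S2 S3 d') (rep_class S1 S2 d) = rep_class S1 S3 e"
proof -
  have refl: "(d, d) \<in> rep_rel K W S1 S2" "(d', d') \<in> rep_rel K W S2 S3"
    using equiv_class_self[OF equiv_rep_rel[OF assms(1,2)] assms(4)]
      equiv_class_self[OF equiv_rep_rel[OF assms(2,3)] assms(5)] by simp_all
  have "rep_rel K W S1 S3 `` {e'. \<exists>c \<in> rep_rel K W S1 S2 `` {d}. \<exists>c' \<in> rep_rel K W S2 S3 `` {d'}.
      rep_comp K W S1 S2 S3 c c' e'} = rep_rel K W S1 S3 `` {e}" (is "?l = ?r")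
  proof (intro equalityI subsetI)
    fix z assume "z \<in> ?l"
    then obtain e' c c' where "(e', z) \<in> rep_rel K W S1 S3" "(d, c) \<in> rep_rel K W S1 S2"
      "(d', c') \<in> rep_rel K W S2 S3" "rep_comp K W S1 S2 S3 c c' e'" by blast
    then have "(e, z) \<in> rep_rel K W S1 S3"
      using rep_comp_cong[OF assms(1-3) _ _ assms(6)] rep_rel_trans[OF assms(1,3)] by meson
    then show "z \<in> ?r" by simp
  next
    fix z assume "z \<in> ?r" then show "z \<in> ?l" using refl assms(6) by blast
  qed
  then show ?thesis by (simp add: rep_class_def)
qed

lemma frac_id_class: "S \<in> spans K W x y \<Longrightarrow> frac_id K W S = rep_class S S (id_rep S)"
  by (cases S) (simp add: rep_class_def)

text \<open>Every axiom is checked on representatives. Since any composite may be used to compute a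
  product of classes, it is enough to find, for each axiom, one choice for which it holds.\<close>

lemma category_frac_hom: "category (frac_hom_category K W x y)" (is "category ?H")
proof
  have [simp]: "Ide ?H = frac_id K W" "Cmp ?H = frac_comp K W" "Obj ?H = spans K W x y"
    by (simp_all add: frac_hom_category_def)
  show "Dom ?H a \<in> Obj ?H" "Cod ?H a \<in> Obj ?H" if "a \<in> Arr ?H" for a
    using that by (auto simp: frac_hom_category_def)
  show "Ide ?H S \<in> hom ?H S S" if "S \<in> Obj ?H" for S
    using that frac_id_class[of S x y] id_rep_reps[of S x y] unfolding hom_frac by auto
  show "Cmp ?H b a \<in> hom ?H S U" if ab: "a \<in> hom ?H S T" "b \<in> hom ?H T U" for a b S T U
  proof -
    obtain d d' where S: "S \<in> spans K W x y" "T \<in> spans K W x y" "U \<in> spans K W x y"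
      and d: "d \<in> reps K W S T" "d' \<in> reps K W T U" and a: "a = rep_class S T d" "b = rep_class T U d'"
      using ab unfolding hom_frac by blast
    obtain e where e: "rep_comp K W S T U d d' e" by (rule rep_comp_exists[OF S d])
    show ?thesis
      using frac_comp_class[OF S d e] rep_comp_reps[OF S d e] S unfolding a hom_frac by auto
  qed
  show "Cmp ?H a (Ide ?H S) = a" "Cmp ?H (Ide ?H T) a = a" if ab: "a \<in> hom ?H S T" for a S T
  proof -
    obtain d where S: "S \<in> spans K W x y" "T \<in> spans K W x y" and d: "d \<in> reps K W S T"
      and a: "a = rep_class S T d"
      using ab unfolding hom_frac by blast
    show "Cmp ?H a (Ide ?H S) = a"
      using frac_comp_class[OF S(1,1,2) id_rep_reps[OF S(1)] d rep_comp_id_left[OF S d]] frac_id_class[OF S(1)]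
      by (simp add: a)
    show "Cmp ?H (Ide ?H T) a = a"
      using frac_comp_class[OF S(1,2,2) d id_rep_reps[OF S(2)] rep_comp_id_right[OF S d]] frac_id_class[OF S(2)]
      by (simp add: a)
  qed
  show "Cmp ?H (Cmp ?H c b) a = Cmp ?H c (Cmp ?H b a)"
    if ab: "a \<in> hom ?H S T" "b \<in> hom ?H T U" "c \<in> hom ?H U V" for a b c S T U V
  proof -
    obtain d d' d'' where S: "S \<in> spans K W x y" "T \<in> spans K W x y" "U \<in> spans K W x y" "V \<in> spans K W x y"
      and d: "d \<in> reps K W S T" "d' \<in> reps K W T U" "d'' \<in> reps K W U V"
      and a: "a = rep_class S T d" "b = rep_class T U d'" "c = rep_class U V d''"
      using ab unfolding hom_frac by blast
    obtain e where e: "rep_comp K W S T U d d' e" by (rule rep_comp_exists[OF S(1-3) d(1,2)])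
    note er = rep_comp_reps[OF S(1-3) d(1,2) e]
    obtain g where g: "rep_comp K W S U V e d'' g" by (rule rep_comp_exists[OF S(1,3,4) er d(3)])
    obtain e' where e': "rep_comp K W T U V d' d'' e'" "rep_comp K W S T V d e' g"
      by (rule rep_comp_assoc[OF S d e g])
    note e'r = rep_comp_reps[OF S(2-4) d(2,3) e'(1)]
    show ?thesis
      using frac_comp_class[OF S(1-3) d(1,2) e] frac_comp_class[OF S(1,3,4) er d(3) g]
        frac_comp_class[OF S(2-4) d(2,3) e'(1)] frac_comp_class[OF S(1,2,4) d(1) e'r e'(2)]
      by (simp add: a)
  qed
qed

lemma isos_frac:
  assumes "S \<in> spans K W x y" "T \<in> spans K W x y"
    "(p1, p2, \<alpha>, \<beta>) \<in> reps K W S T" "\<beta> \<in> iso2 K (snd S \<odot> p1) (snd T \<odot> p2)"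
  shows "isos (frac_hom_category K W x y) S T \<noteq> {}"
proof -
  note S = assms(1,2)
  have \<alpha>: "\<alpha> \<in> iso2 K (fst S \<odot> p1) (fst T \<odot> p2)"
    using assms(3) by (cases S; cases T; simp add: reps_iff)
  obtain \<alpha>' where \<alpha>': "\<alpha>' \<in> iso2 K (fst T \<odot> p2) (fst S \<odot> p1)"
    "\<alpha>' \<cdot> \<alpha> = id2 K (fst S \<odot> p1)" "\<alpha> \<cdot> \<alpha>' = id2 K (fst T \<odot> p2)" using \<alpha> by (rule iso2E)
  obtain \<beta>' where \<beta>': "\<beta>' \<in> iso2 K (snd T \<odot> p2) (snd S \<odot> p1)"
    "\<beta>' \<cdot> \<beta> = id2 K (snd S \<odot> p1)" "\<beta> \<cdot> \<beta>' = id2 K (snd T \<odot> p2)" using assms(4) by (rule iso2E)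
  let ?d = "(p1, p2, \<alpha>, \<beta>)" and ?d' = "(p2, p1, \<alpha>', \<beta>')"
  note inv = rep_comp_inverse[OF S assms(3,4) \<alpha>'(1,2) \<beta>'(1,2)]
  \<comment> \<open>The same lemma with the two spans exchanged provides the inverse law on the
    other side.\<close>
  note inv' = rep_comp_inverse[OF S(2,1) inv(1) \<beta>'(1) \<alpha> \<alpha>'(3) assms(4) \<beta>'(3)]
  obtain e where e: "rep_comp K W S T S ?d ?d' e" "(id_rep S, e) \<in> rep_rel K W S S" using inv(2) by blast
  obtain e' where e': "rep_comp K W T S T ?d' ?d e'" "(id_rep T, e') \<in> rep_rel K W T T" using inv'(2) by blast
  have "rep_class S T ?d \<in> isos (frac_hom_category K W x y) S T"
    unfolding isos_def
  proof (intro CollectI conjI bexI[of _ "rep_class T S ?d'"])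
    show "rep_class S T ?d \<in> hom (frac_hom_category K W x y) S T"
      using S assms(3) unfolding hom_frac by blast
    show "rep_class T S ?d' \<in> hom (frac_hom_category K W x y) T S"
      using S inv(1) unfolding hom_frac by blast
    show "Cmp (frac_hom_category K W x y) (rep_class T S ?d') (rep_class S T ?d) = Ide (frac_hom_category K W x y) S"
      using frac_comp_class[OF S S(1) assms(3) inv(1) e(1)] rep_class_eq[OF S(1,1) e(2)] frac_id_class[OF S(1)]
      by (simp add: frac_hom_category_def)
    show "Cmp (frac_hom_category K W x y) (rep_class S T ?d) (rep_class T S ?d') = Ide (frac_hom_category K W x y) T"
      using frac_comp_class[OF S(2,1,2) inv(1) assms(3) e'(1)] rep_class_eq[OF S(2,2) e'(2)] frac_id_class[OF S(2)]
      by (simp add: frac_hom_category_def)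
  qed
  then show ?thesis by blast
qed

text \<open>The 2-arrows are conjugated with the given isomorphisms of legs. This is the device that
  moves the legs of a representative into a prescribed small set.\<close>

lemma rep_transport:
  assumes "S \<in> spans K W x y" "T \<in> spans K W x y" "(p1, p2, \<alpha>, \<beta>) \<in> reps K W S T"
    "\<gamma>1 \<in> iso2 K p1 p1'" "\<gamma>2 \<in> iso2 K p2 p2'"
  obtains \<alpha>' \<beta>' where "(p1', p2', \<alpha>', \<beta>') \<in> reps K W S T" "rep_iso S T (p1, p2, \<alpha>, \<beta>) (p1', p2', \<alpha>', \<beta>')"
proof -
  obtain w1 f1 where S: "S = (w1, f1)" by fastforce
  obtain w2 f2 where T: "T = (w2, f2)" by fastforce
  note d = repsD[OF assms(3)[unfolded S T]]
  note [simp] = spansD(2-)[OF assms(1)[unfolded S]] spansD(2-)[OF assms(2)[unfolded T]]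
    d(1-11) iso2D[OF assms(4)] iso2D[OF assms(5)]
  obtain \<gamma>1' where \<gamma>1': "\<gamma>1' \<in> iso2 K p1' p1" "\<gamma>1' \<cdot> \<gamma>1 = id2 K p1" "\<gamma>1 \<cdot> \<gamma>1' = id2 K p1'"
    using assms(4) by (rule iso2E)
  note [simp] = iso2D(1-5)[OF \<gamma>1'(1)]
  have w: "id2 K w1 \<star> \<gamma>1 \<in> iso2 K (w1 \<odot> p1) (w1 \<odot> p1')" "id2 K w2 \<star> \<gamma>2 \<in> iso2 K (w2 \<odot> p2) (w2 \<odot> p2')"
    "id2 K w1 \<star> \<gamma>1' \<in> iso2 K (w1 \<odot> p1') (w1 \<odot> p1)"
    by (rule iso2_lwhisker[OF assms(4)] iso2_lwhisker[OF assms(5)] iso2_lwhisker[OF \<gamma>1'(1)]; simp)+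
  define \<alpha>' where "\<alpha>' = (id2 K w2 \<star> \<gamma>2) \<cdot> \<alpha> \<cdot> (id2 K w1 \<star> \<gamma>1')"
  define \<beta>' where "\<beta>' = (id2 K f2 \<star> \<gamma>2) \<cdot> \<beta> \<cdot> (id2 K f1 \<star> \<gamma>1')"
  have \<alpha>'_iso: "\<alpha>' \<in> iso2 K (w1 \<odot> p1') (w2 \<odot> p2')"
    unfolding \<alpha>'_def by (rule iso2_vcomp[OF iso2_vcomp[OF w(3) d(14)] w(2)])
  note [simp] = iso2D(1-3)[OF \<alpha>'_iso]
  have [simp]: "\<beta>' \<in> Ar2 K" "src2 K \<beta>' = f1 \<odot> p1'" "tgt2 K \<beta>' = f2 \<odot> p2'"
    by (simp_all add: \<beta>'_def)
  have "(p1', p2', \<alpha>', \<beta>') \<in> reps K W S T"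
    using d(12,13) W_iso2[OF w(1)] W_iso2[OF w(2)] \<alpha>'_iso by (simp add: S T reps_iff)
  moreover have "rep_iso_by S T \<gamma>1 \<gamma>2 (p1, p2, \<alpha>, \<beta>) (p1', p2', \<alpha>', \<beta>')"
    unfolding S T rep_iso_by.simps
    using iso2_transpose[OF assms(4) \<gamma>1', of w1 "(id2 K w2 \<star> \<gamma>2) \<cdot> \<alpha>" \<alpha>']
      iso2_transpose[OF assms(4) \<gamma>1', of f1 "(id2 K f2 \<star> \<gamma>2) \<cdot> \<beta>" \<beta>'] assms(4,5)
    by (simp add: \<alpha>'_def[symmetric] \<beta>'_def[symmetric])
  ultimately show thesis using that unfolding rep_iso_def by blast
qed

section \<open>Essential smallness of the hom-categories of fractions\<close>

lemma isos_hom_category: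
  assumes "\<theta> \<in> isos (hom_category K x y) f g"
  shows "\<theta> \<in> iso2 K f g"
  using assms unfolding isos_def hom_def hom_category_def hcat_def vcat_def cat1_def by auto

lemma hom_hom_category:
  assumes "f \<in> hom (cat1 K) x y"
  shows "hom (hom_category K x y) f g = {\<alpha> \<in> Ar2 K. src2 K \<alpha> = f \<and> tgt2 K \<alpha> = g}"
  using assms unfolding hom_def hom_category_def hcat_def cat1_def by auto

lemma essentially_small_frac:
  assumes \<kappa>: "size_cardinal \<kappa>" and les: "locally_essentially_small \<kappa> (Ob K) (hom_category K)"
    and V: "locally_small_cofinal_class \<kappa> K V W" and x: "x \<in> Ob K" and y: "y \<in> Ob K"
  shows "essentially_small \<kappa> (frac_hom_category K W x y)"
proof -
  let ?H = "frac_hom_category K W x y"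
  have VW: "V \<subseteq> W" and cofinal: "\<And>f. f \<in> W \<Longrightarrow> \<exists>g \<in> V. \<exists>s \<in> hom (cat1 K) (src K g) (src K f).
      tgt K g = tgt K f \<and> iso2 K (f \<odot> s) g \<noteq> {}"
    using V by (auto simp: locally_small_cofinal_class_def cofinal_class_def)
  define Vx where "Vx = {g \<in> V. tgt K g = x}"
  have Vx_small: "small \<kappa> Vx" using V x by (simp add: locally_small_cofinal_class_def Vx_def)
  have VxD: "g \<in> W" "g \<in> Ar1 K" "tgt K g = x" "src K g \<in> Ob K" if "g \<in> Vx" for g
    using that VW W_arr[of g] by (auto simp: Vx_def)
  have "\<forall>a\<in>Ob K. \<forall>b\<in>Ob K. \<exists>R. R \<subseteq> Obj (hom_category K a b) \<and> small \<kappa> R \<and>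
      (\<forall>f\<in>Obj (hom_category K a b). \<exists>h\<in>R. isos (hom_category K a b) f h \<noteq> {})"
  proof (intro ballI)
    fix a b assume "a \<in> Ob K" "b \<in> Ob K"
    then have "essentially_small \<kappa> (hom_category K a b)"
      using les by (simp add: locally_essentially_small_def)
    then show "\<exists>R. R \<subseteq> Obj (hom_category K a b) \<and> small \<kappa> R \<and>
      (\<forall>f\<in>Obj (hom_category K a b). \<exists>h\<in>R. isos (hom_category K a b) f h \<noteq> {})"
      by (rule essentially_smallD) blast
  qed
  \<comment> \<open>\<open>R a b\<close> is a small set of 1-arrows from \<open>a\<close> to
    \<open>b\<close> meeting every isomorphism class, chosen for all pairs of objects at
    once.\<close>
  then obtain R where R: "\<And>a b. a \<in> Ob K \<Longrightarrow> b \<in> Ob K \<Longrightarrow> R a b \<subseteq> Obj (hom_category K a b) \<and> small \<kappa> (R a b) \<and>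
      (\<forall>f\<in>Obj (hom_category K a b). \<exists>h\<in>R a b. isos (hom_category K a b) f h \<noteq> {})"
    by metis
  have R_small: "small \<kappa> (R a b)" if "a \<in> Ob K" "b \<in> Ob K" for a b using R[OF that] by blast
  have R_hom: "h \<in> hom (cat1 K) a b" if "a \<in> Ob K" "b \<in> Ob K" "h \<in> R a b" for a b h
    using R[OF that(1,2)] that(3) by (auto simp: hom_category_def)
  have R_iso: "\<exists>h\<in>R (src K f) (tgt K f). iso2 K f h \<noteq> {}" if f: "f \<in> Ar1 K" for f
  proof -
    have "f \<in> Obj (hom_category K (src K f) (tgt K f))" using f by (simp add: hom_category_def)
    then obtain h where "h \<in> R (src K f) (tgt K f)" "isos (hom_category K (src K f) (tgt K f)) f h \<noteq> {}"
      using R[OF src_Ob[OF f] tgt_Ob[OF f]] by blast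
    then show ?thesis using isos_hom_category by blast
  qed
  have hom_small: "small \<kappa> {\<alpha> \<in> Ar2 K. src2 K \<alpha> = f \<and> tgt2 K \<alpha> = g}"
    if "f \<in> hom (cat1 K) a b" "g \<in> hom (cat1 K) a b" for f g a b
  proof -
    have "a \<in> Ob K" "b \<in> Ob K" using that(1) by auto
    then have "essentially_small \<kappa> (hom_category K a b)" using les by (simp add: locally_essentially_small_def)
    moreover have "f \<in> Obj (hom_category K a b)" "g \<in> Obj (hom_category K a b)"
      using that by (simp_all add: hom_category_def)
    ultimately have "small \<kappa> (hom (hom_category K a b) f g)"
      by (blast elim: essentially_smallD)
    then show ?thesis using hom_hom_category[OF that(1)] by simp
  qed
  \<comment> \<open>The left leg is taken from the elements of \<open>V\<close> over
    \<open>x\<close>; its source then fixes the hom-category to which the representative of the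
    right leg belongs.\<close>
  define Q where "Q = (SIGMA g : Vx. R (src K g) y)"
  have "Q \<subseteq> spans K W x y"
  proof
    fix T assume "T \<in> Q"
    then obtain g h where T: "T = (g, h)" and g: "g \<in> Vx" and h: "h \<in> R (src K g) y"
      by (auto simp: Q_def)
    show "T \<in> spans K W x y"
      using VxD[OF g] R_hom[OF VxD(4)[OF g] y h] by (simp add: T spans_def)
  qed
  have "small \<kappa> Q"
    unfolding Q_def by (rule small_Sigma[OF \<kappa> Vx_small R_small[OF VxD(4) y]])
  show ?thesis
  proof (rule essentially_smallI[OF \<kappa> category_frac_hom])
    show "Q \<subseteq> Obj ?H" using \<open>Q \<subseteq> spans K W x y\<close> by (simp add: frac_hom_category_def)
    show "small \<kappa> Q" by fact
    show "\<exists>T\<in>Q. isos ?H S T \<noteq> {}" if "S \<in> Obj ?H" for S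
    proof -
      obtain w f where S: "S = (w, f)" by fastforce
      have SH: "S \<in> spans K W x y" using that by (simp add: frac_hom_category_def)
      note w = spansD[OF SH[unfolded S]]
      obtain g s \<theta> where g: "g \<in> V" "s \<in> hom (cat1 K) (src K g) (src K w)" "tgt K g = tgt K w"
        and \<theta>: "\<theta> \<in> iso2 K (w \<odot> s) g"
        using cofinal[OF w(1)] by blast
      have gx: "g \<in> Vx" using g w by (simp add: Vx_def)
      note [simp] = w(2-6) VxD(2-4)[OF gx]
      have s [simp]: "s \<in> Ar1 K" "src K s = src K g" "tgt K s = src K w" using g by simp_all
      obtain h \<psi> where h: "h \<in> R (src K g) y" and \<psi>: "\<psi> \<in> iso2 K (f \<odot> s) h"
        using R_iso[of "f \<odot> s"] by auto
      have [simp]: "h \<in> Ar1 K" "src K h = src K g" "tgt K h = y" using R_hom[OF _ y h] by simp_all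
      have Q: "(g, h) \<in> Q" using gx h by (simp add: Q_def)
      have "w \<odot> s \<in> W" using W_iso2[OF \<theta>] VxD(1)[OF gx] by simp
      \<comment> \<open>The span \<open>S\<close> is compared with \<open>(g, h)\<close> over the
        apex \<open>src K g\<close>. There the left leg of \<open>S\<close> becomes \<open>g\<close>
        through \<theta>, its right leg becomes \<open>h\<close> through \<psi>, and the leg towards
        \<open>(g, h)\<close> is an identity.\<close>
      then have d: "(s, id1 K (src K g), \<theta>, \<psi>) \<in> reps K W S (g, h)"
        using \<theta> iso2D(1-3)[OF \<psi>] VxD(1)[OF gx] by (simp add: S reps_iff)
      have "isos ?H S (g, h) \<noteq> {}"
        by (rule isos_frac[OF SH _ d]) (use Q \<open>Q \<subseteq> spans K W x y\<close> \<psi> in \<open>auto simp: S\<close>)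
      then show ?thesis using Q by blast
    qed
    show "small \<kappa> (hom ?H S T)" if "S \<in> Q" "T \<in> Q" for S T
    proof -
      obtain w1 f1 where S: "S = (w1, f1)" by fastforce
      obtain w2 f2 where T: "T = (w2, f2)" by fastforce
      have ST: "S \<in> spans K W x y" "T \<in> spans K W x y" using that \<open>Q \<subseteq> spans K W x y\<close> by blast+
      note w = spansD[OF ST(1)[unfolded S]] spansD[OF ST(2)[unfolded T]]
      \<comment> \<open>A small set of candidate tuples. It may contain tuples that are not
        representatives, which is harmless since it serves only as an upper bound; of
        \<open>g\<close> only the source matters, as the apex.\<close>
      define B where "B = (\<Union>g\<in>Vx. SIGMA p1 : R (src K g) (src K w1). SIGMA p2 : R (src K g) (src K w2).
        {\<alpha> \<in> Ar2 K. src2 K \<alpha> = w1 \<odot> p1 \<and> tgt2 K \<alpha> = w2 \<odot> p2} \<times>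
        {\<beta> \<in> Ar2 K. src2 K \<beta> = f1 \<odot> p1 \<and> tgt2 K \<beta> = f2 \<odot> p2})"
      have fibre: "small \<kappa> ({\<alpha> \<in> Ar2 K. src2 K \<alpha> = w1 \<odot> p1 \<and> tgt2 K \<alpha> = w2 \<odot> p2} \<times>
            {\<beta> \<in> Ar2 K. src2 K \<beta> = f1 \<odot> p1 \<and> tgt2 K \<beta> = f2 \<odot> p2})"
        if g: "g \<in> Vx" and p: "p1 \<in> R (src K g) (src K w1)" "p2 \<in> R (src K g) (src K w2)" for g p1 p2
      proof -
        have p': "p1 \<in> hom (cat1 K) (src K g) (src K w1)" "p2 \<in> hom (cat1 K) (src K g) (src K w2)"
          by (rule R_hom; use p VxD(4)[OF g] w in simp)+
        show ?thesis
        proof (rule small_Sigma[OF \<kappa>])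
          show "small \<kappa> {\<alpha> \<in> Ar2 K. src2 K \<alpha> = w1 \<odot> p1 \<and> tgt2 K \<alpha> = w2 \<odot> p2}"
            by (rule hom_small[of _ "src K g" x]) (use p' w in simp_all)
          show "small \<kappa> {\<beta> \<in> Ar2 K. src2 K \<beta> = f1 \<odot> p1 \<and> tgt2 K \<beta> = f2 \<odot> p2}"
            by (rule hom_small[of _ "src K g" y]) (use p' w in simp_all)
        qed
      qed
      have "src K w1 \<in> Ob K" "src K w2 \<in> Ob K" using w(2,8) by simp_all
      then have "small \<kappa> B"
        unfolding B_def
        by (intro small_UN[OF \<kappa> Vx_small] small_Sigma[OF \<kappa> R_small[OF VxD(4)]] fibre)
      moreover have "hom ?H S T \<subseteq> rep_class S T ` B"
      proof
        fix a assume "a \<in> hom ?H S T"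
        then obtain d where d: "d \<in> reps K W S T" and a: "a = rep_class S T d" unfolding hom_frac by blast
        obtain p1 p2 \<alpha> \<beta> where dd: "d = (p1, p2, \<alpha>, \<beta>)" by (rule prod_cases4)
        note r = repsD[OF d[unfolded S T dd]]
        note [simp] = w(2-6) w(8-12) r(1-11)
        \<comment> \<open>Cofinality is applied to the composite \<open>w1 \<odot> p1\<close>, which
          is in \<open>W\<close>. Hence \<open>s\<close> covers \<open>d\<close>, and the restricted
          representative has the source of an element of \<open>Vx\<close> as its apex.\<close>
        obtain g s \<theta> where g: "g \<in> V" "s \<in> hom (cat1 K) (src K g) (src K (w1 \<odot> p1))"
          "tgt K g = tgt K (w1 \<odot> p1)" and \<theta>: "\<theta> \<in> iso2 K ((w1 \<odot> p1) \<odot> s) g"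
          using cofinal[OF r(12)] by blast
        have gx: "g \<in> Vx" using g by (simp add: Vx_def)
        have s [simp]: "s \<in> Ar1 K" "src K s = src K g" "tgt K s = src K p1" using g by simp_all
        have c: "covers S d s"
          using W_iso2[OF \<theta>] VxD(1)[OF gx] by (simp add: covers_def S dd)
        note ds = restrict_reps[OF ST d c]
        obtain h1 \<gamma>1 where h1: "h1 \<in> R (src K g) (src K w1)" and \<gamma>1: "\<gamma>1 \<in> iso2 K (p1 \<odot> s) h1"
          using R_iso[of "p1 \<odot> s"] by auto
        obtain h2 \<gamma>2 where h2: "h2 \<in> R (src K g) (src K w2)" and \<gamma>2: "\<gamma>2 \<in> iso2 K (p2 \<odot> s) h2"
          using R_iso[of "p2 \<odot> s"] by auto
        obtain \<alpha>' \<beta>' where e: "(h1, h2, \<alpha>', \<beta>') \<in> reps K W S T"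
          and i: "rep_iso S T (p1 \<odot> s, p2 \<odot> s, \<alpha> \<star> id2 K s, \<beta> \<star> id2 K s) (h1, h2, \<alpha>', \<beta>')"
          by (rule rep_transport[OF ST ds[unfolded dd restrict.simps] \<gamma>1 \<gamma>2])
        have "rep_iso S T (restrict d s) (restrict (h1, h2, \<alpha>', \<beta>') (id1 K (apex (h1, h2, \<alpha>', \<beta>'))))"
          using i unfolding restrict_id[OF e ST] by (simp add: dd)
        then have "rep_equiv K W S T d (h1, h2, \<alpha>', \<beta>')"
          using c covers_id[OF e] rep_equiv_iff[OF d e ST] by blast
        then have "a = rep_class S T (h1, h2, \<alpha>', \<beta>')"
          unfolding a using d e by (intro rep_class_eq[OF ST]) (simp add: rep_rel_iff)
        moreover have "(h1, h2, \<alpha>', \<beta>') \<in> B"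
          unfolding B_def using repsD[OF e[unfolded S T]]
          by (intro UN_I[OF gx] SigmaI h1 h2 CollectI conjI)
        ultimately show "a \<in> rep_class S T ` B" by blast
      qed
      ultimately show ?thesis by (rule small_mono[OF small_image])
    qed
  qed
qed

end

theorem proposition3p2:
  fixes K :: "('o, 'a, 'c) two_precategory" and W :: "'a set" and \<kappa> :: "'k rel"
  assumes "size_cardinal \<kappa>"
    and "two_category K"
    and "locally_essentially_small \<kappa> (Ob K) (hom_category K)"
    and "W \<subseteq> Ar1 K"
    and "BF1 K W" and "BF2 K W" and "BF3 K W" and "BF4 K W"
    and "\<exists>V. locally_small_cofinal_class \<kappa> K V W"
  shows "locally_essentially_small \<kappa> (Ob K) (frac_hom_category K W)"
proof -
  interpret fractions K W
    using assms by (simp add: fractions_def fractions_axioms_def)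
  show ?thesis
    unfolding locally_essentially_small_def using essentially_small_frac assms(1,3,9) by blast
qed

end
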